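(* Let $F$ be a field, $\lambda\in F$, and let $A=F1+Fx$ be the superalgebra with identity $1$, $A_{\bar0}=F1$, $A_{\bar1}=Fx$, $x^2=\lambda$. Let $V$ be a unital irreducible faithful alternative $A$-superbimodule which is not associative. Then there exists a simple algebraic field extension $K=F(\alpha)$, $\alpha\ne\lambda$, such that $V$ is a $K$-vector space with $\dim_KV\le4$, and, up to change of parity, $V$ is described as follows. Put $f(s)=s^2+(\alpha-\lambda)s+\alpha(\alpha-2\lambda)\in K[s]$. (i) If $f$ has a root $\epsilon\neq0$ in $K$, then $V=Kv\oplus Kvx$, $V_{\bar0}=Kv$, $V_{\bar1}=Kvx$, with action ($K$-linear) - $V^{\epsilon}_{\alpha,\lambda}(1|1)$, if $\alpha\ne0$: $v\cdot x=vx$, $x\cdot v=\frac{\epsilon}{\alpha}vx$, $vx\cdot x=\alpha v$, $x\cdot vx=(\alpha+\epsilon-\lambda)v$; - $V_\lambda(1|1)$, if $\alpha=0$: $v\cdot x=vx$, $x\cdot v=-2vx$, $vx\cdot x=0$, $x\cdot vx=-\lambda v$. (ii) If $f$ is irreducible over $K$, then $\mathcal U(\alpha)$ is a graded division algebra over $K$ and $V$ is isomorphic to the regular right supermodule over $\mathcal U(\alpha)$. More exactly, $V=V_{\alpha,\lambda}(2|2)$: $\dim_KV=4$, $V$ has a $K$-basis $\{v,\,xv,\,vx,\,x(vx)\}$, $V_{\bar0}=Kv\oplus Kx(vx)$, $V_{\bar1}=Kvx\oplus Kxv$, and the action is $v\cdot x=vx$, $x\cdot v=xv$, $vx\cdot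 x=\alpha v$, $x\cdot vx=x(vx)$, $xv\cdot x=x(vx)+(\lambda-\alpha)v$, $x\cdot xv=(2\lambda-\alpha)v$, $x(vx)\cdot x=(\alpha-\lambda)vx+\alpha\,xv$, $x\cdot x(vx)=(2\lambda-\alpha)vx$. Conversely, for any simple algebraic field extension $K=F(\alpha)$ with $\alpha\ne\lambda$, the superbimodules $V^{\epsilon}_{\alpha,\lambda}(1|1)$ and $V_{\alpha,\lambda}(2|2)$ so defined (each under the respective conditions above) are irreducible and alternative.
   Context: A superalgebra $A=A_{\bar0}\oplus A_{\bar1}$ is alternative if for $a\in A_i,b\in A_j,c\in A_k$ one has $(a,b,c)=(-1)^{jk+1}(a,c,b)$, $(a,b,c)=(-1)^{ij+1}(b,a,c)$, and $(a,a,c)=0$ for $a\in A_{\bar0}$, $c\in A$, where $(x,y,z)=(xy)z-x(yz)$. A superbimodule $V=V_{\bar0}\oplus V_{\bar1}$ is alternative if the split null extension $A\oplus V$ (with $V^2=0$) is an alternative superalgebra. Irreducible: $V\ne0$ with no graded subbimodules except $0,V$. Faithful: $\{a\in A:a\cdot V=V\cdot a=0\}=0$. Associative: $(V,A,A)=0$. Change of parity: $V$ is replaced by $V^{\mathrm{op}}$, the same space with even and odd parts interchanged, left action $(-1)^{|a|}a\cdot v$ and the same right action. Symbols such as $vx$, $xv$, $x(vx)$ name basis vectors. $\mathcal U_1(A)$ is the universal unital multiplicative enveloping superalgebra of $A$; it is generated by $1$ and the odd elements $a=\mathcal R_x$ and $b=\mathcal L_x$, and has basis $\{1,a,b,ab\}$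 over its center $F[t]$, with $a^2=t$, $b^2=t-2\lambda$, $ab+ba=\lambda-t$. $\mathcal U(\alpha)=\mathcal U_1(A)/(t-\alpha)$ denotes its specialization at $t=\alpha$: the associative $K$-superalgebra with basis $\{1,a,b,ab\}$ ($1,ab$ even, $a,b$ odd) and relations $a^2=\alpha$, $b^2=\alpha-2\lambda$, $ab+ba=\lambda-\alpha$. An $A$-superbimodule corresponds to a right module via $w\,a=w\cdot x$, $w\,b=(-1)^{|w|}x\cdot w$ for homogeneous $w$. *)

theory Defs
  imports
    "HOL-Algebra.Algebraic_Closure_Type"
    "HOL-Algebra.Generated_Fields"
    "HOL-Algebra.Polynomial_Divisibility"
    "HOL-Library.Z2"
    "HOL-Library.Product_Plus"
begin

section \<open>Linear algebra over a subfield of a field type\<close>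

text \<open>
  Scalars range over a subset \<open>K\<close> (a subfield) of a field type, because the extension field in
  the classification depends on the bimodule and hence cannot be a type. Over the ground field the
  set of scalars is \<^term>\<open>UNIV\<close>, see \<open>vspace_on_UNIV\<close> below.
\<close>

definition vspace_on :: "'k::field set \<Rightarrow> ('k \<Rightarrow> 'v \<Rightarrow> 'v) \<Rightarrow> 'v::ab_group_add set \<Rightarrow> bool" where
  "vspace_on K s M \<longleftrightarrow>
     0 \<in> M \<and> (\<forall>u\<in>M. \<forall>v\<in>M. u + v \<in> M) \<and> (\<forall>k\<in>K. \<forall>u\<in>M. s k u \<in> M) \<and>
     (\<forall>k\<in>K. \<forall>u\<in>M. \<forall>v\<in>M. s k (u + v) = s k u + s k v) \<and>
     (\<forall>k\<in>K. \<forall>l\<in>K. \<forall>u\<in>M. s (k + l) u = s k u + s l u \<and> s (k * l) u = s k (s l u)) \<and>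
     (\<forall>u\<in>M. s 1 u = u)"

lemma vspace_on_UNIV: "vspace_on UNIV s UNIV \<longleftrightarrow> vector_space s"
  unfolding vspace_on_def vector_space_def by auto

definition linear_on ::
  "'k set \<Rightarrow> ('k \<Rightarrow> 'v \<Rightarrow> 'v) \<Rightarrow> 'v set \<Rightarrow> ('k \<Rightarrow> 'w \<Rightarrow> 'w) \<Rightarrow> ('v::plus \<Rightarrow> 'w::plus) \<Rightarrow> bool" where
  "linear_on K s M t f \<longleftrightarrow>
     (\<forall>u\<in>M. \<forall>v\<in>M. f (u + v) = f u + f v) \<and> (\<forall>k\<in>K. \<forall>u\<in>M. f (s k u) = t k (f u))"

definition bilinear_on ::
  "'k set \<Rightarrow> ('k \<Rightarrow> 'u \<Rightarrow> 'u) \<Rightarrow> 'u set \<Rightarrow> ('k \<Rightarrow> 'v \<Rightarrow> 'v) \<Rightarrow> 'v set \<Rightarrow>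
   ('k \<Rightarrow> 'w \<Rightarrow> 'w) \<Rightarrow> ('u::plus \<Rightarrow> 'v::plus \<Rightarrow> 'w::plus) \<Rightarrow> bool" where
  "bilinear_on K s M t N r f \<longleftrightarrow>
     (\<forall>u\<in>M. linear_on K t N r (\<lambda>v. f u v)) \<and> (\<forall>v\<in>N. linear_on K s M r (\<lambda>u. f u v))"

definition basis_on :: "'k set \<Rightarrow> ('k \<Rightarrow> 'v \<Rightarrow> 'v) \<Rightarrow> 'v::ab_group_add set \<Rightarrow> 'v set \<Rightarrow> bool" where
  "basis_on K s M B \<longleftrightarrow> finite B \<and> B \<subseteq> M \<and>
     (\<forall>u\<in>M. \<exists>!c. c \<in> B \<rightarrow>\<^sub>E K \<and> u = (\<Sum>b\<in>B. s (c b) b))"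

definition has_dim :: "'k set \<Rightarrow> ('k \<Rightarrow> 'v \<Rightarrow> 'v) \<Rightarrow> 'v::ab_group_add set \<Rightarrow> nat \<Rightarrow> bool" where
  "has_dim K s M n \<longleftrightarrow> (\<exists>B. basis_on K s M B \<and> card B = n)"


section \<open>Superspaces, superalgebras, superbimodules\<close>

text \<open>Parities are elements of the two-element field \<^typ>\<open>bit\<close>, with \<open>1 + 1 = 0\<close>.\<close>

record ('k, 'v) superspace =
  scl :: "'k \<Rightarrow> 'v \<Rightarrow> 'v"
  part :: "bit \<Rightarrow> 'v set"

record ('k, 'b) superalgebra = "('k, 'b) superspace" +
  mul :: "'b \<Rightarrow> 'b \<Rightarrow> 'b"

record ('k, 'b, 'v) superbimodule = "('k, 'v) superspace" +
  lact :: "'b \<Rightarrow> 'v \<Rightarrow> 'v"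
  ract :: "'v \<Rightarrow> 'b \<Rightarrow> 'v"

definition carr :: "('k, 'v::ab_group_add, 'm) superspace_scheme \<Rightarrow> 'v set" where
  "carr V = {u + w | u w. u \<in> part V 0 \<and> w \<in> part V 1}"

definition is_superspace ::
  "'k::field set \<Rightarrow> ('k, 'v::ab_group_add, 'm) superspace_scheme \<Rightarrow> bool" where
  "is_superspace K V \<longleftrightarrow>
     vspace_on K (scl V) (carr V) \<and> (\<forall>i. vspace_on K (scl V) (part V i)) \<and>
     part V 0 \<inter> part V 1 = {0}"

text \<open>\<open>psgn i v\<close> is \<open>(-1)\<^sup>i v\<close>.\<close>

definition psgn :: "bit \<Rightarrow> 'v::ab_group_add \<Rightarrow> 'v" where
  "psgn i v = (if i = 0 then v else - v)"

definition is_superalgebra ::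
  "'k::field set \<Rightarrow> ('k, 'b::ab_group_add) superalgebra \<Rightarrow> bool" where
  "is_superalgebra K A \<longleftrightarrow>
     is_superspace K A \<and>
     bilinear_on K (scl A) (carr A) (scl A) (carr A) (scl A) (mul A) \<and>
     (\<forall>i j. \<forall>a\<in>part A i. \<forall>b\<in>part A j. mul A a b \<in> part A (i + j))"

definition associator :: "('k, 'b::ab_group_add) superalgebra \<Rightarrow> 'b \<Rightarrow> 'b \<Rightarrow> 'b \<Rightarrow> 'b" where
  "associator A x y z = mul A (mul A x y) z - mul A x (mul A y z)"

definition alternative_superalgebra ::
  "'k::field set \<Rightarrow> ('k, 'b::ab_group_add) superalgebra \<Rightarrow> bool" where
  "alternative_superalgebra K A \<longleftrightarrow>
     is_superalgebra K A \<and>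
     (\<forall>i j k. \<forall>a\<in>part A i. \<forall>b\<in>part A j. \<forall>c\<in>part A k.
        associator A a b c = psgn (j * k + 1) (associator A a c b) \<and>
        associator A a b c = psgn (i * j + 1) (associator A b a c)) \<and>
     (\<forall>a\<in>part A 0. \<forall>c\<in>carr A. associator A a a c = 0)"

definition is_superbimodule ::
  "'k::field set \<Rightarrow> ('k, 'b::ab_group_add) superalgebra \<Rightarrow>
   ('k, 'b, 'v::ab_group_add) superbimodule \<Rightarrow> bool" where
  "is_superbimodule K A V \<longleftrightarrow>
     is_superspace K V \<and>
     bilinear_on K (scl A) (carr A) (scl V) (carr V) (scl V) (lact V) \<and>
     bilinear_on K (scl V) (carr V) (scl A) (carr A) (scl V) (ract V) \<and>
     (\<forall>i j. \<forall>a\<in>part A i. \<forall>v\<in>part V j. lact V a v \<in> part V (i + j) \<and> ract V v a \<in> part V (i + j))"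

definition split_null ::
  "('k, 'b::ab_group_add) superalgebra \<Rightarrow> ('k, 'b, 'v::ab_group_add) superbimodule \<Rightarrow>
   ('k, 'b \<times> 'v) superalgebra" where
  "split_null A V =
     \<lparr> scl = (\<lambda>k (a, v). (scl A k a, scl V k v)),
       part = (\<lambda>i. part A i \<times> part V i),
       mul = (\<lambda>(a, v) (b, w). (mul A a b, lact V a w + ract V v b)) \<rparr>"

definition alternative_bimodule ::
  "'k::field set \<Rightarrow> ('k, 'b::ab_group_add) superalgebra \<Rightarrow>
   ('k, 'b, 'v::ab_group_add) superbimodule \<Rightarrow> bool" where
  "alternative_bimodule K A V \<longleftrightarrow>
     is_superbimodule K A V \<and> alternative_superalgebra K (split_null A V)"

definition unital_bimodule :: "'b \<Rightarrow> ('k, 'b, 'v::ab_group_add) superbimodule \<Rightarrow> bool" where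
  "unital_bimodule e V \<longleftrightarrow> (\<forall>v\<in>carr V. lact V e v = v \<and> ract V v e = v)"

definition graded_subbimodule ::
  "'k::field set \<Rightarrow> ('k, 'b::ab_group_add) superalgebra \<Rightarrow>
   ('k, 'b, 'v::ab_group_add) superbimodule \<Rightarrow> 'v set \<Rightarrow> bool" where
  "graded_subbimodule K A V W \<longleftrightarrow>
     W \<subseteq> carr V \<and> vspace_on K (scl V) W \<and>
     W = {u + w | u w. u \<in> W \<inter> part V 0 \<and> w \<in> W \<inter> part V 1} \<and>
     (\<forall>a\<in>carr A. \<forall>w\<in>W. lact V a w \<in> W \<and> ract V w a \<in> W)"

definition irreducible_bimodule ::
  "'k::field set \<Rightarrow> ('k, 'b::ab_group_add) superalgebra \<Rightarrow>
   ('k, 'b, 'v::ab_group_add) superbimodule \<Rightarrow> bool" where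
  "irreducible_bimodule K A V \<longleftrightarrow>
     carr V \<noteq> {0} \<and> (\<forall>W. graded_subbimodule K A V W \<longrightarrow> W = {0} \<or> W = carr V)"

definition faithful_bimodule ::
  "('k, 'b::ab_group_add) superalgebra \<Rightarrow> ('k, 'b, 'v::ab_group_add) superbimodule \<Rightarrow> bool" where
  "faithful_bimodule A V \<longleftrightarrow>
     {a \<in> carr A. \<forall>v\<in>carr V. lact V a v = 0 \<and> ract V v a = 0} = {0}"

definition associative_bimodule ::
  "('k, 'b::ab_group_add) superalgebra \<Rightarrow> ('k, 'b, 'v::ab_group_add) superbimodule \<Rightarrow> bool" where
  "associative_bimodule A V \<longleftrightarrow>
     (\<forall>v\<in>carr V. \<forall>a\<in>carr A. \<forall>b\<in>carr A. ract V (ract V v a) b - ract V v (mul A a b) = 0)"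

text \<open>The linear map \<open>a \<mapsto> (-1)\<^bsup>|a|\<^esup> a\<close>.\<close>

definition grade_inv :: "('k, 'b::ab_group_add) superalgebra \<Rightarrow> 'b \<Rightarrow> 'b" where
  "grade_inv A a = (THE b. \<exists>a0\<in>part A 0. \<exists>a1\<in>part A 1. a = a0 + a1 \<and> b = a0 - a1)"

definition parity_change ::
  "('c, 'b::ab_group_add) superalgebra \<Rightarrow> ('k, 'b, 'v) superbimodule \<Rightarrow>
   ('k, 'b, 'v) superbimodule" where
  "parity_change A V =
     V \<lparr> part := (\<lambda>i. part V (i + 1)), lact := (\<lambda>a v. lact V (grade_inv A a) v) \<rparr>"

text \<open>The same graded additive group and actions, with another field of scalars.\<close>

definition with_scl :: "('l \<Rightarrow> 'v \<Rightarrow> 'v) \<Rightarrow> ('k, 'b, 'v) superbimodule \<Rightarrow> ('l, 'b, 'v) superbimodule" where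
  "with_scl s V = \<lparr> scl = s, part = part V, lact = lact V, ract = ract V \<rparr>"

definition restrict_scalars ::
  "('f \<Rightarrow> 'e) \<Rightarrow> ('e, 'b, 'v) superbimodule \<Rightarrow> ('f, 'b, 'v) superbimodule" where
  "restrict_scalars \<iota> V = with_scl (\<lambda>c. scl V (\<iota> c)) V"

text \<open>
  \<open>s\<close> makes the superbimodule \<open>V\<close> a vector space over \<open>K\<close>, extending the given scalar
  multiplication along the embedding \<open>\<iota>\<close> of the ground field, with \<open>K\<close>-linear action of \<open>A\<close>.
\<close>

definition scalar_extension ::
  "'e::field set \<Rightarrow> ('f \<Rightarrow> 'e) \<Rightarrow> ('f, 'b::ab_group_add) superalgebra \<Rightarrow>
   ('f, 'b, 'v::ab_group_add) superbimodule \<Rightarrow> ('e \<Rightarrow> 'v \<Rightarrow> 'v) \<Rightarrow> bool" where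
  "scalar_extension K \<iota> A V s \<longleftrightarrow>
     is_superspace K (with_scl s V) \<and>
     (\<forall>c. \<forall>v\<in>carr V. s (\<iota> c) v = scl V c v) \<and>
     (\<forall>a\<in>carr A. linear_on K s (carr V) s (lact V a) \<and> linear_on K s (carr V) s (\<lambda>v. ract V v a))"

definition superspace_iso ::
  "'k set \<Rightarrow> ('k, 'v::ab_group_add, 'm) superspace_scheme \<Rightarrow>
   ('k, 'w::ab_group_add, 'n) superspace_scheme \<Rightarrow> ('v \<Rightarrow> 'w) \<Rightarrow> bool" where
  "superspace_iso K V W \<phi> \<longleftrightarrow>
     bij_betw \<phi> (carr V) (carr W) \<and> (\<forall>i. \<phi> ` part V i = part W i) \<and>
     linear_on K (scl V) (carr V) (scl W) \<phi>"

definition isomorphic_bimodules ::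
  "'k set \<Rightarrow> ('c, 'b::ab_group_add) superalgebra \<Rightarrow> ('k, 'b, 'v::ab_group_add) superbimodule \<Rightarrow>
   ('k, 'b, 'w::ab_group_add) superbimodule \<Rightarrow> bool" where
  "isomorphic_bimodules K A V W \<longleftrightarrow>
     (\<exists>\<phi>. superspace_iso K V W \<phi> \<and>
        (\<forall>a\<in>carr A. \<forall>v\<in>carr V. \<phi> (lact V a v) = lact W a (\<phi> v) \<and> \<phi> (ract V v a) = ract W (\<phi> v) a))"


section \<open>Associative superalgebras and right supermodules\<close>

definition unital_associative_superalgebra ::
  "'k::field set \<Rightarrow> ('k, 'b::ab_group_add) superalgebra \<Rightarrow> 'b \<Rightarrow> bool" where
  "unital_associative_superalgebra K U e \<longleftrightarrow>
     is_superalgebra K U \<and>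
     (\<forall>x\<in>carr U. \<forall>y\<in>carr U. \<forall>z\<in>carr U. associator U x y z = 0) \<and>
     e \<in> part U 0 \<and> (\<forall>x\<in>carr U. mul U e x = x \<and> mul U x e = x)"

definition graded_division_algebra ::
  "'k::field set \<Rightarrow> ('k, 'b::ab_group_add) superalgebra \<Rightarrow> 'b \<Rightarrow> bool" where
  "graded_division_algebra K U e \<longleftrightarrow>
     unital_associative_superalgebra K U e \<and> e \<noteq> 0 \<and>
     (\<forall>i. \<forall>u\<in>part U i. u \<noteq> 0 \<longrightarrow> (\<exists>w\<in>carr U. mul U u w = e \<and> mul U w u = e))"

definition right_supermodule ::
  "'k::field set \<Rightarrow> ('k, 'b::ab_group_add) superalgebra \<Rightarrow> 'b \<Rightarrow>
   ('k, 'v::ab_group_add, 'm) superspace_scheme \<Rightarrow> ('v \<Rightarrow> 'b \<Rightarrow> 'v) \<Rightarrow> bool" where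
  "right_supermodule K U e W act \<longleftrightarrow>
     is_superspace K W \<and>
     bilinear_on K (scl W) (carr W) (scl U) (carr U) (scl W) act \<and>
     (\<forall>i j. \<forall>w\<in>part W i. \<forall>u\<in>part U j. act w u \<in> part W (i + j)) \<and>
     (\<forall>w\<in>carr W. act w e = w) \<and>
     (\<forall>w\<in>carr W. \<forall>u\<in>carr U. \<forall>u'\<in>carr U. act w (mul U u u') = act (act w u) u')"

definition isomorphic_to_regular ::
  "'k::field set \<Rightarrow> ('k, 'b::ab_group_add) superalgebra \<Rightarrow>
   ('k, 'v::ab_group_add, 'm) superspace_scheme \<Rightarrow> ('v \<Rightarrow> 'b \<Rightarrow> 'v) \<Rightarrow> bool" where
  "isomorphic_to_regular K U W act \<longleftrightarrow>
     (\<exists>\<phi>. superspace_iso K U W \<phi> \<and> (\<forall>u\<in>carr U. \<forall>u'\<in>carr U. \<phi> (mul U u u') = act (\<phi> u) u'))"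


section \<open>Simple algebraic extensions\<close>

text \<open>
  A field extension is given by an embedding \<open>\<iota>\<close> of the ground field into a field type; the
  extension \<open>F(\<alpha>)\<close> is the subfield generated by the image of \<open>\<iota>\<close> and \<open>\<alpha>\<close>.
\<close>

definition field_embedding :: "('f::field \<Rightarrow> 'e::field) \<Rightarrow> bool" where
  "field_embedding \<iota> \<longleftrightarrow> \<iota> \<in> ring_hom ring_of_type_algebra ring_of_type_algebra"

definition algebraic_elem :: "('f::field \<Rightarrow> 'e::field) \<Rightarrow> 'e \<Rightarrow> bool" where
  "algebraic_elem \<iota> \<alpha> \<longleftrightarrow> (\<exists>p::'f poly. p \<noteq> 0 \<and> poly (map_poly \<iota> p) \<alpha> = 0)"

definition adjoin :: "('f::field \<Rightarrow> 'e::field) \<Rightarrow> 'e \<Rightarrow> 'e set" where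
  "adjoin \<iota> \<alpha> = generate_field ring_of_type_algebra (insert \<alpha> (range \<iota>))"


section \<open>The superalgebra \<open>A = F1 + Fx\<close>, its enveloping algebras and bimodules\<close>

text \<open>\<open>(c, d)\<close> is \<open>c1 + dx\<close>.\<close>

definition algA :: "'f::field \<Rightarrow> ('f, 'f \<times> 'f) superalgebra" where
  "algA lam =
     \<lparr> scl = (\<lambda>k (c, d). (k * c, k * d)),
       part = (\<lambda>i. if i = 0 then UNIV \<times> {0} else {0} \<times> UNIV),
       mul = (\<lambda>(c, d) (c', d'). (c * c' + lam * (d * d'), c * d' + d * c')) \<rparr>"

abbreviation oneA :: "'f::field \<times> 'f" where "oneA \<equiv> (1, 0)"
abbreviation xA :: "'f::field \<times> 'f" where "xA \<equiv> (0, 1)"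

text \<open>
  The polynomial \<open>s\<^sup>2 + (\<alpha> - \<lambda>)s + \<alpha>(\<alpha> - 2\<lambda>)\<close>; in HOL-Algebra polynomials are lists of
  coefficients with the leading coefficient first.
\<close>

definition fpoly :: "'e::field \<Rightarrow> 'e \<Rightarrow> 'e list" where
  "fpoly \<alpha> l = [1, \<alpha> - l, \<alpha> * (\<alpha> - 2 * l)]"

definition nonzero_root :: "'e::field set \<Rightarrow> 'e list \<Rightarrow> 'e \<Rightarrow> bool" where
  "nonzero_root K p \<epsilon> \<longleftrightarrow> \<epsilon> \<in> K \<and> \<epsilon> \<noteq> 0 \<and> ring.eval ring_of_type_algebra p \<epsilon> = 0"

definition irreducible_over :: "'e::field set \<Rightarrow> 'e list \<Rightarrow> bool" where
  "irreducible_over K p \<longleftrightarrow> pirreducible\<^bsub>ring_of_type_algebra\<^esub> K p"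

lemma eval_fpoly:
  "ring.eval ring_of_type_algebra (fpoly \<alpha> l) \<epsilon> =
     \<epsilon>\<^sup>2 + (\<alpha> - l) * \<epsilon> + \<alpha> * (\<alpha> - 2 * l)"
proof -
  interpret R: ring "ring_of_type_algebra :: 'a ring" by (rule ring_from_type_algebra)
  show ?thesis
    by (simp add: fpoly_def R.nat_pow_Suc numeral_2_eq_2)
       (simp add: ring_of_type_algebra_def power2_eq_square algebra_simps)
qed

text \<open>
  \<open>\<U>(\<alpha>)\<close>: \<open>(p, q, r, s)\<close> is \<open>p1 + qa + rb + s(ab)\<close>. The multiplication table is forced by
  associativity and \<open>a\<^sup>2 = \<alpha>\<close>, \<open>b\<^sup>2 = \<alpha> - 2\<lambda>\<close>, \<open>ab + ba = \<lambda> - \<alpha>\<close>; for instance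
  \<open>ba = (\<lambda> - \<alpha>) - ab\<close> and \<open>b(ab) = (\<lambda> - \<alpha>)b - (\<alpha> - 2\<lambda>)a\<close>. See \<open>Ualg_relations\<close> and
  \<open>Ualg_associative\<close>. Here \<open>l\<close> is the image of \<open>\<lambda>\<close> in the extension field.
\<close>

definition Ualg :: "'e::field set \<Rightarrow> 'e \<Rightarrow> 'e \<Rightarrow> ('e, 'e \<times> 'e \<times> 'e \<times> 'e) superalgebra" where
  "Ualg K \<alpha> l =
     \<lparr> scl = (\<lambda>k (p, q, r, s). (k * p, k * q, k * r, k * s)),
       part = (\<lambda>i. if i = 0 then K \<times> {0} \<times> {0} \<times> K else {0} \<times> K \<times> K \<times> {0}),
       mul = (\<lambda>(p, q, r, s) (p', q', r', s').
         (p * p' + \<alpha> * q * q' + (l - \<alpha>) * r * q' + (\<alpha> - 2 * l) * r * r'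
            - \<alpha> * (\<alpha> - 2 * l) * s * s',
          p * q' + q * p' - (\<alpha> - 2 * l) * r * s' + (l - \<alpha>) * s * q' + (\<alpha> - 2 * l) * s * r',
          p * r' + r * p' + \<alpha> * q * s' + (l - \<alpha>) * r * s' - \<alpha> * s * q',
          p * s' + s * p' + q * r' - r * q' + (l - \<alpha>) * s * s')) \<rparr>"

abbreviation oneU :: "'e::field \<times> 'e \<times> 'e \<times> 'e" where "oneU \<equiv> (1, 0, 0, 0)"
abbreviation aU :: "'e::field \<times> 'e \<times> 'e \<times> 'e" where "aU \<equiv> (0, 1, 0, 0)"
abbreviation bU :: "'e::field \<times> 'e \<times> 'e \<times> 'e" where "bU \<equiv> (0, 0, 1, 0)"
abbreviation abU :: "'e::field \<times> 'e \<times> 'e \<times> 'e" where "abU \<equiv> (0, 0, 0, 1)"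

lemma Ualg_relations:
  fixes K :: "'e::field set" and \<alpha> l :: 'e
  defines "m \<equiv> mul (Ualg K \<alpha> l)" and "sc \<equiv> scl (Ualg K \<alpha> l)"
  shows "m aU aU = sc \<alpha> oneU"
    and "m bU bU = sc (\<alpha> - 2 * l) oneU"
    and "m aU bU + m bU aU = sc (l - \<alpha>) oneU"
    and "m aU bU = abU"
    and "m oneU u = u" and "m u oneU = u"
  by (cases u; simp add: m_def sc_def Ualg_def)+

lemma Ualg_associative: "associator (Ualg K \<alpha> l) u u' u'' = 0"
  by (cases u; cases u'; cases u'') (simp add: associator_def Ualg_def zero_prod_def algebra_simps)

text \<open>
  The superbimodule over \<open>A\<close> on which \<open>1\<close> acts identically and \<open>x\<close> acts from the left by \<open>L\<close>
  and from the right by \<open>R\<close>.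
\<close>

definition bimodule_by_x ::
  "('f \<Rightarrow> 'e) \<Rightarrow> ('e \<Rightarrow> 'v::ab_group_add \<Rightarrow> 'v) \<Rightarrow> (bit \<Rightarrow> 'v set) \<Rightarrow> ('v \<Rightarrow> 'v) \<Rightarrow> ('v \<Rightarrow> 'v) \<Rightarrow>
   ('e, 'f \<times> 'f, 'v) superbimodule" where
  "bimodule_by_x \<iota> sc P L R =
     \<lparr> scl = sc, part = P,
       lact = (\<lambda>(c, d) w. sc (\<iota> c) w + sc (\<iota> d) (L w)),
       ract = (\<lambda>w (c, d). sc (\<iota> c) w + sc (\<iota> d) (R w)) \<rparr>"

text \<open>\<open>V\<^sup>\<epsilon>\<^sub>\<alpha>\<^sub>,\<^sub>\<lambda>(1|1)\<close> and \<open>V\<^sub>\<lambda>(1|1)\<close>: \<open>(p, q)\<close> is \<open>pv + q(vx)\<close>.\<close>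

definition V11 ::
  "'e::field set \<Rightarrow> ('f \<Rightarrow> 'e) \<Rightarrow> 'e \<Rightarrow> 'e \<Rightarrow> 'e \<Rightarrow> ('e, 'f \<times> 'f, 'e \<times> 'e) superbimodule" where
  "V11 K \<iota> \<epsilon> \<alpha> l =
     bimodule_by_x \<iota> (\<lambda>k (p, q). (k * p, k * q))
       (\<lambda>i. if i = 0 then K \<times> {0} else {0} \<times> K)
       (\<lambda>(p, q). (q * (\<alpha> + \<epsilon> - l), p * (\<epsilon> / \<alpha>)))
       (\<lambda>(p, q). (q * \<alpha>, p))"

definition V11_zero ::
  "'e::field set \<Rightarrow> ('f \<Rightarrow> 'e) \<Rightarrow> 'e \<Rightarrow> ('e, 'f \<times> 'f, 'e \<times> 'e) superbimodule" where
  "V11_zero K \<iota> l =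
     bimodule_by_x \<iota> (\<lambda>k (p, q). (k * p, k * q))
       (\<lambda>i. if i = 0 then K \<times> {0} else {0} \<times> K)
       (\<lambda>(p, q). (q * (- l), p * (- 2)))
       (\<lambda>(p, q). (0, p))"

text \<open>\<open>V\<^sub>\<alpha>\<^sub>,\<^sub>\<lambda>(2|2)\<close>: \<open>(p, q, r, s)\<close> is \<open>pv + q(xv) + r(vx) + s(x(vx))\<close>.\<close>

definition V22 ::
  "'e::field set \<Rightarrow> ('f \<Rightarrow> 'e) \<Rightarrow> 'e \<Rightarrow> 'e \<Rightarrow> ('e, 'f \<times> 'f, 'e \<times> 'e \<times> 'e \<times> 'e) superbimodule" where
  "V22 K \<iota> \<alpha> l =
     bimodule_by_x \<iota> (\<lambda>k (p, q, r, s). (k * p, k * q, k * r, k * s))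
       (\<lambda>i. if i = 0 then K \<times> {0} \<times> {0} \<times> K else {0} \<times> K \<times> K \<times> {0})
       (\<lambda>(p, q, r, s). (q * (2 * l - \<alpha>), p, s * (2 * l - \<alpha>), r))
       (\<lambda>(p, q, r, s). (q * (l - \<alpha>) + r * \<alpha>, s * \<alpha>, p + s * (\<alpha> - l), q))"

lemma V11_table:
  fixes K :: "'e::field set" and \<epsilon> \<alpha> l :: 'e
  assumes "\<iota> 0 = 0" "\<iota> 1 = 1"
  defines "L \<equiv> lact (V11 K \<iota> \<epsilon> \<alpha> l) xA" and "R \<equiv> \<lambda>w. ract (V11 K \<iota> \<epsilon> \<alpha> l) w xA"
    and "sc \<equiv> scl (V11 K \<iota> \<epsilon> \<alpha> l)"
    and "v \<equiv> (1, 0)" and "vx \<equiv> (0, 1)"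
  shows "R v = vx" and "L v = sc (\<epsilon> / \<alpha>) vx" and "R vx = sc \<alpha> v"
    and "L vx = sc (\<alpha> + \<epsilon> - l) v"
  by (simp_all add: assms V11_def bimodule_by_x_def)

lemma V11_zero_table:
  fixes K :: "'e::field set" and l :: 'e
  assumes "\<iota> 0 = 0" "\<iota> 1 = 1"
  defines "L \<equiv> lact (V11_zero K \<iota> l) xA" and "R \<equiv> \<lambda>w. ract (V11_zero K \<iota> l) w xA"
    and "sc \<equiv> scl (V11_zero K \<iota> l)"
    and "v \<equiv> (1, 0)" and "vx \<equiv> (0, 1)"
  shows "R v = vx" and "L v = sc (- 2) vx" and "R vx = 0" and "L vx = sc (- l) v"
  by (simp_all add: assms V11_zero_def bimodule_by_x_def zero_prod_def)

lemma V22_table: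
  fixes K :: "'e::field set" and \<alpha> l :: 'e
  assumes "\<iota> 0 = 0" "\<iota> 1 = 1"
  defines "L \<equiv> lact (V22 K \<iota> \<alpha> l) xA" and "R \<equiv> \<lambda>w. ract (V22 K \<iota> \<alpha> l) w xA"
    and "sc \<equiv> scl (V22 K \<iota> \<alpha> l)"
    and "v \<equiv> (1, 0, 0, 0)" and "xv \<equiv> (0, 1, 0, 0)"
    and "vx \<equiv> (0, 0, 1, 0)" and "xvx \<equiv> (0, 0, 0, 1)"
  shows "R v = vx" and "L v = xv" and "R vx = sc \<alpha> v" and "L vx = xvx"
    and "R xv = xvx + sc (l - \<alpha>) v" and "L xv = sc (2 * l - \<alpha>) v"
    and "R xvx = sc (\<alpha> - l) vx + sc \<alpha> xv" and "L xvx = sc (2 * l - \<alpha>) vx"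
  by (simp_all add: assms V22_def bimodule_by_x_def)

end

theory Submission
  imports Defs
begin

text \<open>
  Write \<open>a\<close> for right multiplication by \<open>x\<close> on a unital bimodule and \<open>b\<close> for the signed left multiplication
  \<open>w \<mapsto> (-1)\<^sup>i xw\<close>, \<open>w\<close> of parity \<open>i\<close>. In the split null extension only the associators of
  one vector with two copies of \<open>x\<close> matter, and super-alternativity says exactly that
  \<open>b\<^sup>2 = a\<^sup>2 - 2\<lambda>\<close> and \<open>ab + ba = \<lambda> - a\<^sup>2\<close>
  (\<open>alternative_bimodule_realized\<close>, \<open>realized_over_ground.alternative\<close>). Everything else is the
  study of graded spaces with two such odd operators.

  The even operator \<open>t = a\<^sup>2\<close> commutes with \<open>a\<close> and \<open>b\<close>, so by Schur's argument every polynomial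
  in \<open>t\<close> is zero or surjective on an irreducible \<open>V\<close>. As \<open>V\<close> is generated over \<open>F[t]\<close> by
  \<open>v, va, vb, vab\<close> for any homogeneous \<open>v \<noteq> 0\<close>, not all nonzero polynomials in \<open>t\<close> can be
  surjective: a finitely generated divisible module over \<open>F[t]\<close> vanishes. Hence a nonzero
  polynomial in \<open>t\<close> annihilates \<open>V\<close>; a root \<open>\<alpha>\<close> of the one of least degree turns \<open>V\<close> into a space over \<open>K = F(\<alpha>)\<close> on which \<open>t\<close> is
  multiplication by \<open>\<alpha>\<close>, that is, into a graded irreducible right module over \<open>\<U>(\<alpha>)\<close>
  (\<open>irreducible_x_module.extended_scalars\<close>). The bimodule is associative when \<open>\<alpha> = \<lambda>\<close>.

  Over \<open>K\<close> there are two cases. For \<open>\<rho> \<in> K\<close> the odd element \<open>n = b - \<rho>a\<close> has square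
  \<open>\<rho>\<^sup>2\<alpha> - \<rho>(\<lambda> - \<alpha>) + \<alpha> - 2\<lambda>\<close>, which vanishes for \<open>\<rho> = \<epsilon>/\<alpha>\<close> if \<open>\<epsilon>\<close> is a root of \<open>f\<close> and
  \<open>\<alpha> \<noteq> 0\<close>, and for \<open>\<rho> = -2\<close> if \<open>\<alpha> = 0\<close>. Then \<open>n\<close> kills some homogeneous \<open>v \<noteq> 0\<close>, the space
  \<open>Kv + Kva\<close> is stable under \<open>a\<close> and \<open>b\<close>, and \<open>V\<close> is the two-dimensional module
  (\<open>eigen_module.isomorphic_two_dim\<close>). If \<open>f\<close> has no root in \<open>K\<close>, the norms of the homogeneous
  elements of \<open>\<U>(\<alpha>)\<close> that are not multiples of \<open>1\<close> or \<open>a\<close> are, up to nonzero factors, values of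
  \<open>f\<close>, so \<open>\<U>(\<alpha>)\<close> is a graded division algebra and \<open>u \<mapsto> vu\<close> identifies it with \<open>V\<close>
  (\<open>eigen_module.regular_iso\<close>). One of the cases always occurs, because the roots of \<open>f\<close> add up to
  \<open>\<lambda> - \<alpha> \<noteq> 0\<close> and so a root \<open>0\<close> comes with a nonzero root.

  For the converse, the explicit operators satisfy the two relations, and an \<open>F\<close>-subspace stable under
  \<open>a\<close> is stable under \<open>K = F[\<alpha>]\<close> because \<open>a\<^sup>2 = \<alpha>\<close> (\<open>restrict_irreducible\<close>). Over \<open>K\<close> the
  two-dimensional module is irreducible because \<open>v\<close> and \<open>vx\<close> generate each other, and the
  four-dimensional one because it is regular over a graded division algebra.
\<close>

section \<open>Simple algebraic extensions\<close>

text \<open>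
  Division with remainder by an element of least degree; it is applied to annihilators of modules, to
  kernels of evaluations and to sums of two principal ideals.
\<close>

lemma poly_ideal_principal:
  fixes J :: "'f::field poly set"
  assumes add: "\<And>p q. p \<in> J \<Longrightarrow> q \<in> J \<Longrightarrow> p + q \<in> J"
    and mult: "\<And>r p. p \<in> J \<Longrightarrow> r * p \<in> J"
    and "p \<in> J" "p \<noteq> 0"
  obtains d where "d \<in> J" "d \<noteq> 0" "\<And>q. q \<in> J \<Longrightarrow> d dvd q"
proof -
  obtain d where d: "d \<in> J" "d \<noteq> 0"
    and least: "\<And>q. q \<in> J \<Longrightarrow> q \<noteq> 0 \<Longrightarrow> Polynomial.degree d \<le> Polynomial.degree q"
    using ex_has_least_nat[of "\<lambda>q. q \<in> J \<and> q \<noteq> 0" p Polynomial.degree] assms(3,4) by auto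
  have "d dvd q" if "q \<in> J" for q
  proof -
    have "q mod d = q + (- (q div d)) * d"
      by (simp add: minus_div_mult_eq_mod [symmetric])
    then have "q mod d \<in> J"
      using add mult d(1) that by metis
    then have "q mod d = 0"
      using least[of "q mod d"] degree_mod_less[of d q] d(2) by fastforce
    then show ?thesis by (simp add: mod_eq_0_iff_dvd)
  qed
  with d show ?thesis using that by blast
qed

text \<open>
  Closure of a subset of a field type under the field operations; as \<open>inverse 0 = 0\<close>, zero needs no
  exception.
\<close>

definition is_subfield :: "'e::field set \<Rightarrow> bool" where
  "is_subfield K \<longleftrightarrow> 1 \<in> K \<and> (\<forall>x\<in>K. \<forall>y\<in>K. x + y \<in> K \<and> x * y \<in> K) \<and>
     (\<forall>x\<in>K. - x \<in> K \<and> inverse x \<in> K)"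

lemma is_subfield_UNIV: "is_subfield UNIV"
  by (simp add: is_subfield_def)

context
  fixes K :: "'e::field set"
  assumes K: "is_subfield K"
begin

lemma subfield_1: "1 \<in> K"
  and subfield_add: "x \<in> K \<Longrightarrow> y \<in> K \<Longrightarrow> x + y \<in> K"
  and subfield_mult: "x \<in> K \<Longrightarrow> y \<in> K \<Longrightarrow> x * y \<in> K"
  and subfield_uminus: "x \<in> K \<Longrightarrow> - x \<in> K"
  and subfield_inverse: "x \<in> K \<Longrightarrow> inverse x \<in> K"
  using K by (auto simp: is_subfield_def)

lemma subfield_0: "0 \<in> K"
  using subfield_add[OF subfield_1 subfield_uminus[OF subfield_1]] by simp

lemma subfield_diff: "x \<in> K \<Longrightarrow> y \<in> K \<Longrightarrow> x - y \<in> K"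
  using subfield_add[OF _ subfield_uminus] by fastforce

lemma subfield_divide: "x \<in> K \<Longrightarrow> y \<in> K \<Longrightarrow> x / y \<in> K"
  by (simp add: divide_inverse subfield_mult subfield_inverse)

lemma subfield_numeral: "numeral n \<in> K"
  by (induction n) (simp_all only: numeral.simps subfield_1 subfield_add)

lemmas subfield_closed = subfield_0 subfield_1 subfield_add subfield_mult subfield_uminus
  subfield_inverse subfield_diff subfield_divide subfield_numeral

end

lemma ring_of_type_simps [simp]:
  "carrier (ring_of_type_algebra :: 'e::field ring) = UNIV"
  "x \<oplus>\<^bsub>ring_of_type_algebra\<^esub> y = x + (y :: 'e)"
  "x \<otimes>\<^bsub>ring_of_type_algebra\<^esub> y = x * (y :: 'e)"
  "\<one>\<^bsub>ring_of_type_algebra\<^esub> = (1 :: 'e)"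
  "\<zero>\<^bsub>ring_of_type_algebra\<^esub> = (0 :: 'e)"
  by (simp_all add: ring_of_type_algebra_def)

lemma ring_of_type_uminus [simp]: "\<ominus>\<^bsub>ring_of_type_algebra\<^esub> x = - (x :: 'e::field)"
proof -
  interpret R: field "ring_of_type_algebra :: 'e ring" by (rule field_from_type_algebra)
  have "- x \<oplus>\<^bsub>ring_of_type_algebra\<^esub> x = \<zero>\<^bsub>ring_of_type_algebra\<^esub>"
    unfolding ring_of_type_simps by simp
  then show ?thesis
    by (intro R.minus_equality) simp_all
qed

lemma ring_of_type_inverse [simp]:
  assumes "x \<noteq> (0 :: 'e::field)"
  shows "inv\<^bsub>ring_of_type_algebra\<^esub> x = inverse x"
proof -
  interpret R: field "ring_of_type_algebra :: 'e ring" by (rule field_from_type_algebra)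
  show ?thesis using assms
    by (intro R.comm_inv_char) simp_all
qed

lemma field_embedding_hom:
  assumes "field_embedding \<iota>"
  shows "\<iota> 0 = 0" "\<iota> 1 = 1" "\<iota> (x + y) = \<iota> x + \<iota> y" "\<iota> (x * y) = \<iota> x * \<iota> y"
    "\<iota> (- x) = - \<iota> x" "\<iota> x = 0 \<longleftrightarrow> x = 0" "\<iota> (x - y) = \<iota> x - \<iota> y"
proof -
  have add: "\<iota> (x + y) = \<iota> x + \<iota> y" for x y
    using assms by (auto simp: field_embedding_def ring_hom_def)
  have mult: "\<iota> (x * y) = \<iota> x * \<iota> y" for x y
    using assms by (auto simp: field_embedding_def ring_hom_def)
  have one: "\<iota> 1 = 1"
    using assms by (auto simp: field_embedding_def ring_hom_def)
  have zero: "\<iota> 0 = 0"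
    using add[of 0 0] by (metis add_cancel_right_right add_0)
  have minus: "\<iota> (- x) = - \<iota> x" for x
    using add[of x "- x"] zero by (simp add: eq_neg_iff_add_eq_0 add.commute)
  show "\<iota> 0 = 0" "\<iota> 1 = 1" "\<iota> (x + y) = \<iota> x + \<iota> y" "\<iota> (x * y) = \<iota> x * \<iota> y" "\<iota> (- x) = - \<iota> x"
    using add mult one zero minus by auto
  show "\<iota> (x - y) = \<iota> x - \<iota> y"
    using add[of x "- y"] minus by simp
  show "\<iota> x = 0 \<longleftrightarrow> x = 0"
    using mult[of x "inverse x"] one zero by (metis mult_zero_left right_inverse zero_neq_one)
qed

lemma field_embedding_to_ac: "field_embedding to_ac"
  by (auto simp: field_embedding_def ring_hom_def)

lemma is_subfield_adjoin: "is_subfield (adjoin \<iota> \<alpha>)"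
proof -
  let ?G = "generate_field ring_of_type_algebra (insert \<alpha> (range \<iota>))"
  note rules = generate_field.intros[where R = ring_of_type_algebra and H = "insert \<alpha> (range \<iota>)",
      unfolded ring_of_type_simps ring_of_type_uminus]
  have "inverse x \<in> ?G" if x: "x \<in> ?G" for x
  proof (cases "x = 0")
    case False
    then show ?thesis using rules(4)[OF x] by simp
  qed (use x in simp)
  then show ?thesis
    unfolding is_subfield_def adjoin_def using rules by auto
qed

lemma adjoin_incl: "\<alpha> \<in> adjoin \<iota> \<alpha>" "\<iota> c \<in> adjoin \<iota> \<alpha>"
  by (auto simp: adjoin_def intro: generate_field.incl)

lemma adjoin_least:
  assumes "is_subfield E" "\<alpha> \<in> E" "range \<iota> \<subseteq> E"
  shows "adjoin \<iota> \<alpha> \<subseteq> E"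
proof
  fix x
  assume "x \<in> adjoin \<iota> \<alpha>"
  then show "x \<in> E"
    unfolding adjoin_def
    by induction (use assms in \<open>auto simp: is_subfield_def\<close>)
qed

definition eval_at :: "('f::field \<Rightarrow> 'e::field) \<Rightarrow> 'e \<Rightarrow> 'f poly \<Rightarrow> 'e" where
  "eval_at \<iota> \<alpha> q = poly (map_poly \<iota> q) \<alpha>"

context
  fixes \<iota> :: "'f::field \<Rightarrow> 'e::field" and \<alpha> :: 'e
  assumes \<iota>: "field_embedding \<iota>"
begin

lemma eval_at_0: "eval_at \<iota> \<alpha> 0 = 0"
  by (simp add: eval_at_def)

lemma eval_at_pCons: "eval_at \<iota> \<alpha> (pCons c q) = \<iota> c + \<alpha> * eval_at \<iota> \<alpha> q"
  by (simp add: eval_at_def map_poly_pCons field_embedding_hom[OF \<iota>])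

lemma eval_at_add: "eval_at \<iota> \<alpha> (p + q) = eval_at \<iota> \<alpha> p + eval_at \<iota> \<alpha> q"
  by (induction p q rule: poly_induct2)
    (simp_all add: eval_at_0 eval_at_pCons field_embedding_hom[OF \<iota>] algebra_simps)

lemma eval_at_smult: "eval_at \<iota> \<alpha> (Polynomial.smult c q) = \<iota> c * eval_at \<iota> \<alpha> q"
  by (induction q) (simp_all add: eval_at_0 eval_at_pCons field_embedding_hom[OF \<iota>] algebra_simps)

lemma eval_at_mult: "eval_at \<iota> \<alpha> (p * q) = eval_at \<iota> \<alpha> p * eval_at \<iota> \<alpha> q"
  by (induction p)
    (simp_all add: eval_at_0 eval_at_pCons eval_at_add eval_at_smult field_embedding_hom[OF \<iota>]
      algebra_simps)

lemma eval_at_1: "eval_at \<iota> \<alpha> 1 = 1"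
  by (simp add: one_pCons eval_at_pCons eval_at_0 field_embedding_hom[OF \<iota>])

lemma eval_at_uminus: "eval_at \<iota> \<alpha> (- q) = - eval_at \<iota> \<alpha> q"
  using eval_at_smult[of "-1" q] by (simp add: field_embedding_hom[OF \<iota>])

text \<open>
  For algebraic \<open>\<alpha>\<close> the ring of polynomial expressions in \<open>\<alpha>\<close> is already a field: if \<open>q(\<alpha>) \<noteq> 0\<close>,
  then \<open>q\<close> is coprime to the minimal polynomial \<open>m\<close> of \<open>\<alpha>\<close>, and a relation \<open>uq + wm = 1\<close> evaluates
  to \<open>u(\<alpha>)q(\<alpha>) = 1\<close>.
\<close>

lemma adjoin_eq_range_eval_at:
  assumes "algebraic_elem \<iota> \<alpha>"
  shows "adjoin \<iota> \<alpha> = range (eval_at \<iota> \<alpha>)"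
proof
  have "eval_at \<iota> \<alpha> q \<in> adjoin \<iota> \<alpha>" for q
    by (induction q)
      (auto simp: eval_at_0 eval_at_pCons adjoin_incl subfield_closed[OF is_subfield_adjoin])
  then show "range (eval_at \<iota> \<alpha>) \<subseteq> adjoin \<iota> \<alpha>" by blast
next
  let ?J = "{q. eval_at \<iota> \<alpha> q = 0}"
  obtain p0 where p0: "p0 \<in> ?J" "p0 \<noteq> 0"
    using assms by (auto simp: algebraic_elem_def eval_at_def)
  obtain m where m: "m \<in> ?J" "m \<noteq> 0" "\<And>q. q \<in> ?J \<Longrightarrow> m dvd q"
    by (rule poly_ideal_principal[of ?J p0]) (use p0 in \<open>auto simp: eval_at_add eval_at_mult\<close>)
  have inv: "inverse (eval_at \<iota> \<alpha> q) \<in> range (eval_at \<iota> \<alpha>)" if q: "eval_at \<iota> \<alpha> q \<noteq> 0" for q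
  proof -
    let ?I = "{u * q + w * m | u w. True}"
    have "u * q + w * m + (u' * q + w' * m) = (u + u') * q + (w + w') * m" for u w u' w'
      by (simp add: algebra_simps)
    then have I_add: "g + h \<in> ?I" if "g \<in> ?I" "h \<in> ?I" for g h
      using that by blast
    have "r * (u * q + w * m) = (r * u) * q + (r * w) * m" for r u w
      by (simp add: algebra_simps)
    then have I_mult: "r * g \<in> ?I" if "g \<in> ?I" for r g
      using that by blast
    have qI: "q \<in> ?I"
      by (rule CollectI, rule exI[of _ 1], rule exI[of _ 0]) simp
    have mI: "m \<in> ?I"
      by (rule CollectI, rule exI[of _ 0], rule exI[of _ 1]) simp
    obtain d where d: "d \<in> ?I" "d \<noteq> 0" "\<And>g. g \<in> ?I \<Longrightarrow> d dvd g"
      by (rule poly_ideal_principal[of ?I m]) (use I_add I_mult mI m(2) in blast)+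
    obtain e where e: "m = d * e" using d(3)[OF mI] by (auto elim: dvdE)
    obtain q' where q': "q = d * q'" using d(3)[OF qI] by (auto elim: dvdE)
    have "eval_at \<iota> \<alpha> d \<noteq> 0"
      using q q' by (auto simp: eval_at_mult)
    then have "eval_at \<iota> \<alpha> e = 0"
      using m(1) by (simp add: e eval_at_mult)
    then obtain g where g: "e = m * g" using m(3)[of e] by (auto elim: dvdE)
    \<comment> \<open>\<open>m\<close> and its factor \<open>e\<close> divide each other, so the greatest common divisor \<open>d\<close> is a unit\<close>
    have "m * (d * g) = m * 1" using e g by (simp add: ac_simps)
    then have dg: "d * g = 1" using m(2) by (subst (asm) mult_cancel_left) simp
    obtain u w where uw: "d = u * q + w * m" using d(1) by blast
    have "eval_at \<iota> \<alpha> (g * u) * eval_at \<iota> \<alpha> q = eval_at \<iota> \<alpha> (g * d)"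
      using m(1) by (simp add: uw eval_at_mult eval_at_add algebra_simps)
    also have "\<dots> = 1" using dg by (simp add: mult.commute eval_at_1)
    finally have "inverse (eval_at \<iota> \<alpha> q) = eval_at \<iota> \<alpha> (g * u)"
      by (metis inverse_unique mult.commute)
    then show ?thesis by (rule range_eqI)
  qed
  show "adjoin \<iota> \<alpha> \<subseteq> range (eval_at \<iota> \<alpha>)"
  proof (rule adjoin_least)
    show "is_subfield (range (eval_at \<iota> \<alpha>))"
      unfolding is_subfield_def
    proof (intro conjI ballI)
      show "1 \<in> range (eval_at \<iota> \<alpha>)" by (metis eval_at_1 rangeI)
      fix x assume x: "x \<in> range (eval_at \<iota> \<alpha>)"
      show "- x \<in> range (eval_at \<iota> \<alpha>)" using x by (auto simp: eval_at_uminus[symmetric])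
      show "inverse x \<in> range (eval_at \<iota> \<alpha>)"
        using x inv by (cases "x = 0") auto
      fix y assume y: "y \<in> range (eval_at \<iota> \<alpha>)"
      show "x + y \<in> range (eval_at \<iota> \<alpha>)" using x y by (auto simp: eval_at_add[symmetric])
      show "x * y \<in> range (eval_at \<iota> \<alpha>)" using x y by (auto simp: eval_at_mult[symmetric])
    qed
    show "\<alpha> \<in> range (eval_at \<iota> \<alpha>)"
      by (rule range_eqI[of _ _ "[:0, 1:]"])
        (simp add: eval_at_pCons eval_at_0 field_embedding_hom[OF \<iota>])
    show "range \<iota> \<subseteq> range (eval_at \<iota> \<alpha>)"
      proof
      fix x assume "x \<in> range \<iota>"
      then obtain c where "x = \<iota> c" by blast
      then have "x = eval_at \<iota> \<alpha> [:c:]" by (simp add: eval_at_pCons eval_at_0)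
      then show "x \<in> range (eval_at \<iota> \<alpha>)" by blast
    qed
  qed
qed

end

text \<open>
  A root \<open>\<epsilon>\<close> gives the factorisation \<open>(s - \<epsilon>)(s + \<alpha> - \<lambda> + \<epsilon>)\<close> of \<open>f\<close> into polynomials over \<open>K\<close> of
  degree one, which are not units.
\<close>

lemma irreducible_fpoly_no_root:
  assumes K: "is_subfield K" and "\<alpha> \<in> K" "l \<in> K" "\<epsilon> \<in> K"
    and irr: "irreducible_over K (fpoly \<alpha> l)"
  shows "\<epsilon>\<^sup>2 + (\<alpha> - l) * \<epsilon> + \<alpha> * (\<alpha> - 2 * l) \<noteq> 0"
proof
  assume root: "\<epsilon>\<^sup>2 + (\<alpha> - l) * \<epsilon> + \<alpha> * (\<alpha> - 2 * l) = 0"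
  let ?R = "ring_of_type_algebra :: 'a ring"
  interpret R: field ?R by (rule field_from_type_algebra)
  note cl = subfield_closed[OF K]
  have sub: "subring K ?R"
    by (rule R.subringI) (use cl in auto)
  have in_K: "[1, c] \<in> carrier (univ_poly ?R K)" if "c \<in> K" for c
    using that cl by (auto simp: univ_poly_def polynomial_def)
  have fK: "fpoly \<alpha> l \<in> carrier (univ_poly ?R K)"
    using assms(2,3) cl by (auto simp: univ_poly_def polynomial_def fpoly_def)
  let ?g = "[1, - \<epsilon>]" and ?h = "[1, \<alpha> - l + \<epsilon>]"
  have gh: "?g \<in> carrier (univ_poly ?R K)" "?h \<in> carrier (univ_poly ?R K)"
    using assms(2-4) cl by (auto intro!: in_K)
  have "\<alpha> * (\<alpha> - 2 * l) = - (\<epsilon> * (\<alpha> - l + \<epsilon>))"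
    using root by (simp add: algebra_simps power2_eq_square eq_neg_iff_add_eq_0)
  then have "fpoly \<alpha> l = ?g \<otimes>\<^bsub>univ_poly ?R K\<^esub> ?h"
    by (simp add: univ_poly_def fpoly_def)
  then have "?g \<in> Units (univ_poly ?R K) \<or> ?h \<in> Units (univ_poly ?R K)"
    using R.pirreducibleE(3)[OF sub fK irr[unfolded irreducible_over_def] gh] by simp
  moreover have "subfield K ?R"
    by (rule R.subfieldI') (use sub cl in auto)
  ultimately show False
    using R.univ_poly_units[of K] by auto
qed

section \<open>Bimodules as pairs of odd operators\<close>

lemma bit_cases: "(i :: bit) = 0 \<or> i = 1"
  by (cases i) auto

lemma psgn_simps [simp]: "psgn 0 v = v" "psgn 1 v = - v"
  by (simp_all add: psgn_def)

text \<open>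
  Graded subspaces stable under the two operators. They are the graded subbimodules of a bimodule on
  which \<open>x\<close> acts by \<open>a\<close> and \<open>b\<close> (\<open>realized_over_ground.graded_subbimodule_iff\<close>), but make sense for any
  set of scalars.
\<close>

definition ab_submodule ::
  "'k::field set \<Rightarrow> ('k \<Rightarrow> 'v \<Rightarrow> 'v) \<Rightarrow> (bit \<Rightarrow> 'v set) \<Rightarrow> ('v \<Rightarrow> 'v) \<Rightarrow> ('v \<Rightarrow> 'v) \<Rightarrow>
   'v::ab_group_add set \<Rightarrow> bool" where
  "ab_submodule K s P a b N \<longleftrightarrow>
     N \<subseteq> carr \<lparr>scl = s, part = P\<rparr> \<and> vspace_on K s N \<and>
     N = {u + w | u w. u \<in> N \<inter> P 0 \<and> w \<in> N \<inter> P 1} \<and> (\<forall>w\<in>N. a w \<in> N \<and> b w \<in> N)"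

definition ab_irreducible ::
  "'k::field set \<Rightarrow> ('k \<Rightarrow> 'v \<Rightarrow> 'v) \<Rightarrow> (bit \<Rightarrow> 'v set) \<Rightarrow> ('v \<Rightarrow> 'v) \<Rightarrow> ('v::ab_group_add \<Rightarrow> 'v) \<Rightarrow>
   bool" where
  "ab_irreducible K s P a b \<longleftrightarrow>
     carr \<lparr>scl = s, part = P\<rparr> \<noteq> {0} \<and>
     (\<forall>N. ab_submodule K s P a b N \<longrightarrow> N = {0} \<or> N = carr \<lparr>scl = s, part = P\<rparr>)"

locale graded_space =
  fixes K :: "'k::field set" and s :: "'k \<Rightarrow> 'v \<Rightarrow> 'v::ab_group_add" and P :: "bit \<Rightarrow> 'v set"
  assumes subfield: "is_subfield K"
    and superspace: "is_superspace K \<lparr>scl = s, part = P\<rparr>"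
begin

abbreviation M where "M \<equiv> carr \<lparr>scl = s, part = P\<rparr>"

lemmas K_closed [simp] = subfield_closed[OF subfield]

lemma vspace_M: "vspace_on K s M" and vspace_P: "vspace_on K s (P i)"
  using superspace by (simp_all add: is_superspace_def)

lemma M_iff: "w \<in> M \<longleftrightarrow> (\<exists>u\<in>P 0. \<exists>v\<in>P 1. w = u + v)"
  by (auto simp: carr_def)

lemma M_0 [simp]: "0 \<in> M" and M_add [simp]: "u \<in> M \<Longrightarrow> v \<in> M \<Longrightarrow> u + v \<in> M"
  and M_s [simp]: "k \<in> K \<Longrightarrow> u \<in> M \<Longrightarrow> s k u \<in> M"
  and s_add: "k \<in> K \<Longrightarrow> u \<in> M \<Longrightarrow> v \<in> M \<Longrightarrow> s k (u + v) = s k u + s k v"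
  and s_add_left: "k \<in> K \<Longrightarrow> k' \<in> K \<Longrightarrow> u \<in> M \<Longrightarrow> s (k + k') u = s k u + s k' u"
  and s_s: "k \<in> K \<Longrightarrow> k' \<in> K \<Longrightarrow> u \<in> M \<Longrightarrow> s k (s k' u) = s (k * k') u"
  and s_1 [simp]: "u \<in> M \<Longrightarrow> s 1 u = u"
  using vspace_M unfolding vspace_on_def by auto

lemma P_0 [simp]: "0 \<in> P i" and P_add [simp]: "u \<in> P i \<Longrightarrow> v \<in> P i \<Longrightarrow> u + v \<in> P i"
  and P_s [simp]: "k \<in> K \<Longrightarrow> u \<in> P i \<Longrightarrow> s k u \<in> P i"
  using vspace_P[of i] unfolding vspace_on_def by auto

lemma P_M [simp]: assumes "u \<in> P i" shows "u \<in> M"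
proof (cases "i = 0")
  case True
  then have "u \<in> P 0" "0 \<in> P 1" "u = u + 0" using assms by simp_all
  then show ?thesis unfolding M_iff by blast
next
  case False
  then have "0 \<in> P 0" "u \<in> P 1" "u = 0 + u" using assms bit_cases[of i] by simp_all
  then show ?thesis unfolding M_iff by blast
qed

lemma s_0 [simp]: "u \<in> M \<Longrightarrow> s 0 u = 0"
  using s_add_left[of 0 0 u] by simp

lemma s_0_right [simp]: "k \<in> K \<Longrightarrow> s k 0 = 0"
  using s_add[of k 0 0] by simp

lemma s_uminus_left: "k \<in> K \<Longrightarrow> u \<in> M \<Longrightarrow> s (- k) u = - s k u"
  using s_add_left[of k "- k" u] by (simp add: eq_neg_iff_add_eq_0 add.commute)

lemma M_uminus [simp]: "u \<in> M \<Longrightarrow> - u \<in> M"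
  using s_uminus_left[of 1 u] M_s[of "- 1" u] by simp

lemma P_uminus [simp]: "u \<in> P i \<Longrightarrow> - u \<in> P i"
  using s_uminus_left[of 1 u] P_s[of "- 1" u i] by simp

lemma M_diff [simp]: "u \<in> M \<Longrightarrow> v \<in> M \<Longrightarrow> u - v \<in> M"
  using M_add[of u "- v"] by simp

lemma P_diff [simp]: "u \<in> P i \<Longrightarrow> v \<in> P i \<Longrightarrow> u - v \<in> P i"
  using P_add[of u i "- v"] by simp

lemma s_uminus: "k \<in> K \<Longrightarrow> u \<in> M \<Longrightarrow> s k (- u) = - s k u"
  using s_add[of k u "- u"] by (simp add: eq_neg_iff_add_eq_0 add.commute)

lemma s_diff: "k \<in> K \<Longrightarrow> u \<in> M \<Longrightarrow> v \<in> M \<Longrightarrow> s k (u - v) = s k u - s k v"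
  using s_add[of k u "- v"] by (simp add: s_uminus)

lemma s_diff_left: "k \<in> K \<Longrightarrow> k' \<in> K \<Longrightarrow> u \<in> M \<Longrightarrow> s (k - k') u = s k u - s k' u"
  using s_add_left[of k "- k'" u] by (simp add: s_uminus_left)

lemma s_double: "k \<in> K \<Longrightarrow> u \<in> M \<Longrightarrow> s (2 * k) u = s k u + s k u"
  by (simp only: mult_2 s_add_left)

text \<open>
  A decomposition into components of parities \<open>i\<close> and \<open>i + 1\<close> is a decomposition into an even and an
  odd component, whichever of the two comes first.
\<close>

lemma homogeneous_split:
  assumes "u \<in> N" "v \<in> N" "u \<in> P i" "v \<in> P (i + 1)" "w = u + v"
  shows "\<exists>u\<in>N \<inter> P 0. \<exists>v\<in>N \<inter> P 1. w = u + v"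
proof (cases "i = 0")
  case False
  then have "i = 1" using bit_cases by blast
  then show ?thesis using assms add.commute[of u v] by auto
qed (use assms in auto)

lemma nonzero_homogeneous:
  assumes "M \<noteq> {0}"
  obtains v i where "v \<in> P i" "v \<noteq> 0"
proof -
  obtain w where "w \<in> M" "w \<noteq> 0" using assms M_0 by blast
  then obtain u v where "u \<in> P 0" "v \<in> P 1" "u + v \<noteq> 0" by (auto simp: M_iff)
  then show ?thesis using that by (metis add.right_neutral)
qed

lemma P_disjoint: "u \<in> P 0 \<Longrightarrow> u \<in> P 1 \<Longrightarrow> u = 0"
  using superspace by (auto simp: is_superspace_def)

lemma homogeneous_sum_unique:
  assumes "u \<in> P 0" "v \<in> P 1" "u' \<in> P 0" "v' \<in> P 1" "u + v = u' + v'"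
  shows "u = u' \<and> v = v'"
proof -
  have "u - u' = v' - v" using assms(5) by (metis add_diff_cancel_left' add_diff_eq diff_add_eq diff_diff_eq2)
  moreover have "u - u' \<in> P 0" "v' - v \<in> P 1" using assms(1-4) by simp_all
  ultimately show ?thesis using P_disjoint by (metis eq_iff_diff_eq_0)
qed

lemmas s_simps = s_add s_add_left s_s s_uminus s_uminus_left s_diff s_diff_left

end

text \<open>
  A graded module over the universal multiplicative enveloping algebra of \<open>F1 + Fx\<close>: with \<open>a\<close> and \<open>b\<close>
  written on the right of vectors, the last two relations read \<open>b\<^sup>2 = a\<^sup>2 - 2\<lambda>\<close> and
  \<open>ba = \<lambda> - a\<^sup>2 - ab\<close>. As functions the operators compose in the opposite order.
\<close>

locale x_module = graded_space K s P
  for K :: "'k::field set" and s :: "'k \<Rightarrow> 'v \<Rightarrow> 'v::ab_group_add" and P +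
  fixes a b :: "'v \<Rightarrow> 'v" and l :: 'k
  assumes l_K [simp]: "l \<in> K"
    and a_linear: "linear_on K s M s a"
    and b_linear: "linear_on K s M s b"
    and a_odd: "w \<in> P i \<Longrightarrow> a w \<in> P (i + 1)"
    and b_odd: "w \<in> P i \<Longrightarrow> b w \<in> P (i + 1)"
    and b_b: "w \<in> M \<Longrightarrow> b (b w) = a (a w) - s (2 * l) w"
    and a_b: "w \<in> M \<Longrightarrow> a (b w) = s l w - a (a w) - b (a w)"
begin

lemma a_M [simp]: "w \<in> M \<Longrightarrow> a w \<in> M" and b_M [simp]: "w \<in> M \<Longrightarrow> b w \<in> M"
proof -
  fix w assume "w \<in> M"
  then obtain u v where w: "w = u + v" "u \<in> P 0" "v \<in> P 1" by (auto simp: M_iff)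
  have "a u \<in> M" "a v \<in> M" "b u \<in> M" "b v \<in> M"
    using a_odd b_odd w(2,3) by (blast intro: P_M)+
  moreover have "a w = a u + a v" "b w = b u + b v"
    using a_linear b_linear w by (auto simp: linear_on_def)
  ultimately show "a w \<in> M" "b w \<in> M" by simp_all
qed

lemma a_add: "u \<in> M \<Longrightarrow> v \<in> M \<Longrightarrow> a (u + v) = a u + a v"
  and a_s: "k \<in> K \<Longrightarrow> u \<in> M \<Longrightarrow> a (s k u) = s k (a u)"
  and b_add: "u \<in> M \<Longrightarrow> v \<in> M \<Longrightarrow> b (u + v) = b u + b v"
  and b_s: "k \<in> K \<Longrightarrow> u \<in> M \<Longrightarrow> b (s k u) = s k (b u)"
  using a_linear b_linear unfolding linear_on_def by auto

lemma a_0 [simp]: "a 0 = 0" and b_0 [simp]: "b 0 = 0"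
  using a_add[of 0 0] b_add[of 0 0] by simp_all

lemma a_uminus: "u \<in> M \<Longrightarrow> a (- u) = - a u" and b_uminus: "u \<in> M \<Longrightarrow> b (- u) = - b u"
  using a_add[of u "- u"] b_add[of u "- u"] by (simp_all add: eq_neg_iff_add_eq_0 add.commute)

lemma a_diff: "u \<in> M \<Longrightarrow> v \<in> M \<Longrightarrow> a (u - v) = a u - a v"
  and b_diff: "u \<in> M \<Longrightarrow> v \<in> M \<Longrightarrow> b (u - v) = b u - b v"
  using a_add[of u "- v"] b_add[of u "- v"] by (simp_all add: a_uminus b_uminus)

lemma P_1_simps [simp]: "w \<in> P 0 \<Longrightarrow> a w \<in> P 1" "w \<in> P 0 \<Longrightarrow> b w \<in> P 1"
  "w \<in> P 1 \<Longrightarrow> a w \<in> P 0" "w \<in> P 1 \<Longrightarrow> b w \<in> P 0"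
  using a_odd[of w 0] b_odd[of w 0] a_odd[of w 1] b_odd[of w 1] by simp_all

lemma a_a_P [simp]: "w \<in> P i \<Longrightarrow> a (a w) \<in> P i" and b_a_P [simp]: "w \<in> P i \<Longrightarrow> b (a w) \<in> P i"
  using bit_cases[of i] by auto

lemmas ab_simps = a_add a_s a_uminus a_diff b_add b_s b_uminus b_diff

lemma ab_submoduleI:
  assumes "N \<subseteq> M" "0 \<in> N" "\<And>u v. u \<in> N \<Longrightarrow> v \<in> N \<Longrightarrow> u + v \<in> N"
    and "\<And>k u. k \<in> K \<Longrightarrow> u \<in> N \<Longrightarrow> s k u \<in> N"
    and "\<And>w. w \<in> N \<Longrightarrow> \<exists>u\<in>N \<inter> P 0. \<exists>v\<in>N \<inter> P 1. w = u + v"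
    and "\<And>w. w \<in> N \<Longrightarrow> a w \<in> N" "\<And>w. w \<in> N \<Longrightarrow> b w \<in> N"
  shows "ab_submodule K s P a b N"
proof -
  have "vspace_on K s N"
    using vspace_M assms(1-4) unfolding vspace_on_def by (simp add: subset_iff)
  moreover have "N = {u + w | u w. u \<in> N \<inter> P 0 \<and> w \<in> N \<inter> P 1}"
    using assms(3,5) by fast
  ultimately show ?thesis
    using assms(1,6,7) unfolding ab_submodule_def by blast
qed

lemma ab_submoduleD:
  assumes "ab_submodule K s P a b N"
  shows "N \<subseteq> M" "0 \<in> N" "u \<in> N \<Longrightarrow> v \<in> N \<Longrightarrow> u + v \<in> N" "k \<in> K \<Longrightarrow> u \<in> N \<Longrightarrow> s k u \<in> N"
    "u \<in> N \<Longrightarrow> \<exists>u'\<in>N \<inter> P 0. \<exists>v\<in>N \<inter> P 1. u = u' + v"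
    "u \<in> N \<Longrightarrow> a u \<in> N" "u \<in> N \<Longrightarrow> b u \<in> N" "u \<in> N \<Longrightarrow> - u \<in> N"
proof -
  show N: "N \<subseteq> M" and "0 \<in> N" "u \<in> N \<Longrightarrow> v \<in> N \<Longrightarrow> u + v \<in> N"
    and sN: "\<And>k. k \<in> K \<Longrightarrow> u \<in> N \<Longrightarrow> s k u \<in> N"
    and "u \<in> N \<Longrightarrow> a u \<in> N" "u \<in> N \<Longrightarrow> b u \<in> N"
    using assms unfolding ab_submodule_def vspace_on_def by auto
  have "N = {u + w | u w. u \<in> N \<inter> P 0 \<and> w \<in> N \<inter> P 1}"
    using assms unfolding ab_submodule_def by blast
  then show "u \<in> N \<Longrightarrow> \<exists>u'\<in>N \<inter> P 0. \<exists>v\<in>N \<inter> P 1. u = u' + v"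
    by blast
  show "u \<in> N \<Longrightarrow> - u \<in> N"
    using sN[of "- 1"] N by (auto simp: s_uminus_left)
qed

lemma b_a: "w \<in> M \<Longrightarrow> b (a w) = s l w - a (a w) - a (b w)"
  using a_b[of w] by simp

end

text \<open>
  The bimodule structure given by the operators: \<open>x\<close> acts from the right by \<open>a\<close>, and from the left by
  \<open>b\<close> on even and by \<open>- b\<close> on odd vectors. The sign makes \<open>b\<close> an odd operator of a right module.
\<close>

definition realizes ::
  "('f \<Rightarrow> 'e) \<Rightarrow> ('e, 'f \<times> 'f, 'v) superbimodule \<Rightarrow> ('e \<Rightarrow> 'v \<Rightarrow> 'v) \<Rightarrow> (bit \<Rightarrow> 'v set) \<Rightarrow>
   ('v \<Rightarrow> 'v) \<Rightarrow> ('v \<Rightarrow> 'v::ab_group_add) \<Rightarrow> bool" where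
  "realizes \<iota> W s P a b \<longleftrightarrow> scl W = s \<and> part W = P \<and>
     (\<forall>u\<in>P 0. \<forall>w\<in>P 1. \<forall>c d.
        lact W (c, d) (u + w) = s (\<iota> c) (u + w) + s (\<iota> d) (b u - b w) \<and>
        ract W (u + w) (c, d) = s (\<iota> c) (u + w) + s (\<iota> d) (a (u + w)))"

lemma carr_algA [simp]: "carr (algA lam) = UNIV"
  by (auto simp: carr_def algA_def)

lemma algA_simps [simp]:
  "scl (algA lam) k (c, d) = (k * c, k * d)"
  "mul (algA lam) (c, d) (c', d') = (c * c' + lam * (d * d'), c * d' + d * c')"
  "part (algA lam) 0 = UNIV \<times> {0}" "part (algA lam) 1 = {0} \<times> UNIV"
  by (simp_all add: algA_def)

text \<open>
  The vector component is a sum of three terms, according to which of the three factors contributes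
  its vector.
\<close>

lemma split_null_associator:
  "associator (split_null A V) (a, v) (b, w) (c, u) =
     (associator A a b c,
      (lact V (mul A a b) u - lact V a (lact V b u + ract V w c)) +
      ract V (lact V a w + ract V v b) c - ract V v (mul A b c))"
  by (simp add: associator_def split_null_def)

locale realized = x_module K s P a b l
  for K :: "'k::field set" and s :: "'k \<Rightarrow> 'v \<Rightarrow> 'v::ab_group_add" and P a b l +
  fixes \<iota> :: "'f::field \<Rightarrow> 'k" and W :: "('k, 'f \<times> 'f, 'v) superbimodule"
  assumes realizes: "realizes \<iota> W s P a b"
    and \<iota>: "field_embedding \<iota>" and \<iota>_K: "\<iota> c \<in> K"
begin

declare \<iota>_K [simp]

lemma scl_W [simp]: "scl W = s" and part_W [simp]: "part W = P"
  and carr_W [simp]: "carr W = M"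
  using realizes by (auto simp: realizes_def carr_def)

lemma ract_W: "w \<in> M \<Longrightarrow> ract W w (c, d) = s (\<iota> c) w + s (\<iota> d) (a w)"
  using realizes by (auto simp: realizes_def M_iff)

lemma lact_W_sum: "u \<in> P 0 \<Longrightarrow> w \<in> P 1 \<Longrightarrow>
    lact W (c, d) (u + w) = s (\<iota> c) (u + w) + s (\<iota> d) (b u - b w)"
  using realizes by (auto simp: realizes_def)

lemma lact_W:
  assumes "w \<in> P i"
  shows "lact W (c, d) w = s (\<iota> c) w + psgn i (s (\<iota> d) (b w))"
proof (cases "i = 0")
  case True
  then show ?thesis using lact_W_sum[of w 0 c d] assms by simp
next
  case False
  then have "i = 1" using bit_cases by blast
  then show ?thesis using lact_W_sum[of 0 w c d] assms by (simp add: s_uminus)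
qed

lemma lact_M [simp]: "w \<in> M \<Longrightarrow> lact W z w \<in> M"
proof -
  assume "w \<in> M"
  then obtain u v where w: "w = u + v" "u \<in> P 0" "v \<in> P 1"
    by (auto simp: M_iff)
  then show ?thesis
    by (cases z) (simp add: lact_W_sum)
qed

lemma lact_add:
  assumes "w \<in> M" "w' \<in> M"
  shows "lact W z (w + w') = lact W z w + lact W z w'"
proof -
  obtain u v u' v' where w: "w = u + v" "u \<in> P 0" "v \<in> P 1" "w' = u' + v'" "u' \<in> P 0" "v' \<in> P 1"
    using assms by (auto simp: M_iff)
  obtain c d where z: "z = (c, d)" by (cases z)
  have eq: "w + w' = (u + u') + (v + v')" using w by (simp add: algebra_simps)
  have "lact W z (w + w') = s (\<iota> c) (u + u' + (v + v')) + s (\<iota> d) (b (u + u') - b (v + v'))"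
    unfolding eq z using w by (intro lact_W_sum) simp_all
  also have "\<dots> = lact W z w + lact W z w'"
    using w by (simp add: z lact_W_sum s_simps ab_simps algebra_simps)
  finally show ?thesis .
qed

lemma lact_uminus: "w \<in> M \<Longrightarrow> lact W z (- w) = - lact W z w"
  using lact_add[of w "- w" z] lact_add[of 0 0 z]
  by (simp add: eq_neg_iff_add_eq_0 add.commute)

lemma lact_diff: "w \<in> M \<Longrightarrow> w' \<in> M \<Longrightarrow> lact W z (w - w') = lact W z w - lact W z w'"
  using lact_add[of w "- w'" z] by (simp add: lact_uminus)

lemma lact_s:
  assumes "w \<in> M" "k \<in> K"
  shows "lact W z (s k w) = s k (lact W z w)"
proof -
  obtain u v where w: "w = u + v" "u \<in> P 0" "v \<in> P 1"
    using assms by (auto simp: M_iff)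
  obtain c d where z: "z = (c, d)" by (cases z)
  have eq: "s k w = s k u + s k v" using w assms by (simp add: s_add)
  show ?thesis
    unfolding eq z using w assms by (simp add: lact_W_sum s_simps ab_simps algebra_simps)
qed

end

locale realized_over_ground = realized UNIV s P a b lam "\<lambda>c. c" W
  for s :: "'f::field \<Rightarrow> 'v \<Rightarrow> 'v::ab_group_add" and P a b lam W
begin

lemma graded_subbimodule_iff:
  "graded_subbimodule UNIV (algA lam) W N \<longleftrightarrow> ab_submodule UNIV s P a b N"
proof
  assume N: "graded_subbimodule UNIV (algA lam) W N"
  then have sub: "N \<subseteq> M" and vs: "vspace_on UNIV s N"
    and dec: "N = {u + w | u w. u \<in> N \<inter> P 0 \<and> w \<in> N \<inter> P 1}"
    and act: "\<And>z w. w \<in> N \<Longrightarrow> lact W z w \<in> N" "\<And>z w. w \<in> N \<Longrightarrow> ract W w z \<in> N"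
    by (auto simp: graded_subbimodule_def)
  have add: "u + v \<in> N" if "u \<in> N" "v \<in> N" for u v using that vs by (simp add: vspace_on_def)
  have sc: "s k u \<in> N" if "u \<in> N" for u k using that vs by (simp add: vspace_on_def)
  have neg: "- u \<in> N" if "u \<in> N" for u
    using sc[OF that, of "- 1"] sub that by (auto simp: s_uminus_left)
  have "a w \<in> N" if "w \<in> N" for w
    using act(2)[OF that, of "(0, 1)"] sub that by (auto simp: ract_W)
  moreover have "b w \<in> N" if "w \<in> N" for w
  proof -
    obtain u v where w: "w = u + v" "u \<in> N \<inter> P 0" "v \<in> N \<inter> P 1" using dec \<open>w \<in> N\<close> by blast
    have "b u \<in> N" using act(1)[of u "(0, 1)"] w by (auto simp: lact_W[of _ 0])
    moreover have "- b v \<in> N" using act(1)[of v "(0, 1)"] w by (auto simp: lact_W[of _ 1])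
    ultimately have "b u + - (- b v) \<in> N" by (blast intro: add neg)
    then show ?thesis using w by (auto simp: b_add)
  qed
  ultimately show "ab_submodule UNIV s P a b N"
    using sub vs dec by (auto simp: ab_submodule_def)
next
  assume N: "ab_submodule UNIV s P a b N"
  note D = ab_submoduleD[OF N]
  have "ract W w z \<in> N" if "w \<in> N" for w z
  proof -
    have "w \<in> M" using that D(1) by blast
    then show ?thesis using that D(3,4,6) by (cases z) (simp add: ract_W)
  qed
  moreover have "lact W z w \<in> N" if "w \<in> N" for w z
  proof -
    obtain u v where w: "u \<in> N \<inter> P 0" "v \<in> N \<inter> P 1" "w = u + v"
      using D(5)[OF \<open>w \<in> N\<close>] by blast
    obtain c d where z: "z = (c, d)" by (cases z)
    have "s c w + s d (b u + - b v) \<in> N"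
      using w that D(7)[of u] D(8)[OF D(7)[of v]] by (intro D(3) D(4)) auto
    then show ?thesis using w by (simp add: z lact_W_sum)
  qed
  ultimately show "graded_subbimodule UNIV (algA lam) W N"
    using N by (auto simp: graded_subbimodule_def ab_submodule_def)
qed

lemma irreducible_iff:
  "irreducible_bimodule UNIV (algA lam) W \<longleftrightarrow> ab_irreducible UNIV s P a b"
  by (simp add: irreducible_bimodule_def ab_irreducible_def graded_subbimodule_iff)

lemma superbimodule: "is_superbimodule UNIV (algA lam) W"
proof -
  have "is_superspace UNIV W"
    using superspace unfolding is_superspace_def carr_W scl_W part_W by (simp add: carr_def)
  moreover have "bilinear_on UNIV (scl (algA lam)) (carr (algA lam)) (scl W) (carr W) (scl W) (lact W)"
  proof -
    have "lact W (c + c', d + d') w = lact W (c, d) w + lact W (c', d') w"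
      "lact W (k * c, k * d) w = s k (lact W (c, d) w)" if w: "w \<in> M" for c c' d d' k w
    proof -
      obtain u v where w: "w = u + v" "u \<in> P 0" "v \<in> P 1"
        using w by (auto simp: M_iff)
      then show "lact W (c + c', d + d') w = lact W (c, d) w + lact W (c', d') w"
        "lact W (k * c, k * d) w = s k (lact W (c, d) w)"
        by (simp_all add: lact_W_sum s_simps ab_simps algebra_simps)
    qed
    then show ?thesis
      by (auto simp: bilinear_on_def linear_on_def lact_add lact_s)
  qed
  moreover have "bilinear_on UNIV (scl W) (carr W) (scl (algA lam)) (carr (algA lam)) (scl W) (ract W)"
    by (auto simp: bilinear_on_def linear_on_def ract_W s_simps ab_simps algebra_simps)
  moreover have "lact W z w \<in> P (i + j) \<and> ract W w z \<in> P (i + j)"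
    if "z \<in> part (algA lam) i" "w \<in> P j" for i j z w
    using that bit_cases[of i] bit_cases[of j]
    by (cases z) (auto simp: lact_W ract_W s_simps)
  ultimately show ?thesis
    by (simp add: is_superbimodule_def)
qed

text \<open>
  All associators of homogeneous elements are governed by the single even operator \<open>D = a\<^sup>2 - \<lambda>\<close>: the
  two relations between \<open>a\<close> and \<open>b\<close> say that \<open>(x, x, u)\<close>, \<open>(v, x, x)\<close> and \<open>\<plusminus>(x, w, x)\<close> are the values of
  \<open>D\<close> at \<open>u\<close>, \<open>v\<close> and \<open>w\<close>. The \<open>x\<close>-coefficients \<open>a1\<close>, \<open>b1\<close>, \<open>c1\<close> vanish on even elements, which makes the
  super-alternative laws evident from this formula.
\<close>

lemma associator_split_null:
  assumes "v \<in> P i" "w \<in> P j" "u \<in> P k"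
  defines "D \<equiv> \<lambda>w. a (a w) - s lam w"
  shows "associator (split_null (algA lam) W) ((a0, a1), v) ((b0, b1), w) ((c0, c1), u) =
    (0, s (a1 * b1) (D u) + s (b1 * c1) (D v) - psgn j (s (a1 * c1) (D w)))"
proof -
  have fst: "associator (algA lam) (a0, a1) (b0, b1) (c0, c1) = 0"
    by (simp add: associator_def algebra_simps zero_prod_def)
  note expand = s_simps ab_simps D_def
  have M: "v \<in> M" "w \<in> M" "u \<in> M" using assms by auto
  have "ract W (ract W v (b0, b1)) (c0, c1) - ract W v (mul (algA lam) (b0, b1) (c0, c1)) =
      s (b1 * c1) (D v)"
    using M by (simp add: ract_W expand algebra_simps)
  moreover have "lact W (mul (algA lam) (a0, a1) (b0, b1)) u - lact W (a0, a1) (lact W (b0, b1) u) =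
      s (a1 * b1) (D u)"
  proof -
    have "lact W (b0, b1) u = s b0 u + psgn k (s b1 (b u))"
      using assms by (simp add: lact_W)
    moreover have "lact W (a0, a1) (s b0 u) = s a0 (s b0 u) + psgn k (s a1 (b (s b0 u)))"
      using assms by (intro lact_W) simp
    moreover have "lact W (a0, a1) (psgn k (s b1 (b u))) =
        s a0 (psgn k (s b1 (b u))) - psgn k (s a1 (b (psgn k (s b1 (b u)))))"
      using lact_W[of "psgn k (s b1 (b u))" "k + 1" a0 a1] assms bit_cases[of k] by auto
    moreover have "lact W (mul (algA lam) (a0, a1) (b0, b1)) u =
        s (a0 * b0 + lam * (a1 * b1)) u + psgn k (s (a0 * b1 + a1 * b0) (b u))"
      using assms by (simp add: lact_W)
    ultimately show ?thesis
      using M bit_cases[of k] s_double[of "a1 * (b1 * lam)" u]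
      by (auto simp: mult.assoc mult.commute mult.left_commute lact_add lact_diff lact_uminus expand b_b algebra_simps)
  qed
  moreover have "ract W (lact W (a0, a1) w) (c0, c1) - lact W (a0, a1) (ract W w (c0, c1)) =
      - psgn j (s (a1 * c1) (D w))"
  proof -
    have "lact W (a0, a1) w = s a0 w + psgn j (s a1 (b w))"
      "ract W w (c0, c1) = s c0 w + s c1 (a w)"
      using assms M by (simp_all add: lact_W ract_W)
    moreover have "lact W (a0, a1) (s c0 w) = s a0 (s c0 w) + psgn j (s a1 (b (s c0 w)))"
      using assms by (intro lact_W) simp
    moreover have "lact W (a0, a1) (s c1 (a w)) = s a0 (s c1 (a w)) - psgn j (s a1 (b (s c1 (a w))))"
      using lact_W[of "s c1 (a w)" "j + 1" a0 a1] assms a_odd[of w j] bit_cases[of j] by auto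
    ultimately show ?thesis
      using M bit_cases[of j] by (auto simp: lact_add ract_W expand a_b algebra_simps)
  qed
  ultimately show ?thesis
    using M by (simp add: split_null_associator fst lact_add ract_W s_simps ab_simps algebra_simps)
qed

lemma alternative: "alternative_bimodule UNIV (algA lam) W"
proof -
  let ?E = "split_null (algA lam) W"
  let ?D = "\<lambda>w. a (a w) - s lam w"
  have part_E: "part ?E i = part (algA lam) i \<times> P i" and scl_E: "scl ?E = (\<lambda>k (z, v). (scl (algA lam) k z, s k v))" for i
    by (simp_all add: split_null_def)
  have carr_E: "carr ?E = UNIV \<times> M"
  proof -
    have "((c, d), u + v) = ((c, 0), u) + ((0, d), v)" for c d :: 'f and u v :: 'v
      by simp
    then have "((c, d), u + v) \<in> carr ?E" if "u \<in> P 0" "v \<in> P 1" for c d u v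
      unfolding carr_def part_E using that
      by (intro CollectI exI[of _ "((c, 0), u)"] exI[of _ "((0, d), v)"]) simp
    then show ?thesis
      by (auto simp: M_iff) (auto simp: carr_def part_E)
  qed
  have "is_superspace UNIV ?E"
  proof -
    have "vspace_on UNIV (scl ?E) (UNIV \<times> M)"
      by (auto simp: vspace_on_def scl_E zero_prod_def s_simps algebra_simps)
    moreover have "vspace_on UNIV (scl ?E) (part ?E i)" for i
      using bit_cases[of i]
      by (auto simp: vspace_on_def part_E scl_E zero_prod_def s_simps algebra_simps)
    moreover have "part ?E 0 \<inter> part ?E 1 = {0}"
      using P_disjoint by (auto simp: part_E zero_prod_def)
    ultimately show ?thesis by (simp add: is_superspace_def carr_E)
  qed
  moreover have bilin: "bilinear_on UNIV (scl ?E) (carr ?E) (scl ?E) (carr ?E) (scl ?E) (mul ?E)"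
  proof -
    have "lact W (c + c', d + d') w = lact W (c, d) w + lact W (c', d') w"
      "lact W (k * c, k * d) w = s k (lact W (c, d) w)" if "w \<in> M" for c c' d d' k w
      using superbimodule that
      by (auto simp: is_superbimodule_def bilinear_on_def linear_on_def)
    moreover have "ract W w (c + c', d + d') = ract W w (c, d) + ract W w (c', d')"
      "ract W w (k * c, k * d) = s k (ract W w (c, d))" if "w \<in> M" for c c' d d' k w
      using superbimodule that
      by (auto simp: is_superbimodule_def bilinear_on_def linear_on_def)
    moreover have "ract W (w + w') z = ract W w z + ract W w' z"
      "ract W (s k w) z = s k (ract W w z)" if "w \<in> M" "w' \<in> M" for k w w' z
      using that by (cases z; simp add: ract_W s_simps ab_simps algebra_simps)+
    moreover have "ract W w z \<in> M" if "w \<in> M" for w z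
      using that by (cases z) (simp add: ract_W)
    ultimately show ?thesis
      unfolding carr_E scl_E
      by (auto simp: bilinear_on_def linear_on_def split_null_def lact_add lact_s s_add
          algebra_simps)
  qed
  moreover have "mul ?E x y \<in> part ?E (i + j)" if "x \<in> part ?E i" "y \<in> part ?E j" for i j x y
    using that superbimodule bit_cases[of i] bit_cases[of j]
    by (auto simp: part_E split_null_def is_superbimodule_def)
       (auto simp: lact_W ract_W s_simps)
  ultimately have alg: "is_superalgebra UNIV ?E"
    by (simp add: is_superalgebra_def)
  have swap: "associator ?E x y z = psgn (j * k + 1) (associator ?E x z y)"
    "associator ?E x y z = psgn (i * j + 1) (associator ?E y x z)"
    if "x \<in> part ?E i" "y \<in> part ?E j" "z \<in> part ?E k" for i j k x y z
  proof -
    obtain a0 a1 v b0 b1 w c0 c1 u where xyz: "x = ((a0, a1), v)" "y = ((b0, b1), w)" "z = ((c0, c1), u)"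
      by (metis surj_pair)
    have h: "v \<in> P i" "w \<in> P j" "u \<in> P k" using that by (auto simp: xyz part_E)
    have [simp]: "v \<in> M" "w \<in> M" "u \<in> M" using h by auto
    show "associator ?E x y z = psgn (j * k + 1) (associator ?E x z y)"
      unfolding xyz associator_split_null[OF h] associator_split_null[OF h(1,3,2)]
      using that bit_cases[of i] bit_cases[of j] bit_cases[of k]
      by (auto simp: xyz part_E algebra_simps zero_prod_def)
    show "associator ?E x y z = psgn (i * j + 1) (associator ?E y x z)"
      unfolding xyz associator_split_null[OF h] associator_split_null[OF h(2,1,3)]
      using that bit_cases[of i] bit_cases[of j] bit_cases[of k]
      by (auto simp: xyz part_E algebra_simps zero_prod_def)
  qed
  have sq: "associator ?E x x z = 0" if x: "x \<in> part ?E 0" and z: "z \<in> carr ?E" for x z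
  proof -
    have homog: "associator ?E x x z = 0" if zk: "z \<in> part ?E k" for z k
    proof -
      obtain a0 v c0 c1 u where xz: "x = ((a0, 0), v)" "z = ((c0, c1), u)" "v \<in> P 0" "u \<in> P k"
        using x zk by (cases x; cases z) (auto simp: part_E)
      then have [simp]: "v \<in> M" "u \<in> M" by auto
      show ?thesis
        unfolding xz associator_split_null[OF xz(3,3,4)] by (simp add: zero_prod_def)
    qed
    obtain z0 z1 where z01: "z = z0 + z1" "z0 \<in> part ?E 0" "z1 \<in> part ?E 1"
      using z by (auto simp: carr_def)
    have "z0 \<in> carr ?E" "z1 \<in> carr ?E" "x \<in> carr ?E"
      using z01(2,3) x unfolding part_E carr_E by auto
    moreover have "mul ?E y y' \<in> carr ?E" if "y \<in> carr ?E" "y' \<in> carr ?E" for y y'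
      using that unfolding carr_E by (cases y; cases y') (auto simp: split_null_def ract_W)
    moreover have "mul ?E y (y' + y'') = mul ?E y y' + mul ?E y y''"
      if "y \<in> carr ?E" "y' \<in> carr ?E" "y'' \<in> carr ?E" for y y' y''
      using bilin that unfolding bilinear_on_def linear_on_def by blast
    ultimately have "associator ?E x x z = associator ?E x x z0 + associator ?E x x z1"
      by (simp add: z01(1) associator_def)
    then show ?thesis using homog[OF z01(2)] homog[OF z01(3)] by simp
  qed
  have "alternative_superalgebra UNIV ?E"
    unfolding alternative_superalgebra_def
    by (intro conjI allI ballI alg sq swap)
  then show ?thesis
    by (simp add: alternative_bimodule_def superbimodule)
qed

end

text \<open>
  Changing the parity leaves both operators as they are: the sign by which \<open>x\<close> acts from the left on the
  new even part is absorbed by the sign in the definition of the parity change.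
\<close>

lemma parity_change_realized:
  assumes "realized K s P a b l \<iota> W"
  shows "realized K s (\<lambda>i. P (i + 1)) a b l \<iota> (parity_change (algA lam) W)"
proof -
  interpret realized K s P a b l \<iota> W by fact
  have M_eq: "carr \<lparr>scl = s, part = \<lambda>i. P (i + 1)\<rparr> = M"
    by (auto simp: carr_def) (metis add.commute)+
  have gi: "grade_inv (algA lam) (c, d) = (c, - d)" for c d
    unfolding grade_inv_def by (rule the_equality) auto
  show ?thesis
  proof
    show "is_superspace K \<lparr>scl = s, part = \<lambda>i. P (i + 1)\<rparr>"
      using superspace unfolding is_superspace_def M_eq by auto
    show "linear_on K s (carr \<lparr>scl = s, part = \<lambda>i. P (i + 1)\<rparr>) s a"
      "linear_on K s (carr \<lparr>scl = s, part = \<lambda>i. P (i + 1)\<rparr>) s b"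
      unfolding M_eq by (rule a_linear b_linear)+
    show "realizes \<iota> (parity_change (algA lam) W) s (\<lambda>i. P (i + 1)) a b"
      unfolding realizes_def
    proof (intro conjI ballI allI)
      fix u w c d
      assume "u \<in> P (0 + 1)" "w \<in> P (1 + 1)"
      then have uw: "u \<in> P 1" "w \<in> P 0" by simp_all
      then have [simp]: "u \<in> M" "w \<in> M" by auto
      show "lact (parity_change (algA lam) W) (c, d) (u + w) = s (\<iota> c) (u + w) + s (\<iota> d) (b u - b w)"
        using uw lact_W_sum[OF uw(2,1), of c "- d"]
        by (simp add: parity_change_def gi add.commute field_embedding_hom[OF \<iota>] s_simps)
      show "ract (parity_change (algA lam) W) (u + w) (c, d) = s (\<iota> c) (u + w) + s (\<iota> d) (a (u + w))"
        by (simp add: parity_change_def ract_W)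
    qed (simp_all add: parity_change_def)
    show "a w \<in> P (i + 1 + 1)" "b w \<in> P (i + 1 + 1)" if "w \<in> P (i + 1)" for w i
      using that by (rule a_odd b_odd)+
    show "b (b w) = a (a w) - s (2 * l) w" "a (b w) = s l w - a (a w) - b (a w)"
      if "w \<in> carr \<lparr>scl = s, part = \<lambda>i. P (i + 1)\<rparr>" for w
      using that unfolding M_eq by (rule b_b a_b)+
  qed (simp_all add: subfield \<iota>)
qed

text \<open>
  The associators of \<open>x\<close>, \<open>x\<close> and a homogeneous vector \<open>w\<close> in the three possible orders coincide up to
  signs. The two resulting equations are the relations for \<open>b\<^sup>2\<close> and for \<open>ab + ba\<close>.
\<close>

lemma alternative_bimodule_realized:
  assumes alt: "alternative_bimodule UNIV (algA lam) V" and unital: "unital_bimodule oneA V"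
  obtains b where "realized_over_ground (scl V) (part V) (\<lambda>w. ract V w xA) b lam V"
proof -
  let ?E = "split_null (algA lam) V"
  have ss: "is_superspace UNIV V"
    and lin: "\<And>z. linear_on UNIV (scl V) (carr V) (scl V) (lact V z)"
      "\<And>w. w \<in> carr V \<Longrightarrow> linear_on UNIV (scl (algA lam)) UNIV (scl V) (\<lambda>z. lact V z w)"
      "\<And>z. linear_on UNIV (scl V) (carr V) (scl V) (\<lambda>w. ract V w z)"
      "\<And>w. w \<in> carr V \<Longrightarrow> linear_on UNIV (scl (algA lam)) UNIV (scl V) (ract V w)"
    and par: "\<And>i j z w. z \<in> part (algA lam) i \<Longrightarrow> w \<in> part V j \<Longrightarrow> lact V z w \<in> part V (i + j)"
      "\<And>i j z w. z \<in> part (algA lam) i \<Longrightarrow> w \<in> part V j \<Longrightarrow> ract V w z \<in> part V (i + j)"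
    using alt by (auto simp: alternative_bimodule_def is_superbimodule_def bilinear_on_def)
  have one: "lact V oneA w = w" "ract V w oneA = w" if "w \<in> carr V" for w
    using unital that by (auto simp: unital_bimodule_def)
  have acts: "lact V (c, d) w = scl V c w + scl V d (lact V xA w)"
    "ract V w (c, d) = scl V c w + scl V d (ract V w xA)" if w: "w \<in> carr V" for w c d
  proof -
    have "lact V (scl (algA lam) c oneA + scl (algA lam) d xA) w =
        scl V c (lact V oneA w) + scl V d (lact V xA w)"
      using lin(2)[OF w] unfolding linear_on_def by (metis UNIV_I)
    then show "lact V (c, d) w = scl V c w + scl V d (lact V xA w)" by (simp add: one w)
    have "ract V w (scl (algA lam) c oneA + scl (algA lam) d xA) =
        scl V c (ract V w oneA) + scl V d (ract V w xA)"
      using lin(4)[OF w] unfolding linear_on_def by (metis UNIV_I)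
    then show "ract V w (c, d) = scl V c w + scl V d (ract V w xA)" by (simp add: one w)
  qed
  interpret graded_space UNIV "scl V" "part V"
    using ss by unfold_locales (auto simp: is_subfield_UNIV is_superspace_def carr_def)
  have carr_V: "carr V = M" by (simp add: carr_def)
  note lin = lin[unfolded carr_V]
  note acts = acts[unfolded carr_V]
  let ?L = "lact V xA" and ?R = "\<lambda>w. ract V w xA"
  have LR_P: "?L w \<in> part V (i + 1)" "?R w \<in> part V (i + 1)" if "w \<in> part V i" for w i
    using par(1)[of xA 1 w i] par(2)[of xA 1 w i] that by (simp_all add: add.commute)
  have L_add: "?L (u + v) = ?L u + ?L v" and L_s: "?L (scl V k u) = scl V k (?L u)"
    and R_add: "?R (u + v) = ?R u + ?R v" if "u \<in> M" "v \<in> M" for u v k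
    using lin(1,3)[of xA] that by (auto simp: linear_on_def)
  have lin_0: "f 0 = 0" if "linear_on UNIV (scl V) M (scl V) f" for f :: "'b \<Rightarrow> 'b"
  proof -
    have "f (0 + 0) = f 0 + f 0" using that unfolding linear_on_def by (metis M_0)
    then show ?thesis by simp
  qed
  have LR_M: "?L w \<in> M" "?R w \<in> M" if w: "w \<in> M" for w
  proof -
    obtain u v where "w = u + v" "u \<in> part V 0" "v \<in> part V 1" using w by (auto simp: M_iff)
    then show "?L w \<in> M" "?R w \<in> M"
      using LR_P[of u 0] LR_P[of v 1] by (auto simp: L_add R_add)
  qed
  have L_0: "?L 0 = 0" using L_add[of 0 0] by simp
  have L_uminus: "?L (- u) = - ?L u" if "u \<in> M" for u
    using L_add[of u "- u"] L_0 that by (simp add: eq_neg_iff_add_eq_0 add.commute)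
  have L_diff: "?L (u - v) = ?L u - ?L v" if "u \<in> M" "v \<in> M" for u v
    using L_add[of u "- v"] L_uminus that by simp
  have R_uminus: "?R (- u) = - ?R u" if "u \<in> M" for u
    using R_add[of u "- u"] lin_0[OF lin(3)] that
    by (simp add: eq_neg_iff_add_eq_0 add.commute)
  \<comment> \<open>the grading involution\<close>
  define \<sigma> where "\<sigma> w = (THE z. \<exists>u\<in>part V 0. \<exists>v\<in>part V 1. w = u + v \<and> z = u - v)" for w
  have \<sigma>: "\<sigma> (u + v) = u - v" if "u \<in> part V 0" "v \<in> part V 1" for u v
    unfolding \<sigma>_def
    by (rule the_equality) (use that homogeneous_sum_unique in blast)+
  define b where "b w = ?L (\<sigma> w)" for w
  have b_sum: "b (u + v) = ?L u - ?L v" if "u \<in> part V 0" "v \<in> part V 1" for u v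
    using that by (auto simp: b_def \<sigma> L_diff)
  have b_hom: "b w = psgn i (?L w)" if "w \<in> part V i" for i w
    using b_sum[of w 0] b_sum[of 0 w] that bit_cases[of i] by (auto simp: L_0)
  have b_add: "b (w + w') = b w + b w'" if M: "w \<in> M" "w' \<in> M" for w w'
  proof -
    obtain u v u' v' where w: "w = u + v" "u \<in> part V 0" "v \<in> part V 1"
      "w' = u' + v'" "u' \<in> part V 0" "v' \<in> part V 1"
      using M by (auto simp: M_iff)
    then show ?thesis
      using b_sum[of "u + u'" "v + v'"] by (simp add: b_sum L_add algebra_simps)
  qed
  have b_uminus: "b (- w) = - b w" if "w \<in> M" for w
    using b_add[of w "- w"] b_sum[of 0 0] that by (simp add: L_0 eq_neg_iff_add_eq_0 add.commute)
  have relations: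
    "b (b w) = ?R (?R w) - scl V (2 * lam) w"
    "?R (b w) = scl V lam w - ?R (?R w) - b (?R w)" if w: "w \<in> part V i" for w i
  proof -
    let ?X = "(xA, 0)" and ?Y = "((0, 0), w)"
    have X: "?X \<in> part ?E 1" and Y: "?Y \<in> part ?E i"
      using w bit_cases[of i] by (auto simp: split_null_def)
    have [simp]: "w \<in> M" "?L w \<in> M" "?R w \<in> M" using w LR_P[OF w] by auto
    have act0: "lact V (0, 0) u = 0" "ract V u (0, 0) = 0"
      if "u \<in> M" for u
      using that acts[of u 0 0] LR_M[of u] by auto
    have act_0: "lact V z 0 = 0" "ract V 0 z = 0" for z
      by (rule lin_0[OF lin(1)] lin_0[OF lin(3)])+
    have act_scalar: "lact V (c, 0) u = scl V c u" "ract V u (c, 0) = scl V c u" if "u \<in> M" for c u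
      using that acts[of u c 0] LR_M[of u] by auto
    have swap: "associator ?E x y z = psgn (j * k + 1) (associator ?E x z y)"
      "associator ?E x y z = psgn (i * j + 1) (associator ?E y x z)"
      if "x \<in> part ?E i" "y \<in> part ?E j" "z \<in> part ?E k" for x y z i j k
      using alt that unfolding alternative_bimodule_def alternative_superalgebra_def by blast+
    have 1: "associator ?E ?X ?X ?Y = (0, scl V lam w - ?L (?L w))"
      unfolding split_null_associator by (simp add: associator_def act0 act_0 act_scalar zero_prod_def)
    have 2: "associator ?E ?X ?Y ?X = (0, ?R (?L w) - ?L (?R w))"
      unfolding split_null_associator by (simp add: associator_def act0 act_0 act_scalar zero_prod_def)
    have 3: "associator ?E ?Y ?X ?X = (0, ?R (?R w) - scl V lam w)"
      unfolding split_null_associator by (simp add: associator_def act0 act_0 act_scalar zero_prod_def)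
    have e1: "scl V lam w - ?L (?L w) = psgn (i + 1) (?R (?L w) - ?L (?R w))"
      using swap(1)[OF X X Y] bit_cases[of i] unfolding 1 2 by auto
    have e2: "?R (?L w) - ?L (?R w) = psgn (i + 1) (?R (?R w) - scl V lam w)"
      using swap(2)[OF X Y X] bit_cases[of i] unfolding 2 3 by auto
    have bR: "b (?R w) = psgn (i + 1) (?L (?R w))" and bL: "b (?L w) = psgn (i + 1) (?L (?L w))"
      using LR_P[OF w] by (simp_all add: b_hom)
    have b_L: "b (psgn i (?L w)) = psgn i (b (?L w))"
      using bit_cases[of i] b_uminus[of "?L w"] by auto
    have R_L: "?R (psgn i (?L w)) = psgn i (?R (?L w))"
      using bit_cases[of i] R_uminus[of "?L w"] by auto
    show "b (b w) = ?R (?R w) - scl V (2 * lam) w"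
      using bit_cases[of i] e1 e2 s_double[of lam w] unfolding b_hom[OF w] b_L bL
      by (auto simp: algebra_simps)
    show "?R (b w) = scl V lam w - ?R (?R w) - b (?R w)"
      using bit_cases[of i] e1 e2 unfolding b_hom[OF w] R_L bR
      by (auto simp: algebra_simps)
  qed
  have "realized_over_ground (scl V) (part V) ?R b lam V"
  proof
    show "linear_on UNIV (scl V) M (scl V) ?R" using lin(3) .
    show "linear_on UNIV (scl V) M (scl V) b"
    proof -
      have "b (scl V k w) = scl V k (b w)" if M: "w \<in> M" for k w
      proof -
        obtain u v where w: "w = u + v" "u \<in> part V 0" "v \<in> part V 1"
          using M by (auto simp: M_iff)
        have "b (scl V k u + scl V k v) = ?L (scl V k u) - ?L (scl V k v)"
          using w by (intro b_sum) auto
        then show ?thesis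
          using w LR_M[of u] LR_M[of v] by (simp add: s_add L_s[of _ 0] b_sum s_diff)
      qed
      then show ?thesis using b_add by (auto simp: linear_on_def)
    qed
    show "?R w \<in> part V (i + 1)" "b w \<in> part V (i + 1)" if "w \<in> part V i" for w i
      using LR_P[OF that] bit_cases[of i] by (auto simp: b_hom[OF that])
    show "b (b w) = ?R (?R w) - scl V (2 * lam) w"
      "?R (b w) = scl V lam w - ?R (?R w) - b (?R w)" if M: "w \<in> M" for w
    proof -
      obtain u v where w: "w = u + v" "u \<in> part V 0" "v \<in> part V 1"
        using M by (auto simp: M_iff)
      then have [simp]: "u \<in> M" "v \<in> M" "b u \<in> M" "b v \<in> M"
        using b_hom[of u 0] b_hom[of v 1] LR_M by auto
      show "b (b w) = ?R (?R w) - scl V (2 * lam) w"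
        "?R (b w) = scl V lam w - ?R (?R w) - b (?R w)"
        using w
        by (simp_all add: relations[of u 0] relations[of v 1] b_add R_add LR_M s_add)
    qed
    show "realizes (\<lambda>c. c) V (scl V) (part V) ?R b"
      unfolding realizes_def
    proof (intro conjI ballI allI)
      fix u w c d
      assume uw: "u \<in> part V 0" "w \<in> part V 1"
      then have "u \<in> M" "w \<in> M" by auto
      then show "lact V (c, d) (u + w) = scl V c (u + w) + scl V d (b u - b w)"
        "ract V (u + w) (c, d) = scl V c (u + w) + scl V d (?R (u + w))"
        using acts[of "u + w" c d] L_add[of u w] b_hom[OF uw(1)] b_hom[OF uw(2)] by auto
    qed simp_all
    show "field_embedding (\<lambda>c :: 'a. c)"
      by (auto simp: field_embedding_def ring_hom_def)
  qed auto
  then show ?thesis using that by blast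
qed

section \<open>The field generated by the square of the right multiplication\<close>

text \<open>
  The set of all combinations \<open>q\<^sub>1v\<^sub>1 + \<dots> + q\<^sub>nv\<^sub>n\<close>, in a form suited to induction on the number of
  generators; \<open>f\<close> lets coefficients act on vectors.
\<close>

primrec poly_span :: "('p \<Rightarrow> 'v \<Rightarrow> 'v) \<Rightarrow> 'v::ab_group_add list \<Rightarrow> 'v set" where
  "poly_span f [] = {0}"
| "poly_span f (v # vs) = {f q v + u | q u. u \<in> poly_span f vs}"

locale irreducible_x_module = x_module UNIV s P a b lam
  for s :: "'f::field \<Rightarrow> 'v \<Rightarrow> 'v::ab_group_add" and P a b lam +
  assumes irreducible: "ab_irreducible UNIV s P a b"
begin

text \<open>
  \<open>pact q\<close> is the operator \<open>q(a\<^sup>2)\<close>, computed by Horner's scheme.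
\<close>

definition pact :: "'f poly \<Rightarrow> 'v \<Rightarrow> 'v" where
  "pact q w = fold_coeffs (\<lambda>c u. s c w + a (a u)) q 0"

lemma pact_0 [simp]: "pact 0 w = 0"
  by (simp add: pact_def)

lemma pact_pCons: "w \<in> M \<Longrightarrow> pact (pCons c q) w = s c w + a (a (pact q w))"
  by (cases "c = 0 \<and> q = 0") (auto simp: pact_def fold_coeffs_pCons_not_0_0_eq)

lemma pact_M [simp]: "w \<in> M \<Longrightarrow> pact q w \<in> M"
  by (induction q) (simp_all add: pact_pCons)

lemma pact_P: "w \<in> P i \<Longrightarrow> pact q w \<in> P i"
  by (induction q) (simp_all add: pact_pCons)

lemma pact_const: "w \<in> M \<Longrightarrow> pact [:c:] w = s c w"
  by (simp add: pact_pCons)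

lemma pact_1 [simp]: "w \<in> M \<Longrightarrow> pact 1 w = w"
  by (simp add: one_pCons pact_const)

lemma pact_add: "w \<in> M \<Longrightarrow> pact (p + q) w = pact p w + pact q w"
  by (induction p q rule: poly_induct2) (simp_all add: pact_pCons s_simps ab_simps algebra_simps)

lemma pact_smult: "w \<in> M \<Longrightarrow> pact (Polynomial.smult c q) w = s c (pact q w)"
  by (induction q) (simp_all add: pact_pCons s_simps ab_simps algebra_simps)

lemma pact_mult: "w \<in> M \<Longrightarrow> pact (p * q) w = pact p (pact q w)"
  by (induction p) (simp_all add: pact_pCons pact_add pact_smult s_simps ab_simps algebra_simps)

lemma pact_uminus: "w \<in> M \<Longrightarrow> pact (- q) w = - pact q w"
  using pact_smult[of w "- 1" q] by (simp add: s_uminus_left)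

lemma pact_add_right: "u \<in> M \<Longrightarrow> w \<in> M \<Longrightarrow> pact q (u + w) = pact q u + pact q w"
  by (induction q) (simp_all add: pact_pCons s_simps ab_simps algebra_simps)

lemma pact_s_right: "w \<in> M \<Longrightarrow> pact q (s c w) = s c (pact q w)"
  by (induction q) (simp_all add: pact_pCons s_simps ab_simps algebra_simps)

lemma pact_0_right [simp]: "pact q 0 = 0"
  using pact_s_right[of 0 q 0] by simp

lemma pact_uminus_right: "w \<in> M \<Longrightarrow> pact q (- w) = - pact q w"
  using pact_s_right[of w q "- 1"] by (simp add: s_uminus_left)

lemma pact_a: "w \<in> M \<Longrightarrow> pact q (a w) = a (pact q w)"
  by (induction q) (simp_all add: pact_pCons s_simps ab_simps algebra_simps)

text \<open>
  By \<open>ab + ba = \<lambda> - a\<^sup>2\<close>, commuting \<open>b\<close> past \<open>a\<close> twice changes the sign twice, and the two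
  correction terms cancel because they commute with \<open>a\<close>. So \<open>a\<^sup>2\<close> is central.
\<close>

lemma b_a_a: "w \<in> M \<Longrightarrow> b (a (a w)) = a (a (b w))"
  by (simp add: a_b ab_simps)

lemma pact_b: "w \<in> M \<Longrightarrow> pact q (b w) = b (pact q w)"
  by (induction q) (simp_all add: pact_pCons s_simps ab_simps b_a_a algebra_simps)

lemma pact_mult_commute: "w \<in> M \<Longrightarrow> pact p (pact q w) = pact q (pact p w)"
  by (metis mult.commute pact_mult)

text \<open>
  Schur's argument: the image of a polynomial in the central even operator \<open>a\<^sup>2\<close> is a graded submodule.
\<close>

lemma pact_zero_or_surj:
  "(\<forall>w\<in>M. pact q w = 0) \<or> (\<forall>w\<in>M. \<exists>w'\<in>M. w = pact q w')"
proof -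
  have "ab_submodule UNIV s P a b (pact q ` M)"
  proof (rule ab_submoduleI)
    show "pact q ` M \<subseteq> M" by auto
    show "0 \<in> pact q ` M" by (metis M_0 image_eqI pact_0_right)
    show "u + v \<in> pact q ` M" if "u \<in> pact q ` M" "v \<in> pact q ` M" for u v
      using that by (auto simp: pact_add_right[symmetric])
    show "s k u \<in> pact q ` M" if "u \<in> pact q ` M" for k u
      using that by (auto simp: pact_s_right[symmetric])
    show "a u \<in> pact q ` M" "b u \<in> pact q ` M" if "u \<in> pact q ` M" for u
      using that by (auto simp: pact_a[symmetric] pact_b[symmetric])
    show "\<exists>u\<in>pact q ` M \<inter> P 0. \<exists>v\<in>pact q ` M \<inter> P 1. w = u + v" if "w \<in> pact q ` M" for w
    proof -
      obtain u v where "u \<in> P 0" "v \<in> P 1" "w = pact q (u + v)"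
        using \<open>w \<in> pact q ` M\<close> by (auto simp: M_iff)
      then have "w = pact q u + pact q v" "pact q u \<in> pact q ` M \<inter> P 0" "pact q v \<in> pact q ` M \<inter> P 1"
        by (auto simp: pact_add_right pact_P)
      then show ?thesis by blast
    qed
  qed
  then have "pact q ` M = {0} \<or> pact q ` M = M"
    using irreducible unfolding ab_irreducible_def by blast
  then show ?thesis by blast
qed

lemma poly_span_M: "set vs \<subseteq> M \<Longrightarrow> u \<in> poly_span pact vs \<Longrightarrow> u \<in> M"
  by (induction vs arbitrary: u) auto

lemma poly_span_add:
  "set vs \<subseteq> M \<Longrightarrow> u \<in> poly_span pact vs \<Longrightarrow> w \<in> poly_span pact vs \<Longrightarrow> u + w \<in> poly_span pact vs"
proof (induction vs arbitrary: u w)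
  case (Cons v vs)
  then obtain p p' x x' where "u = pact p v + x" "w = pact p' v + x'"
    and x: "x \<in> poly_span pact vs" "x' \<in> poly_span pact vs" by auto
  then have "u + w = pact (p + p') v + (x + x')"
    using Cons.prems(1) by (simp add: pact_add algebra_simps)
  moreover have "x + x' \<in> poly_span pact vs" using Cons.IH Cons.prems(1) x by simp
  ultimately show ?case by auto
qed simp

lemma poly_span_pact:
  "set vs \<subseteq> M \<Longrightarrow> u \<in> poly_span pact vs \<Longrightarrow> pact q u \<in> poly_span pact vs"
proof (induction vs arbitrary: u)
  case (Cons v vs)
  then obtain p x where "u = pact p v + x" and x: "x \<in> poly_span pact vs" by auto
  then have "pact q u = pact (q * p) v + pact q x"
    using Cons.prems(1) poly_span_M[of vs x] by (simp add: pact_mult pact_add_right)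
  moreover have "pact q x \<in> poly_span pact vs" using Cons.IH Cons.prems(1) x by simp
  ultimately show ?case by auto
qed simp

text \<open>
  A finitely generated module over \<open>F[t]\<close> on which all nonzero polynomials act surjectively vanishes.
  One can drop a generator \<open>v\<close>: writing \<open>v = tw\<close> and expressing \<open>w\<close> in the generators gives
  \<open>(1 - tq)v = tu\<close> with \<open>u\<close> in the span of the others. The polynomial \<open>r = 1 - tq\<close> is nonzero and hence
  surjective, so every vector is of the form \<open>rw'\<close>, and these lie in the span of the other generators.
\<close>

lemma finitely_generated_divisible_trivial:
  assumes surj: "\<And>q w. q \<noteq> 0 \<Longrightarrow> w \<in> M \<Longrightarrow> \<exists>w'\<in>M. w = pact q w'"
    and "set vs \<subseteq> M" "M \<subseteq> poly_span pact vs"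
  shows "M = {0}"
  using assms(2,3)
proof (induction vs)
  case Nil
  then show ?case using M_0 by (auto simp del: M_0)
next
  case (Cons v vs)
  have v: "v \<in> M" "set vs \<subseteq> M" using Cons.prems(1) by auto
  note span = poly_span_M[OF v(2)] poly_span_add[OF v(2)] poly_span_pact[OF v(2)]
  let ?X = "[:0, 1:] :: 'f poly"
  obtain w where w: "w \<in> M" "v = pact ?X w"
    using surj[of ?X v] v by auto
  then obtain q u where qu: "w = pact q v + u" "u \<in> poly_span pact vs"
    using Cons.prems(2) by auto
  have uM: "u \<in> M" using span(1)[OF qu(2)] .
  let ?r = "1 - ?X * q"
  have "coeff ?r 0 = 1" by simp
  then have r0: "?r \<noteq> 0" by (metis coeff_0 zero_neq_one)
  have "pact ?r v = pact ?X u"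
  proof -
    have "v = pact (?X * q) v + pact ?X u"
      using w(2) qu(1) v uM by (simp only: pact_add_right pact_M pact_mult)
    moreover have "pact ?r v = v - pact (?X * q) v"
      using pact_add[OF v(1), of 1 "- (?X * q)"] v(1)
      by (simp add: pact_uminus del: mult_pCons_left)
    ultimately show ?thesis by (metis add_diff_cancel_left')
  qed
  then have rv: "pact ?r v \<in> poly_span pact vs" using span(3)[OF qu(2)] by simp
  have "M \<subseteq> poly_span pact vs"
  proof
    fix w assume "w \<in> M"
    then obtain w' where w': "w' \<in> M" "w = pact ?r w'" using surj[OF r0] by blast
    then obtain q' u' where qu': "w' = pact q' v + u'" "u' \<in> poly_span pact vs"
      using Cons.prems(2) by auto
    have "u' \<in> M" using span(1)[OF qu'(2)] .
    then have "w = pact q' (pact ?r v) + pact ?r u'"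
      using w'(2) qu'(1) v by (simp only: pact_add_right pact_M pact_mult_commute[of v ?r])
    then show "w \<in> poly_span pact vs"
      using span(2)[OF span(3)[OF rv] span(3)[OF qu'(2)]] by simp
  qed
  then show ?case by (rule Cons.IH[OF v(2)])
qed

text \<open>
  The vectors \<open>v, va, vb, vab\<close> generate over \<open>F[t]\<close>, because the relations allow rewriting every word
  in \<open>a\<close> and \<open>b\<close> as a combination of \<open>1, a, b, ab\<close> with coefficients in the centre \<open>F[t]\<close>.
\<close>

lemma finitely_generated:
  obtains vs where "set vs \<subseteq> M" "M \<subseteq> poly_span pact vs"
proof -
  obtain v i where v: "v \<in> P i" "v \<noteq> 0" by (rule nonzero_homogeneous) (use irreducible in \<open>simp_all add: ab_irreducible_def\<close>)
  have vM [simp]: "v \<in> M" using v by auto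
  define g where "g p q r t = pact p v + pact q (a v) + pact r (b v) + pact t (b (a v))" for p q r t
  let ?N = "{g p q r t | p q r t. True}"
  \<comment> \<open>the polynomials \<open>t\<close>, \<open>\<lambda> - t\<close> and \<open>t - 2\<lambda>\<close>, which are \<open>a\<^sup>2\<close>, \<open>ab + ba\<close> and \<open>b\<^sup>2\<close>\<close>
  let ?X = "[:0, 1:] :: 'f poly" and ?Y = "[:lam, - 1:]" and ?Z = "[:- 2 * lam, 1:]"
  have gM: "g p q r t \<in> M" for p q r t by (simp add: g_def)
  have g_I: "g p q r t \<in> ?N" for p q r t by blast
  have X: "pact ?X w = a (a w)" and Y: "pact ?Y w = s lam w - a (a w)"
    and Z: "pact ?Z w = b (b w)" if "w \<in> M" for w
    using that by (simp_all add: pact_pCons b_b ab_simps s_simps algebra_simps)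
  have g_add: "g p q r t + g p' q' r' t' = g (p + p') (q + q') (r + r') (t + t')" for p q r t p' q' r' t'
    by (simp add: g_def pact_add algebra_simps)
  have g_s: "s c (g p q r t) = g (Polynomial.smult c p) (Polynomial.smult c q) (Polynomial.smult c r) (Polynomial.smult c t)"
    for c p q r t
    by (simp add: g_def pact_smult s_simps)
  have ab: "a (b v) = pact ?Y v - b (a v)" and aba: "a (b (a v)) = pact ?Y (a v) - pact ?X (b v)"
    by (simp_all add: a_b X Y b_a_a)
  have g_a: "a (g p q r t) = g (?X * q + ?Y * r) (p + ?Y * t) (- ?X * t) (- r)" for p q r t
  proof -
    have "a (g p q r t) = pact p (a v) + pact q (a (a v)) + pact r (a (b v)) + pact t (a (b (a v)))"
      by (simp add: g_def ab_simps pact_a)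
    also have "\<dots> = pact p (a v) + pact q (pact ?X v) + (pact r (pact ?Y v) - pact r (b (a v))) +
        (pact t (pact ?Y (a v)) - pact t (pact ?X (b v)))"
      unfolding ab aba X[OF vM, symmetric]
      using pact_add_right[of "pact ?Y v" "- b (a v)" r]
        pact_add_right[of "pact ?Y (a v)" "- pact ?X (b v)" t]
      by (simp add: pact_uminus_right del: X)
    also have "\<dots> = g (?X * q + ?Y * r) (p + ?Y * t) (- ?X * t) (- r)"
      unfolding g_def
      by (simp only: pact_add pact_uminus pact_mult pact_M vM a_M b_M minus_mult_left[symmetric]
          pact_mult_commute[of _ ?X] pact_mult_commute[of _ ?Y]) (simp add: algebra_simps)
    finally show ?thesis .
  qed
  have g_b: "b (g p q r t) = g (?Z * r) (?Z * t) p q" for p q r t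
  proof -
    have "b (g p q r t) = pact p (b v) + pact q (b (a v)) + pact r (b (b v)) + pact t (b (b (a v)))"
      by (simp add: g_def ab_simps pact_b)
    also have "\<dots> = g (?Z * r) (?Z * t) p q"
      unfolding g_def
      by (simp only: Z[symmetric] pact_mult pact_M vM a_M b_M pact_mult_commute[of _ ?Z])
        (simp add: algebra_simps)
    finally show ?thesis .
  qed
  have "ab_submodule UNIV s P a b ?N"
  proof (rule ab_submoduleI)
    show "?N \<subseteq> M" using gM by blast
    have "0 = g 0 0 0 0" by (simp add: g_def)
    then show "0 \<in> ?N" by blast
    show "u + w \<in> ?N" if "u \<in> ?N" "w \<in> ?N" for u w
      using that g_add by (smt (verit, ccfv_threshold) mem_Collect_eq)
    show "s k u \<in> ?N" "a u \<in> ?N" "b u \<in> ?N" if "u \<in> ?N" for k u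
      using that g_s g_a g_b by (smt (verit, ccfv_threshold) mem_Collect_eq)+
    show "\<exists>u\<in>?N \<inter> P 0. \<exists>u'\<in>?N \<inter> P 1. w = u + u'" if "w \<in> ?N" for w
    proof -
      obtain p q r t where w: "w = g p q r t" using \<open>w \<in> ?N\<close> by blast
      have "g p 0 0 t + g 0 q r 0 = w" by (simp add: w g_add)
      moreover have "g p 0 0 t \<in> P i"
        using v(1) b_odd[OF a_odd[OF v(1)]] by (simp add: g_def pact_P add.assoc)
      moreover have "g 0 q r 0 \<in> P (i + 1)"
        using a_odd[OF v(1)] b_odd[OF v(1)] by (simp add: g_def pact_P)
      ultimately show ?thesis
        using g_I by (intro homogeneous_split[of "g p 0 0 t" ?N "g 0 q r 0" i]) auto
    qed
  qed
  moreover have "v = g 1 0 0 0" by (simp add: g_def)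
  ultimately have "?N = M"
    using irreducible v(2) g_I unfolding ab_irreducible_def by (metis (no_types, lifting) singletonD)
  have "M \<subseteq> poly_span pact [v, a v, b v, b (a v)]"
  proof
    fix w assume "w \<in> M"
    then obtain p q r t where w: "w = g p q r t" using \<open>?N = M\<close> by blast
    have "w = pact p v + (pact q (a v) + (pact r (b v) + (pact t (b (a v)) + 0)))"
      by (simp add: w g_def)
    then show "w \<in> poly_span pact [v, a v, b v, b (a v)]"
      unfolding poly_span.simps by blast
  qed
  then show ?thesis using that[of "[v, a v, b v, b (a v)]"] by simp
qed

lemma annihilating_poly:
  obtains p where "p \<noteq> 0" "\<And>w. w \<in> M \<Longrightarrow> pact p w = 0"
proof -
  obtain vs where vs: "set vs \<subseteq> M" "M \<subseteq> poly_span pact vs" by (rule finitely_generated)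
  have "M \<noteq> {0}" using irreducible by (simp add: ab_irreducible_def)
  then obtain q where q: "q \<noteq> 0" "\<not> (\<forall>w\<in>M. \<exists>w'\<in>M. w = pact q w')"
    using finitely_generated_divisible_trivial[OF _ vs] by blast
  then have "\<forall>w\<in>M. pact q w = 0" using pact_zero_or_surj[of q] by blast
  then show ?thesis using that q(1) by blast
qed

text \<open>
  Let \<open>m\<close> generate the ideal of polynomials annihilating \<open>V\<close>, let \<open>\<alpha>\<close> be a root of \<open>m\<close> and \<open>d\<close> the
  minimal polynomial of \<open>\<alpha>\<close>, so \<open>m = dr\<close>. If \<open>d\<close> did not annihilate \<open>V\<close>, it would act surjectively, and
  \<open>r\<close> would annihilate \<open>V\<close>; then \<open>m\<close> divides its own factor \<open>r\<close> and \<open>d\<close> is a unit, which is absurd. So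
  both ideals agree.
\<close>

lemma eigenvalue:
  obtains \<alpha> where "algebraic_elem to_ac \<alpha>"
    "\<And>q. eval_at to_ac \<alpha> q = 0 \<longleftrightarrow> (\<forall>w\<in>M. pact q w = 0)"
proof -
  let ?J = "{q. \<forall>w\<in>M. pact q w = 0}"
  note ev = eval_at_add[OF field_embedding_to_ac] eval_at_mult[OF field_embedding_to_ac]
  obtain p where p: "p \<in> ?J" "p \<noteq> 0" by (rule annihilating_poly) blast
  obtain m where m: "m \<in> ?J" "m \<noteq> 0" "\<And>q. q \<in> ?J \<Longrightarrow> m dvd q"
    by (rule poly_ideal_principal[of ?J p]) (use p in \<open>auto simp: pact_add pact_mult\<close>)
  obtain v i where v: "v \<in> P i" "v \<noteq> 0" by (rule nonzero_homogeneous) (use irreducible in \<open>simp_all add: ab_irreducible_def\<close>)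
  have "Polynomial.degree m \<noteq> 0"
  proof
    assume "Polynomial.degree m = 0"
    then obtain c where c: "m = [:c:]" by (meson degree_eq_zeroE)
    then have "c \<noteq> 0" "s (inverse c) (s c v) = 0" using m(1,2) v by (auto simp: pact_const)
    then show False using v by (simp add: s_s)
  qed
  moreover have "Polynomial.degree (map_poly to_ac m) = Polynomial.degree m"
    by (rule degree_map_poly) simp
  ultimately obtain \<alpha> where \<alpha>: "poly (map_poly to_ac m) \<alpha> = 0"
    using alg_closed_imp_poly_has_root[of "map_poly to_ac m"] by auto
  let ?I = "{q. eval_at to_ac \<alpha> q = 0}"
  have mI: "m \<in> ?I" using \<alpha> by (simp add: eval_at_def)
  obtain d where d: "d \<in> ?I" "d \<noteq> 0" "\<And>q. q \<in> ?I \<Longrightarrow> d dvd q"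
    by (rule poly_ideal_principal[of ?I m]) (use mI m in \<open>auto simp: ev\<close>)
  have "d \<in> ?J"
  proof (rule ccontr)
    assume "d \<notin> ?J"
    then have surj: "\<exists>w'\<in>M. w = pact d w'" if "w \<in> M" for w
      using pact_zero_or_surj[of d] that by blast
    obtain r where r: "m = d * r" using d(3)[OF mI] by (auto elim: dvdE)
    have "pact r w = 0" if wM: "w \<in> M" for w
    proof -
      obtain w' where w': "w' \<in> M" "w = pact d w'" using surj[OF wM] by blast
      then have "pact r w = pact m w'" by (simp add: r pact_mult_commute pact_mult)
      then show ?thesis using m(1) w'(1) by simp
    qed
    then have "m dvd r" by (intro m(3)) blast
    then obtain e where "r = m * e" by (rule dvdE)
    then have "m * (d * e) = m * 1" using r by (simp add: ac_simps)
    then have "d * e = 1" using m(2) by (subst (asm) mult_cancel_left) simp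
    then have "eval_at to_ac \<alpha> 1 = eval_at to_ac \<alpha> d * eval_at to_ac \<alpha> e" by (metis ev(2))
    then have "eval_at to_ac \<alpha> 1 = 0" using d(1) by simp
    then show False by (simp add: eval_at_1[OF field_embedding_to_ac])
  qed
  have "q \<in> ?I \<longleftrightarrow> q \<in> ?J" for q
  proof
    assume "q \<in> ?I"
    then have "d dvd q" by (rule d(3))
    then obtain e where "q = d * e" by (rule dvdE)
    then show "q \<in> ?J" using \<open>d \<in> ?J\<close> by (simp add: pact_mult pact_mult_commute[of _ d])
  next
    assume "q \<in> ?J"
    then have "m dvd q" by (rule m(3))
    then obtain e where "q = m * e" by (rule dvdE)
    then show "q \<in> ?I" using mI by (simp add: ev)
  qed
  moreover have "algebraic_elem to_ac \<alpha>"
    using \<alpha> m(2) by (auto simp: algebraic_elem_def)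
  ultimately show ?thesis using that[of \<alpha>] by simp
qed

text \<open>
  \<open>q(\<alpha>) \<in> K\<close> acts as \<open>q(a\<^sup>2)\<close>. This depends on \<open>q(\<alpha>)\<close> only since the polynomials vanishing at \<open>\<alpha>\<close> are
  those annihilating the module, and all of \<open>K = F(\<alpha>)\<close> is reached because \<open>\<alpha>\<close> is algebraic.
\<close>

lemma extended_scalars:
  obtains \<alpha> sc where "algebraic_elem to_ac \<alpha>"
    "x_module (adjoin to_ac \<alpha>) sc P a b (to_ac lam)"
    "ab_irreducible (adjoin to_ac \<alpha>) sc P a b"
    "\<And>w. w \<in> M \<Longrightarrow> a (a w) = sc \<alpha> w" "\<And>c w. w \<in> M \<Longrightarrow> sc (to_ac c) w = s c w"
proof -
  obtain \<alpha> where \<alpha>: "algebraic_elem to_ac \<alpha>"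
    "\<And>q. eval_at to_ac \<alpha> q = 0 \<longleftrightarrow> (\<forall>w\<in>M. pact q w = 0)"
    by (rule eigenvalue) blast
  let ?ev = "eval_at to_ac \<alpha>"
  let ?K = "adjoin to_ac \<alpha>"
  note emb = field_embedding_to_ac
  have K: "?K = range ?ev" by (rule adjoin_eq_range_eval_at[OF emb \<alpha>(1)])
  define sc where "sc k w = pact (SOME q. ?ev q = k) w" for k w
  have sc: "sc (?ev q) w = pact q w" if "w \<in> M" for q w
  proof -
    define q' where "q' = (SOME q'. ?ev q' = ?ev q)"
    have "?ev q' = ?ev q" unfolding q'_def by (rule someI) (rule refl)
    then have "?ev (q' + - q) = 0"
      by (simp only: eval_at_add[OF emb] eval_at_uminus[OF emb]) simp
    then have "pact (q' + - q) w = 0" using \<alpha>(2) that by blast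
    then have "pact q' w = pact q w"
      using pact_add[OF that, of q' "- q"] by (simp add: pact_uminus[OF that])
    then show ?thesis by (simp add: sc_def q'_def)
  qed
  have ev_const: "to_ac c = ?ev [:c:]" for c
    by (simp add: eval_at_pCons[OF emb] eval_at_0[OF emb])
  have ev_X: "\<alpha> = ?ev [:0, 1:]"
    by (simp add: eval_at_pCons[OF emb] eval_at_0[OF emb])
  have sc_const: "sc (to_ac c) w = s c w" if "w \<in> M" for c w
    unfolding ev_const sc[OF that] using that by (simp add: pact_const)
  have carr_eq: "carr \<lparr>scl = sc, part = P\<rparr> = M" by (simp add: carr_def)
  have vs: "vspace_on ?K sc N" if "N \<subseteq> M" "0 \<in> N" "\<And>u v. u \<in> N \<Longrightarrow> v \<in> N \<Longrightarrow> u + v \<in> N"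
      "\<And>q u. u \<in> N \<Longrightarrow> pact q u \<in> N" for N
  proof -
    have sc': "sc (?ev q) u = pact q u" if "u \<in> N" for q u using sc that \<open>N \<subseteq> M\<close> by blast
    have "sc 1 u = u" if "u \<in> N" for u
      using sc_const[of u 1] that \<open>N \<subseteq> M\<close> by auto
    then show ?thesis
      unfolding vspace_on_def K
      using that(2-4) subsetD[OF that(1)]
      by (auto simp: sc' pact_add pact_mult pact_add_right
          simp flip: eval_at_add[OF emb] eval_at_mult[OF emb])
  qed
  have P_sub: "P i \<subseteq> M" for i by auto
  have mod: "x_module ?K sc P a b (to_ac lam)"
  proof (unfold_locales, unfold carr_eq)
    show "is_subfield ?K" by (rule is_subfield_adjoin)
    show "to_ac lam \<in> ?K" by (rule adjoin_incl)
    show "is_superspace ?K \<lparr>scl = sc, part = P\<rparr>"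
      using vs[of M] vs[of "P i" for i] P_sub P_disjoint unfolding is_superspace_def carr_eq
      by (auto simp: pact_P)
    show "linear_on ?K sc M sc a" "linear_on ?K sc M sc b"
      by (auto simp: K linear_on_def sc a_add b_add pact_a pact_b)
    show "a w \<in> P (i + 1)" "b w \<in> P (i + 1)" if "w \<in> P i" for w i
      using that by (rule a_odd b_odd)+
    show "b (b w) = a (a w) - sc (2 * to_ac lam) w" if "w \<in> M" for w
      using sc_const[OF that, of "2 * lam"] by (simp add: b_b[OF that])
    show "a (b w) = sc (to_ac lam) w - a (a w) - b (a w)" if "w \<in> M" for w
      using that by (simp add: sc_const a_b)
  qed
  moreover have "ab_irreducible ?K sc P a b"
    unfolding ab_irreducible_def carr_eq
  proof (intro conjI allI impI)
    show "M \<noteq> {0}" using irreducible by (simp add: ab_irreducible_def)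
    fix N assume N: "ab_submodule ?K sc P a b N"
    note D = x_module.ab_submoduleD[OF mod N, unfolded carr_eq]
    have "s c u \<in> N" if "u \<in> N" for c u
      using D(4)[of "to_ac c" u] D(1) that sc_const[of u c] by (auto simp: adjoin_incl)
    then have "ab_submodule UNIV s P a b N"
      by (intro ab_submoduleI D)
    then show "N = {0} \<or> N = M" using irreducible by (simp add: ab_irreducible_def)
  qed
  moreover have "a (a w) = sc \<alpha> w" if "w \<in> M" for w
    using sc[OF that, of "[:0, 1:]"] that ev_X by (simp add: pact_pCons)
  ultimately show ?thesis using that \<alpha>(1) sc_const by blast
qed

end

section \<open>Bimodules on which the square of the right multiplication is a scalar\<close>

lemma (in graded_space) basis_onI:
  assumes "finite B" "B \<subseteq> M"
    and span: "\<And>u. u \<in> M \<Longrightarrow> \<exists>c. (\<forall>x\<in>B. c x \<in> K) \<and> u = (\<Sum>x\<in>B. s (c x) x)"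
    and indep: "\<And>c. (\<forall>x\<in>B. c x \<in> K) \<Longrightarrow> (\<Sum>x\<in>B. s (c x) x) = 0 \<Longrightarrow> \<forall>x\<in>B. c x = 0"
  shows "basis_on K s M B"
  unfolding basis_on_def
proof (intro conjI ballI ex_ex1I)
  fix u assume "u \<in> M"
  then obtain c where c: "\<forall>x\<in>B. c x \<in> K" "u = (\<Sum>x\<in>B. s (c x) x)" using span by blast
  then have "u = (\<Sum>x\<in>B. s (restrict c B x) x)" by (metis (mono_tags, lifting) restrict_apply' sum.cong)
  then show "\<exists>c. c \<in> B \<rightarrow>\<^sub>E K \<and> u = (\<Sum>x\<in>B. s (c x) x)"
    using c(1) by (intro exI[of _ "restrict c B"]) auto
next
  fix u c c'
  assume c: "c \<in> B \<rightarrow>\<^sub>E K \<and> u = (\<Sum>x\<in>B. s (c x) x)" and c': "c' \<in> B \<rightarrow>\<^sub>E K \<and> u = (\<Sum>x\<in>B. s (c' x) x)"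
  then have K: "\<forall>x\<in>B. c x \<in> K \<and> c' x \<in> K" by auto
  have "(\<Sum>x\<in>B. s (c x - c' x) x) = (\<Sum>x\<in>B. s (c x) x - s (c' x) x)"
    using K assms(2) by (intro sum.cong) (auto intro!: s_diff_left)
  also have "\<dots> = 0" using c c' by (simp add: sum_subtractf)
  finally have "\<forall>x\<in>B. c x - c' x = 0" using K by (intro indep) auto
  then show "c = c'" using c c' by (intro PiE_ext[of c B "\<lambda>_. K" c']) auto
qed (use assms in auto)

text \<open>
  A graded right module over \<open>\<U>(\<alpha>)\<close>.
\<close>

locale eigen_module = x_module +
  fixes \<alpha>
  assumes \<alpha>_K [simp]: "\<alpha> \<in> K" and a_a: "w \<in> M \<Longrightarrow> a (a w) = s \<alpha> w"
begin

text \<open>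
  The vector \<open>w(p1 + qa + rb + t(ab))\<close>; note that \<open>ab\<close> acts by first applying \<open>a\<close>.
\<close>

definition comb where
  "comb p q r t w = s p w + s q (a w) + s r (b w) + s t (b (a w))"

context
  fixes p q r t w
  assumes K [simp]: "p \<in> K" "q \<in> K" "r \<in> K" "t \<in> K" and w [simp]: "w \<in> M"
begin

lemma comb_M [simp]: "comb p q r t w \<in> M"
  by (simp add: comb_def)

lemma comb_s: "k \<in> K \<Longrightarrow> s k (comb p q r t w) = comb (k * p) (k * q) (k * r) (k * t) w"
  by (simp add: comb_def s_simps)

lemma comb_add:
  "p' \<in> K \<Longrightarrow> q' \<in> K \<Longrightarrow> r' \<in> K \<Longrightarrow> t' \<in> K \<Longrightarrow>
    comb p q r t w + comb p' q' r' t' w = comb (p + p') (q + q') (r + r') (t + t') w"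
  by (simp add: comb_def s_simps algebra_simps)

lemma a_comb:
  "a (comb p q r t w) = comb (\<alpha> * q + (l - \<alpha>) * r) (p + (l - \<alpha>) * t) (- \<alpha> * t) (- r) w"
  by (simp add: comb_def ab_simps s_simps a_b a_a algebra_simps)

lemma b_comb:
  "b (comb p q r t w) = comb ((\<alpha> - 2 * l) * r) ((\<alpha> - 2 * l) * t) p q w"
  by (simp add: comb_def ab_simps s_simps b_b a_a algebra_simps)

lemma comb_even_odd: "comb p q r t w = comb p 0 0 t w + comb 0 q r 0 w"
  by (simp add: comb_def algebra_simps)

end

lemma comb_even_P: "p \<in> K \<Longrightarrow> t \<in> K \<Longrightarrow> w \<in> P i \<Longrightarrow> comb p 0 0 t w \<in> P i"
  using bit_cases[of i] by (auto simp: comb_def)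

lemma comb_odd_P: "q \<in> K \<Longrightarrow> r \<in> K \<Longrightarrow> w \<in> P i \<Longrightarrow> comb 0 q r 0 w \<in> P (i + 1)"
  using a_odd[of w i] b_odd[of w i] by (simp add: comb_def)

lemma comb_1 [simp]: "w \<in> M \<Longrightarrow> comb 1 0 0 0 w = w"
  and comb_0 [simp]: "w \<in> M \<Longrightarrow> comb 0 0 0 0 w = 0"
  by (simp_all add: comb_def)

definition act where
  "act w u = (case u of (p, q, r, t) \<Rightarrow> comb p q r t w)"

lemma act_mult:
  assumes "w \<in> M" "u \<in> K \<times> K \<times> K \<times> K" "u' \<in> K \<times> K \<times> K \<times> K"
  shows "act w (mul (Ualg K \<alpha> l) u u') = act (act w u) u'"
proof -
  obtain p q r t p' q' r' t' where u: "u = (p, q, r, t)" "u' = (p', q', r', t')"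
    by (metis surj_pair)
  let ?w = "comb p q r t w"
  have K [simp]: "p \<in> K" "q \<in> K" "r \<in> K" "t \<in> K" "p' \<in> K" "q' \<in> K" "r' \<in> K" "t' \<in> K"
    using assms(2,3) by (auto simp: u)
  have "comb p' q' r' t' ?w = s p' ?w + s q' (a ?w) + s r' (b ?w) + s t' (b (a ?w))"
    by (simp add: comb_def[of p' q' r' t' ?w])
  also have "\<dots> = act w (mul (Ualg K \<alpha> l) u u')"
    using assms(1) by (simp add: a_comb b_comb comb_s comb_add act_def u Ualg_def algebra_simps)
  finally show ?thesis by (simp add: act_def u)
qed

lemma comb_submodule:
  assumes v: "v \<in> P i"
  shows "ab_submodule K s P a b {comb p q r t v | p q r t. p \<in> K \<and> q \<in> K \<and> r \<in> K \<and> t \<in> K}"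
    (is "ab_submodule K s P a b ?N")
proof (rule ab_submoduleI)
  have [simp]: "v \<in> M" using v by auto
  have I: "comb p q r t v \<in> ?N" if "p \<in> K" "q \<in> K" "r \<in> K" "t \<in> K" for p q r t
    using that by blast
  show "?N \<subseteq> M" by auto
  have "comb 0 0 0 0 v \<in> ?N" by (rule I) simp_all
  then show "0 \<in> ?N" by simp
  fix u assume "u \<in> ?N"
  then obtain p q r t where u: "u = comb p q r t v" and [simp]: "p \<in> K" "q \<in> K" "r \<in> K" "t \<in> K"
    by blast
  show "s k u \<in> ?N" if "k \<in> K" for k
    unfolding u using that by (subst comb_s) (simp_all only: subfield_closed[OF subfield] I \<open>v \<in> M\<close> \<open>p \<in> K\<close> \<open>q \<in> K\<close> \<open>r \<in> K\<close> \<open>t \<in> K\<close>)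
  show "a u \<in> ?N" unfolding u by (subst a_comb, simp_all only: \<open>v \<in> M\<close> \<open>p \<in> K\<close> \<open>q \<in> K\<close> \<open>r \<in> K\<close> \<open>t \<in> K\<close>) (rule I; simp)
  show "b u \<in> ?N" unfolding u by (subst b_comb, simp_all only: \<open>v \<in> M\<close> \<open>p \<in> K\<close> \<open>q \<in> K\<close> \<open>r \<in> K\<close> \<open>t \<in> K\<close>) (rule I; simp)
  show "\<exists>u'\<in>?N \<inter> P 0. \<exists>u''\<in>?N \<inter> P 1. u = u' + u''"
  proof (rule homogeneous_split)
    show "comb p 0 0 t v \<in> ?N" "comb 0 q r 0 v \<in> ?N" by (rule I; simp)+
    show "comb p 0 0 t v \<in> P i" by (rule comb_even_P) (simp_all add: v)
    show "comb 0 q r 0 v \<in> P (i + 1)" by (rule comb_odd_P) (simp_all add: v)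
    show "u = comb p 0 0 t v + comb 0 q r 0 v" unfolding u by (rule comb_even_odd) simp_all
  qed
  fix w assume "w \<in> ?N"
  then obtain p' q' r' t' where w: "w = comb p' q' r' t' v"
    and [simp]: "p' \<in> K" "q' \<in> K" "r' \<in> K" "t' \<in> K"
    by blast
  have "u + w = comb (p + p') (q + q') (r + r') (t + t') v"
    unfolding u w by (rule comb_add) simp_all
  also have "\<dots> \<in> ?N" by (rule I) simp_all
  finally show "u + w \<in> ?N" .
qed

lemma irreducible_cyclic:
  assumes "ab_irreducible K s P a b" "v \<in> P i" "v \<noteq> 0"
  shows "M = {comb p q r t v | p q r t. p \<in> K \<and> q \<in> K \<and> r \<in> K \<and> t \<in> K}" (is "_ = ?N")
proof -
  have "v = comb 1 0 0 0 v" using assms(2) by simp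
  then have "v \<in> ?N" by (metis (mono_tags, lifting) K_closed(1,2) mem_Collect_eq)
  then show ?thesis
    using comb_submodule[OF assms(2)] assms(1,3) unfolding ab_irreducible_def by blast
qed

end

text \<open>
  The polynomial \<open>f\<close> of the classification has no root in \<open>K\<close>.
\<close>

definition no_root :: "'e::field set \<Rightarrow> 'e \<Rightarrow> 'e \<Rightarrow> bool" where
  "no_root K \<alpha> l \<longleftrightarrow> (\<forall>\<epsilon>\<in>K. \<epsilon>\<^sup>2 + (\<alpha> - l) * \<epsilon> + \<alpha> * (\<alpha> - 2 * l) \<noteq> 0)"

text \<open>
  If \<open>0\<close> is a root of \<open>f\<close>, then so is \<open>\<lambda> - \<alpha>\<close>, which is nonzero.
\<close>

lemma no_root_iff:
  assumes "is_subfield K" "\<alpha> \<in> K" "l \<in> K" "\<alpha> \<noteq> l"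
  shows "no_root K \<alpha> l \<longleftrightarrow> (\<nexists>\<epsilon>. nonzero_root K (fpoly \<alpha> l) \<epsilon>)"
proof -
  have "nonzero_root K (fpoly \<alpha> l) (l - \<alpha>)" if "\<alpha> * (\<alpha> - 2 * l) = 0"
    unfolding nonzero_root_def eval_fpoly that
    using assms subfield_closed[OF assms(1)] by (simp add: power2_eq_square algebra_simps)
  then show ?thesis
    unfolding no_root_def nonzero_root_def eval_fpoly by fastforce
qed

lemma carr_Ualg:
  assumes "is_subfield K"
  shows "carr (Ualg K \<alpha> l) = K \<times> K \<times> K \<times> K"
proof -
  have "(p, q, r, t) = (p, 0, 0, t) + (0, q, r, 0)" for p q r t :: 'a by simp
  then show ?thesis
    using subfield_closed[OF assms]
    by (fastforce simp: carr_def Ualg_def)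
qed

lemma Ualg_unital_associative:
  assumes K: "is_subfield K" and "\<alpha> \<in> K" "l \<in> K"
  shows "unital_associative_superalgebra K (Ualg K \<alpha> l) oneU"
proof -
  let ?U = "Ualg K \<alpha> l"
  note [simp] = subfield_closed[OF K] assms(2,3)
  have "is_superspace K ?U"
    unfolding is_superspace_def carr_Ualg[OF K]
    by (auto simp: vspace_on_def Ualg_def zero_prod_def algebra_simps)
  moreover have "bilinear_on K (scl ?U) (carr ?U) (scl ?U) (carr ?U) (scl ?U) (mul ?U)"
    unfolding bilinear_on_def linear_on_def carr_Ualg[OF K]
    by (auto simp: Ualg_def algebra_simps)
  moreover have "mul ?U u u' \<in> part ?U (i + j)" if "u \<in> part ?U i" "u' \<in> part ?U j" for u u' i j
    using that bit_cases[of i] bit_cases[of j] by (auto simp: Ualg_def)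
  moreover have "oneU \<in> part ?U 0" by (simp add: Ualg_def)
  ultimately show ?thesis
    by (simp add: unital_associative_superalgebra_def is_superalgebra_def Ualg_associative
        Ualg_relations(5,6))
qed

text \<open>
  An even element \<open>p + t(ab)\<close> has the conjugate \<open>p + t(\<lambda> - \<alpha>) - t(ab)\<close>, and their product is the scalar
  \<open>p\<^sup>2 + (\<lambda> - \<alpha>)pt + \<alpha>(\<alpha> - 2\<lambda>)t\<^sup>2\<close>, which is \<open>t\<^sup>2f(-p/t)\<close> if \<open>t \<noteq> 0\<close>. The square of an odd element \<open>qa + rb\<close> is the scalar
  \<open>\<alpha>q\<^sup>2 + (\<lambda> - \<alpha>)qr + (\<alpha> - 2\<lambda>)r\<^sup>2\<close>, which is \<open>r\<^sup>2f(-\<alpha>q/r)/\<alpha>\<close> if \<open>r \<noteq> 0\<close>; here \<open>\<alpha> \<noteq> 0\<close> because \<open>f(0) \<noteq> 0\<close>. So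
  neither vanishes on nonzero elements, and inverses are obtained by dividing by them.
\<close>

lemma Ualg_homogeneous_inverse:
  assumes K: "is_subfield K" and \<alpha>: "\<alpha> \<in> K" "l \<in> K" and root: "no_root K \<alpha> l"
    and u: "u \<in> part (Ualg K \<alpha> l) i" "u \<noteq> 0"
  shows "\<exists>w\<in>carr (Ualg K \<alpha> l). mul (Ualg K \<alpha> l) u w = oneU \<and> mul (Ualg K \<alpha> l) w u = oneU"
proof -
  note [simp] = subfield_closed[OF K] \<alpha>
  have f: "\<epsilon>\<^sup>2 + (\<alpha> - l) * \<epsilon> + \<alpha> * (\<alpha> - 2 * l) \<noteq> 0" if "\<epsilon> \<in> K" for \<epsilon>
    using root that by (simp add: no_root_def)
  show ?thesis
  proof (cases "i = 0")
    case True
    then obtain p t where pt: "u = (p, 0, 0, t)" "p \<in> K" "t \<in> K"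
      using u(1) by (auto simp: Ualg_def)
    define n where "n = p\<^sup>2 + (l - \<alpha>) * p * t + \<alpha> * (\<alpha> - 2 * l) * t\<^sup>2"
    have "n \<noteq> 0"
    proof (cases "t = 0")
      case True
      then show ?thesis using u(2) pt by (simp add: n_def zero_prod_def)
    next
      case False
      then have "n = t\<^sup>2 * ((- p / t)\<^sup>2 + (\<alpha> - l) * (- p / t) + \<alpha> * (\<alpha> - 2 * l))"
        by (simp add: n_def power2_eq_square field_simps)
      then show ?thesis using f[of "- p / t"] False pt by simp
    qed
    then show ?thesis
      using pt unfolding carr_Ualg[OF K]
      by (intro bexI[of _ "((p + (l - \<alpha>) * t) / n, 0, 0, - t / n)"])
        (simp_all add: Ualg_def n_def[unfolded power2_eq_square] add_divide_distrib[symmetric]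
          diff_divide_distrib[symmetric] power2_eq_square algebra_simps n_def)
  next
    case False
    then obtain q r where qr: "u = (0, q, r, 0)" "q \<in> K" "r \<in> K"
      using u(1) by (auto simp: Ualg_def)
    define n where "n = \<alpha> * q\<^sup>2 + (l - \<alpha>) * q * r + (\<alpha> - 2 * l) * r\<^sup>2"
    have \<alpha>0: "\<alpha> \<noteq> 0" using f[of 0] by auto
    have "n \<noteq> 0"
    proof (cases "r = 0")
      case True
      then show ?thesis using u(2) qr \<alpha>0 by (simp add: n_def zero_prod_def)
    next
      case False
      then have "\<alpha> * n = r\<^sup>2 * ((- \<alpha> * q / r)\<^sup>2 + (\<alpha> - l) * (- \<alpha> * q / r) + \<alpha> * (\<alpha> - 2 * l))"
        by (simp add: n_def power2_eq_square field_simps)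
      moreover have "- \<alpha> * q / r \<in> K" using qr by (intro subfield_divide[OF K]) simp_all
      ultimately show ?thesis using f[of "- \<alpha> * q / r"] False by auto
    qed
    then show ?thesis
      using qr unfolding carr_Ualg[OF K]
      by (intro bexI[of _ "(0, q / n, r / n, 0)"])
        (simp_all add: Ualg_def add_divide_distrib[symmetric]
          diff_divide_distrib[symmetric] power2_eq_square algebra_simps n_def)
  qed
qed

lemma Ualg_graded_division:
  assumes "is_subfield K" "\<alpha> \<in> K" "l \<in> K" "no_root K \<alpha> l"
  shows "graded_division_algebra K (Ualg K \<alpha> l) oneU"
  using Ualg_unital_associative[OF assms(1-3)] Ualg_homogeneous_inverse[OF assms]
  by (simp add: graded_division_algebra_def zero_prod_def)

context eigen_module
begin

abbreviation U where "U \<equiv> Ualg K \<alpha> l"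

lemma part_U: "part U 0 = K \<times> {0} \<times> {0} \<times> K" "part U 1 = {0} \<times> K \<times> K \<times> {0}"
  by (simp_all add: Ualg_def)

lemma act_M [simp]: "w \<in> M \<Longrightarrow> u \<in> K \<times> K \<times> K \<times> K \<Longrightarrow> act w u \<in> M"
  by (auto simp: act_def)

lemma part_U_carr: "u \<in> part U i \<Longrightarrow> u \<in> K \<times> K \<times> K \<times> K"
  using bit_cases[of i] by (auto simp: part_U)

lemma act_P: "w \<in> P i \<Longrightarrow> u \<in> part U j \<Longrightarrow> act w u \<in> P (i + j)"
  using bit_cases[of j] comb_odd_P[of _ _ w i] by (auto simp: part_U act_def comb_even_P)

lemma act_0_left [simp]: "u \<in> K \<times> K \<times> K \<times> K \<Longrightarrow> act 0 u = 0"
  by (auto simp: act_def comb_def)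

lemma act_0_right [simp]: "w \<in> M \<Longrightarrow> act w 0 = 0" and act_1 [simp]: "w \<in> M \<Longrightarrow> act w oneU = w"
  by (simp_all add: act_def zero_prod_def)

lemma act_add: "w \<in> M \<Longrightarrow> u \<in> K \<times> K \<times> K \<times> K \<Longrightarrow> u' \<in> K \<times> K \<times> K \<times> K \<Longrightarrow>
    act w (u + u') = act w u + act w u'"
  by (auto simp: act_def comb_add)

lemma act_s: "w \<in> M \<Longrightarrow> k \<in> K \<Longrightarrow> u \<in> K \<times> K \<times> K \<times> K \<Longrightarrow> act w (scl U k u) = s k (act w u)"
  by (auto simp: act_def comb_s Ualg_def)

lemma act_add_left: "w \<in> M \<Longrightarrow> w' \<in> M \<Longrightarrow> u \<in> K \<times> K \<times> K \<times> K \<Longrightarrow>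
    act (w + w') u = act w u + act w' u"
  by (auto simp: act_def comb_def s_simps ab_simps algebra_simps)

lemma act_s_left: "w \<in> M \<Longrightarrow> k \<in> K \<Longrightarrow> u \<in> K \<times> K \<times> K \<times> K \<Longrightarrow> act (s k w) u = s k (act w u)"
  by (auto simp: act_def comb_def s_simps ab_simps algebra_simps)

lemma right_supermodule:
  assumes W: "scl W = s" "part W = P"
  shows "right_supermodule K U oneU W act"
proof -
  have carr_W: "carr W = M" using W by (simp add: carr_def)
  have "is_superspace K W"
    using superspace unfolding is_superspace_def carr_W W by simp
  then show ?thesis
    unfolding right_supermodule_def carr_W W carr_Ualg[OF subfield] bilinear_on_def linear_on_def
    using act_P by (auto simp: act_add act_s act_add_left act_s_left act_mult
        simp del: mem_Sigma_iff SigmaE2)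
qed

text \<open>
  The even and the odd component of an element annihilating a homogeneous vector annihilate it as well,
  and a nonzero homogeneous element is invertible.
\<close>

lemma act_injective:
  assumes root: "no_root K \<alpha> l" and v: "v \<in> P i" "v \<noteq> 0"
    and u: "u \<in> K \<times> K \<times> K \<times> K" "act v u = 0"
  shows "u = 0"
proof -
  have [simp]: "v \<in> M" using v by auto
  have homogeneous: "x = 0" if x: "x \<in> part U j" "act v x = 0" for x j
  proof (rule ccontr)
    assume "x \<noteq> 0"
    then obtain y where y: "y \<in> K \<times> K \<times> K \<times> K" "mul U x y = oneU"
      using Ualg_homogeneous_inverse[OF subfield \<alpha>_K l_K root x(1)] unfolding carr_Ualg[OF subfield]
      by blast
    have "v = act v (mul U x y)" using y by simp
    also have "\<dots> = act (act v x) y" by (rule act_mult) (use y part_U_carr[OF x(1)] in auto)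
    also have "\<dots> = 0" using x y by simp
    finally show False using v by simp
  qed
  obtain p q r t where pq: "u = (p, 0, 0, t) + (0, q, r, 0)" and K: "p \<in> K" "q \<in> K" "r \<in> K" "t \<in> K"
    using u(1) by auto
  let ?x = "(p, 0, 0, t)" and ?y = "(0, q, r, 0)"
  have xy: "?x \<in> part U 0" "?y \<in> part U 1" using K by (simp_all add: part_U)
  have sum: "act v ?x + act v ?y = 0"
    using u(2) act_add[of v ?x ?y] K unfolding pq by simp
  then have "act v ?x = - act v ?y" by (simp add: eq_neg_iff_add_eq_0)
  then have "act v ?x \<in> P (i + 1)"
    using P_uminus[OF act_P[OF v(1) xy(2)]] by simp
  moreover have "act v ?x \<in> P i"
    using act_P[OF v(1) xy(1)] unfolding add_0_right .
  ultimately have "act v ?x = 0" using P_disjoint bit_cases[of i] by auto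
  then show ?thesis
    using sum homogeneous[OF xy(1)] homogeneous[OF xy(2)] unfolding pq by simp
qed

text \<open>
  A nonzero homogeneous vector \<open>w = vu\<close> of a submodule recovers the generator as \<open>v = wu\<^sup>-\<^sup>1\<close>.
\<close>

lemma irreducible_of_cyclic:
  assumes root: "no_root K \<alpha> l" and v: "v \<in> P 0" "v \<noteq> 0"
    and cyclic: "\<And>i w. w \<in> P i \<Longrightarrow> \<exists>u\<in>part U i. w = act v u"
  shows "ab_irreducible K s P a b"
  unfolding ab_irreducible_def
proof (intro conjI allI impI)
  have [simp]: "v \<in> M" using v by auto
  show "M \<noteq> {0}" using v P_M by blast
  fix N assume N: "ab_submodule K s P a b N"
  note D = ab_submoduleD[OF N]
  have act_N: "act w u \<in> N" if "w \<in> N" "u \<in> K \<times> K \<times> K \<times> K" for w u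
    using that by (auto simp: act_def comb_def intro!: D)
  show "N = {0} \<or> N = M"
  proof (cases "N = {0}")
    case False
    then obtain w where "w \<in> N" "w \<noteq> 0" using D(2) by blast
    then obtain w i where w: "w \<in> N" "w \<noteq> 0" "w \<in> P i"
      using D(5)[of w] by (metis IntD1 IntD2 add.right_neutral)
    then obtain u where u: "u \<in> part U i" "w = act v u" using cyclic by blast
    then have "u \<noteq> 0" using w(2) by auto
    then obtain y where y: "y \<in> K \<times> K \<times> K \<times> K" "mul U u y = oneU"
      using Ualg_homogeneous_inverse[OF subfield \<alpha>_K l_K root u(1)] unfolding carr_Ualg[OF subfield]
      by blast
    have "act w y = act v (mul U u y)"
      unfolding u(2) by (rule act_mult[symmetric]) (use y part_U_carr[OF u(1)] in auto)
    then have vN: "v \<in> N" using act_N[OF w(1) y(1)] y by simp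
    have PN: "P i \<subseteq> N" for i
    proof
      fix w assume "w \<in> P i"
      then obtain u where "u \<in> part U i" "w = act v u" using cyclic by blast
      then show "w \<in> N" using act_N[OF vN] part_U_carr by blast
    qed
    have "M \<subseteq> N"
    proof
      fix w assume "w \<in> M"
      then obtain x y where "x \<in> P 0" "y \<in> P 1" "w = x + y" by (auto simp: M_iff)
      then show "w \<in> N" using PN by (auto intro: D(3))
    qed
    then show ?thesis using D(1) by blast
  qed blast
qed

text \<open>
  The map \<open>u \<mapsto> vu\<close> is injective over a graded division algebra and surjective by irreducibility. It
  preserves parities only for even \<open>v\<close>; this is the source of the parity change in the classification.
\<close>

lemma regular_iso:
  assumes W: "scl W = s" "part W = P" and irr: "ab_irreducible K s P a b"
    and root: "no_root K \<alpha> l" and v: "v \<in> P 0" "v \<noteq> 0"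
  shows "superspace_iso K U W (act v)"
proof -
  have carr_W: "carr W = M" using W by (simp add: carr_def)
  have [simp]: "v \<in> M" using v by auto
  have diff: "act v u - act v u' = act v (u - u')"
    if "u \<in> K \<times> K \<times> K \<times> K" "u' \<in> K \<times> K \<times> K \<times> K" for u u'
    using that act_add[of v "u - u'" u'] by auto
  have "inj_on (act v) (K \<times> K \<times> K \<times> K)"
  proof (rule inj_onI)
    fix u u' assume u: "u \<in> K \<times> K \<times> K \<times> K" "u' \<in> K \<times> K \<times> K \<times> K" "act v u = act v u'"
    have "u - u' = 0"
      by (rule act_injective[OF root v]) (use u diff[OF u(1,2)] in auto)
    then show "u = u'" by simp
  qed
  moreover have im: "act v ` (K \<times> K \<times> K \<times> K) = M"
    using irreducible_cyclic[OF irr v] by (fastforce simp: act_def image_iff)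
  moreover have "act v ` part U i = P i" for i
  proof
    show "act v ` part U i \<subseteq> P i" using act_P[OF v(1), of _ i, unfolded add_0] by auto
    show "P i \<subseteq> act v ` part U i"
    proof
      fix w assume w: "w \<in> P i"
      then have "w \<in> act v ` (K \<times> K \<times> K \<times> K)" unfolding im by simp
      then obtain p q r t where u: "w = act v (p, q, r, t)" and K: "p \<in> K" "q \<in> K" "r \<in> K" "t \<in> K" by auto
      let ?x = "(p, 0, 0, t)" and ?y = "(0, q, r, 0)"
      have xy: "?x \<in> part U 0" "?y \<in> part U 1" using K by (simp_all add: part_U)
      have sum: "w = act v ?x + act v ?y" "act v ?x \<in> P 0" "act v ?y \<in> P 1"
        using act_add[of v ?x ?y] K act_P[OF v(1) xy(1)] act_P[OF v(1) xy(2)] by (simp_all add: u)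
      show "w \<in> act v ` part U i"
      proof (cases "i = 0")
        case True
        then have "w = act v ?x"
          using homogeneous_sum_unique[of w 0 "act v ?x" "act v ?y"] sum w by simp
        then show ?thesis using xy True by blast
      next
        case False
        then have "i = 1" using bit_cases by blast
        then have "w = act v ?y"
          using homogeneous_sum_unique[of 0 w "act v ?x" "act v ?y"] sum w by simp
        then show ?thesis using xy \<open>i = 1\<close> by blast
      qed
    qed
  qed
  ultimately show ?thesis
    unfolding superspace_iso_def carr_W W carr_Ualg[OF subfield] bij_betw_def linear_on_def
    by (auto simp: act_add act_s simp del: mem_Sigma_iff SigmaE2)
qed

lemma dim_4:
  assumes irr: "ab_irreducible K s P a b" and root: "no_root K \<alpha> l" and v: "v \<in> P i" "v \<noteq> 0"
  shows "has_dim K s M 4"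
proof -
  have [simp]: "v \<in> M" using v by auto
  have indep: "p = 0 \<and> q = 0 \<and> r = 0 \<and> t = 0"
    if "comb p q r t v = 0" "p \<in> K" "q \<in> K" "r \<in> K" "t \<in> K" for p q r t
    using act_injective[OF root v, of "(p, q, r, t)"] that by (simp add: act_def zero_prod_def)
  let ?B = "{v, a v, b v, b (a v)}"
  have dist: "v \<noteq> a v" "v \<noteq> b v" "v \<noteq> b (a v)" "a v \<noteq> b v" "a v \<noteq> b (a v)" "b v \<noteq> b (a v)"
    using indep[of 1 "- 1" 0 0] indep[of 1 0 "- 1" 0] indep[of 1 0 0 "- 1"] indep[of 0 1 "- 1" 0]
      indep[of 0 1 0 "- 1"] indep[of 0 0 1 "- 1"] by (auto simp: comb_def s_uminus_left)
  have sum: "(\<Sum>x\<in>?B. s (c x) x) = comb (c v) (c (a v)) (c (b v)) (c (b (a v))) v" for c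
    using dist by (simp add: comb_def add.assoc)
  have "basis_on K s M ?B"
  proof (rule basis_onI)
    fix u assume "u \<in> M"
    then obtain p q r t where u: "u = comb p q r t v" "p \<in> K" "q \<in> K" "r \<in> K" "t \<in> K"
      using irreducible_cyclic[OF irr v] by blast
    define c where "c x = (if x = v then p else if x = a v then q else if x = b v then r else t)" for x
    have "u = (\<Sum>x\<in>?B. s (c x) x)" unfolding sum using dist u by (simp add: c_def)
    moreover have "\<forall>x\<in>?B. c x \<in> K" using u by (simp add: c_def)
    ultimately show "\<exists>c. (\<forall>x\<in>?B. c x \<in> K) \<and> u = (\<Sum>x\<in>?B. s (c x) x)" by blast
  next
    fix c assume "\<forall>x\<in>?B. c x \<in> K" "(\<Sum>x\<in>?B. s (c x) x) = 0"
    then show "\<forall>x\<in>?B. c x = 0" unfolding sum using indep by simp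
  qed simp_all
  moreover have "card ?B = 4" using dist by simp
  ultimately show ?thesis unfolding has_dim_def by blast
qed

end

context eigen_module
begin

text \<open>
  The odd operator \<open>n = b - \<rho>a\<close> has square zero by the choice of \<open>\<rho>\<close>. So for homogeneous \<open>u \<noteq> 0\<close> either
  \<open>u\<close> or its image under \<open>n\<close> is a nonzero homogeneous vector killed by \<open>n\<close>.
\<close>

lemma odd_root_vector:
  assumes irr: "ab_irreducible K s P a b" and \<rho>: "\<rho> \<in> K"
    and root: "\<rho>\<^sup>2 * \<alpha> - \<rho> * (l - \<alpha>) + (\<alpha> - 2 * l) = 0"
  obtains v i where "v \<in> P i" "v \<noteq> 0" "b v = s \<rho> (a v)"
proof -
  obtain u i where u: "u \<in> P i" "u \<noteq> 0"
    by (rule nonzero_homogeneous) (use irr in \<open>simp_all add: ab_irreducible_def\<close>)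
  have [simp]: "u \<in> M" using u by auto
  note [simp] = \<rho>
  define n where "n = b u - s \<rho> (a u)"
  have n_P: "n \<in> P (i + 1)" unfolding n_def using a_odd[OF u(1)] b_odd[OF u(1)] by (intro P_diff P_s) simp_all
  have "b n - s \<rho> (a n) = s (\<rho>\<^sup>2 * \<alpha> - \<rho> * (l - \<alpha>) + (\<alpha> - 2 * l)) u"
    by (simp add: n_def ab_simps s_simps b_b a_b a_a power2_eq_square algebra_simps)
  then have "b n = s \<rho> (a n)" by (simp add: root)
  then show ?thesis
    using that[of u i] that[of n "i + 1"] u n_P by (cases "n = 0") (auto simp: n_def)
qed

context
  fixes \<rho> v i
  assumes irr: "ab_irreducible K s P a b" and \<rho> [simp]: "\<rho> \<in> K"
    and v: "v \<in> P i" "v \<noteq> 0" "b v = s \<rho> (a v)" and \<alpha>_l: "\<alpha> \<noteq> l"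
begin

lemma v_M [simp]: "v \<in> M"
  using v by auto

lemma b_a_v: "b (a v) = s (l - \<alpha> - \<rho> * \<alpha>) v"
  using b_a[OF v_M] v(3) by (simp add: a_a a_s s_simps)

text \<open>
  Since \<open>vb\<close> and \<open>vab\<close> are multiples of \<open>va\<close> and \<open>v\<close>, the four generators reduce to two.
\<close>

lemma two_dim_span: "w \<in> M \<Longrightarrow> \<exists>p\<in>K. \<exists>q\<in>K. w = s p v + s q (a v)"
proof -
  assume "w \<in> M"
  then obtain p q r t where w: "w = comb p q r t v" and K [simp]: "p \<in> K" "q \<in> K" "r \<in> K" "t \<in> K"
    using irreducible_cyclic[OF irr v(1,2)] by blast
  have "w = s (p + t * (l - \<alpha> - \<rho> * \<alpha>)) v + s (q + r * \<rho>) (a v)"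
    by (simp add: w comb_def v(3) b_a_v s_simps algebra_simps)
  then show ?thesis
    by (intro bexI[of _ "p + t * (l - \<alpha> - \<rho> * \<alpha>)"] bexI[of _ "q + r * \<rho>"]) simp_all
qed

text \<open>
  The vectors \<open>v\<close> and \<open>va\<close> have different parities, so only \<open>va \<noteq> 0\<close> is at stake: otherwise also \<open>vb = 0\<close>,
  and \<open>ab + ba = \<lambda> - \<alpha>\<close> would annihilate \<open>v\<close>.
\<close>

lemma two_dim_indep:
  assumes "p \<in> K" "q \<in> K" "s p v + s q (a v) = 0"
  shows "p = 0 \<and> q = 0"
proof -
  have s_zero: "k = 0" if "k \<in> K" "u \<in> M" "u \<noteq> 0" "s k u = 0" for k u
    using that s_s[of "inverse k" k u] by (cases "k = 0") auto
  have "a v \<noteq> 0"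
  proof
    assume "a v = 0"
    then have "s (l - \<alpha>) v = 0" using v(3) a_b[OF v_M] a_a[OF v_M] by (simp add: s_simps)
    then show False using s_zero[of "l - \<alpha>" v] v(2) \<alpha>_l by simp
  qed
  have "s p v = - s q (a v)" using assms(3) by (simp add: eq_neg_iff_add_eq_0)
  then have "s p v \<in> P (i + 1)" using a_odd[OF v(1)] assms(2) by simp
  moreover have "s p v \<in> P i" using v(1) assms(1) by simp
  ultimately have "s p v = 0" using P_disjoint bit_cases[of i] by auto
  then show ?thesis
    using s_zero[of p v] s_zero[of q "a v"] assms v(2) \<open>a v \<noteq> 0\<close> by simp
qed

lemma dim_2: "has_dim K s M 2"
proof -
  have dist: "v \<noteq> a v"
    using two_dim_indep[of 1 "- 1"] by (auto simp: s_uminus_left)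
  have sum: "(\<Sum>x\<in>{v, a v}. s (c x) x) = s (c v) v + s (c (a v)) (a v)" for c
    using dist by simp
  have "basis_on K s M {v, a v}"
  proof (rule basis_onI)
    fix u assume "u \<in> M"
    then obtain p q where u: "u = s p v + s q (a v)" "p \<in> K" "q \<in> K"
      using two_dim_span by blast
    define c where "c x = (if x = v then p else q)" for x
    have "u = (\<Sum>x\<in>{v, a v}. s (c x) x)" unfolding sum using dist u by (simp add: c_def)
    moreover have "\<forall>x\<in>{v, a v}. c x \<in> K" using u by (simp add: c_def)
    ultimately show "\<exists>c. (\<forall>x\<in>{v, a v}. c x \<in> K) \<and> u = (\<Sum>x\<in>{v, a v}. s (c x) x)" by blast
  next
    fix c assume "\<forall>x\<in>{v, a v}. c x \<in> K" "(\<Sum>x\<in>{v, a v}. s (c x) x) = 0"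
    then show "\<forall>x\<in>{v, a v}. c x = 0" unfolding sum using two_dim_indep[of "c v" "c (a v)"] by simp
  qed simp_all
  moreover have "card {v, a v} = 2" using dist by simp
  ultimately show ?thesis unfolding has_dim_def by blast
qed

end

end

section \<open>The explicit bimodules\<close>

lemma realized_isomorphic:
  assumes "realized K s P a b l \<iota> W" and "realized K s' P' a' b' l \<iota> W'"
    and iso: "superspace_iso K W W' \<phi>"
    and \<phi>: "\<And>w. w \<in> carr W \<Longrightarrow> \<phi> (a w) = a' (\<phi> w)" "\<And>w. w \<in> carr W \<Longrightarrow> \<phi> (b w) = b' (\<phi> w)"
  shows "isomorphic_bimodules K (algA lam) W W'"
proof -
  interpret W: realized K s P a b l \<iota> W by fact
  interpret W': realized K s' P' a' b' l \<iota> W' by fact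
  have add: "\<phi> (u + w) = \<phi> u + \<phi> w" if "u \<in> W.M" "w \<in> W.M" for u w
    using iso that by (auto simp: superspace_iso_def linear_on_def)
  have sc: "\<phi> (s k u) = s' k (\<phi> u)" if "u \<in> W.M" "k \<in> K" for u k
    using iso that by (auto simp: superspace_iso_def linear_on_def)
  have \<phi>M: "\<phi> u \<in> W'.M" if "u \<in> W.M" for u
    using iso that by (auto simp: superspace_iso_def bij_betw_def)
  have \<phi>P: "\<phi> u \<in> P' i" if "u \<in> P i" for u i
    using iso that by (auto simp: superspace_iso_def)
  have "\<phi> (lact W (c, d) x) = lact W' (c, d) (\<phi> x) \<and> \<phi> (ract W x (c, d)) = ract W' (\<phi> x) (c, d)"
    if "x \<in> W.M" for c d x
  proof -
    obtain u w where x: "x = u + w" "u \<in> P 0" "w \<in> P 1" using \<open>x \<in> W.M\<close> by (auto simp: W.M_iff)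
    have [simp]: "u \<in> W.M" "w \<in> W.M" using x by auto
    have [simp]: "\<phi> u \<in> P' 0" "\<phi> w \<in> P' 1" using x \<phi>P by auto
    have [simp]: "\<phi> u \<in> W'.M" by (rule W'.P_M[of _ 0]) simp
    have [simp]: "\<phi> w \<in> W'.M" by (rule W'.P_M[of _ 1]) simp
    have neg: "\<phi> (- y) = - \<phi> y" if "y \<in> W.M" for y
      using sc[of y "- 1"] that \<phi>M[OF that] by (simp add: W.s_uminus_left W'.s_uminus_left)
    have "\<phi> (b u - b w) = b' (\<phi> u) - b' (\<phi> w)"
      using add[of "b u" "- b w"] \<phi>(2) by (simp add: neg)
    then show ?thesis
      using x(2,3) by (simp add: x(1) W.lact_W_sum W'.lact_W_sum W.ract_W W'.ract_W add sc \<phi>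
          W.a_add W'.a_add)
  qed
  then show ?thesis
    unfolding isomorphic_bimodules_def using iso by (auto intro!: exI[of _ \<phi>])
qed

definition scale2 :: "'e::field \<Rightarrow> 'e \<times> 'e \<Rightarrow> 'e \<times> 'e" where
  "scale2 k = (\<lambda>(p, q). (k * p, k * q))"

definition grade2 :: "'e::field set \<Rightarrow> bit \<Rightarrow> ('e \<times> 'e) set" where
  "grade2 K i = (if i = 0 then K \<times> {0} else {0} \<times> K)"

definition right2 :: "'e::field \<Rightarrow> 'e \<times> 'e \<Rightarrow> 'e \<times> 'e" where
  "right2 \<alpha> = (\<lambda>(p, q). (q * \<alpha>, p))"

text \<open>
  The signed left multiplication on \<open>V\<^sup>\<epsilon>\<^sub>\<alpha>\<^sub>,\<^sub>\<lambda>(1|1)\<close> and \<open>V\<^sub>\<lambda>(1|1)\<close>, with \<open>vb = \<rho>va\<close>.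
\<close>

definition left2 :: "'e::field \<Rightarrow> 'e \<Rightarrow> 'e \<Rightarrow> 'e \<times> 'e \<Rightarrow> 'e \<times> 'e" where
  "left2 \<rho> \<alpha> l = (\<lambda>(p, q). (q * (l - \<alpha> - \<rho> * \<alpha>), p * \<rho>))"

text \<open>
  The common form of the two families of two-dimensional bimodules: the slope \<open>\<rho>\<close> is \<open>\<epsilon>/\<alpha>\<close> for the
  first and \<open>-2\<close>, together with \<open>\<alpha> = 0\<close>, for the second.
\<close>

definition two_dim :: "'e::field set \<Rightarrow> ('f \<Rightarrow> 'e) \<Rightarrow> 'e \<Rightarrow> 'e \<Rightarrow> 'e \<Rightarrow> ('e, 'f \<times> 'f, 'e \<times> 'e) superbimodule" where
  "two_dim K \<iota> \<rho> \<alpha> l = bimodule_by_x \<iota> scale2 (grade2 K) (\<lambda>(p, q). (q * (\<alpha> - l + \<rho> * \<alpha>), p * \<rho>)) (right2 \<alpha>)"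

lemma V11_two_dim: "\<alpha> \<noteq> 0 \<Longrightarrow> V11 K \<iota> \<epsilon> \<alpha> l = two_dim K \<iota> (\<epsilon> / \<alpha>) \<alpha> l"
  by (simp add: V11_def two_dim_def scale2_def[abs_def] grade2_def[abs_def] right2_def algebra_simps)

lemma V11_zero_two_dim: "V11_zero K \<iota> l = two_dim K \<iota> (- 2) 0 l"
  by (simp add: V11_zero_def two_dim_def scale2_def[abs_def] grade2_def[abs_def] right2_def)

definition scale4 :: "'e::field \<Rightarrow> 'e \<times> 'e \<times> 'e \<times> 'e \<Rightarrow> 'e \<times> 'e \<times> 'e \<times> 'e" where
  "scale4 k = (\<lambda>(p, q, r, t). (k * p, k * q, k * r, k * t))"

definition grade4 :: "'e::field set \<Rightarrow> bit \<Rightarrow> ('e \<times> 'e \<times> 'e \<times> 'e) set" where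
  "grade4 K i = (if i = 0 then K \<times> {0} \<times> {0} \<times> K else {0} \<times> K \<times> K \<times> {0})"

definition right4 :: "'e::field \<Rightarrow> 'e \<Rightarrow> 'e \<times> 'e \<times> 'e \<times> 'e \<Rightarrow> 'e \<times> 'e \<times> 'e \<times> 'e" where
  "right4 \<alpha> l = (\<lambda>(p, q, r, t). (q * (l - \<alpha>) + r * \<alpha>, t * \<alpha>, p + t * (\<alpha> - l), q))"

text \<open>
  Compared with the table of \<open>V\<^sub>\<alpha>\<^sub>,\<^sub>\<lambda>(2|2)\<close>, the values at the odd basis vectors \<open>xv\<close> and \<open>vx\<close> have changed sign.
\<close>

definition left4 :: "'e::field \<Rightarrow> 'e \<Rightarrow> 'e \<times> 'e \<times> 'e \<times> 'e \<Rightarrow> 'e \<times> 'e \<times> 'e \<times> 'e" where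
  "left4 \<alpha> l = (\<lambda>(p, q, r, t). (q * (\<alpha> - 2 * l), p, t * (2 * l - \<alpha>), - r))"

lemma V22_by_x:
  "V22 K \<iota> \<alpha> l = bimodule_by_x \<iota> scale4 (grade4 K)
     (\<lambda>(p, q, r, t). (q * (2 * l - \<alpha>), p, t * (2 * l - \<alpha>), r)) (right4 \<alpha> l)"
  by (simp add: V22_def scale4_def[abs_def] grade4_def[abs_def] right4_def)

lemma carr_grade2:
  assumes "is_subfield K"
  shows "carr \<lparr>scl = s, part = grade2 K\<rparr> = K \<times> K"
proof -
  have "(p, q) = (p, 0) + (0, q)" for p q :: 'a by simp
  then show ?thesis
    using subfield_closed[OF assms] by (fastforce simp: carr_def grade2_def)
qed

lemma carr_grade4:
  assumes "is_subfield K"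
  shows "carr \<lparr>scl = s, part = grade4 K\<rparr> = K \<times> K \<times> K \<times> K"
proof -
  have "(p, q, r, t) = (p, 0, 0, t) + (0, q, r, 0)" for p q r t :: 'a by simp
  then show ?thesis
    using subfield_closed[OF assms] by (fastforce simp: carr_def grade4_def)
qed

lemma two_dim_eigen_module:
  assumes K: "is_subfield K" and K_in: "\<alpha> \<in> K" "l \<in> K" "\<rho> \<in> K"
    and root: "\<rho>\<^sup>2 * \<alpha> - \<rho> * (l - \<alpha>) + (\<alpha> - 2 * l) = 0"
  shows "eigen_module K scale2 (grade2 K) (right2 \<alpha>) (left2 \<rho> \<alpha> l) l \<alpha>"
proof -
  note [simp] = subfield_closed[OF K] K_in
  have r: "\<rho> * (l - \<alpha> - \<rho> * \<alpha>) = \<alpha> - 2 * l"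
    using root by (simp add: algebra_simps power2_eq_square)
  show ?thesis
  proof (unfold_locales, unfold carr_grade2[OF K])
    show "is_superspace K \<lparr>scl = scale2, part = grade2 K\<rparr>"
      unfolding is_superspace_def carr_grade2[OF K]
      by (auto simp: vspace_on_def scale2_def grade2_def zero_prod_def algebra_simps)
    show "linear_on K scale2 (K \<times> K) scale2 (right2 \<alpha>)" "linear_on K scale2 (K \<times> K) scale2 (left2 \<rho> \<alpha> l)"
      by (auto simp: linear_on_def scale2_def right2_def left2_def algebra_simps)
    show "right2 \<alpha> w \<in> grade2 K (i + 1)" "left2 \<rho> \<alpha> l w \<in> grade2 K (i + 1)" if "w \<in> grade2 K i" for w i
      using that bit_cases[of i] by (auto simp: grade2_def right2_def left2_def)
    fix w assume "w \<in> K \<times> K"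
    then obtain p q where w: "w = (p, q)" by blast
    show "right2 \<alpha> (right2 \<alpha> w) = scale2 \<alpha> w" by (simp add: w scale2_def right2_def)
    have "p * \<rho> * (l - \<alpha> - \<rho> * \<alpha>) = p * (\<alpha> - 2 * l)" "q * (l - \<alpha> - \<rho> * \<alpha>) * \<rho> = q * (\<alpha> - 2 * l)"
      by (simp_all only: r[symmetric] mult.assoc) (simp add: mult.commute)
    then show "left2 \<rho> \<alpha> l (left2 \<rho> \<alpha> l w) = right2 \<alpha> (right2 \<alpha> w) - scale2 (2 * l) w"
      unfolding w left2_def right2_def scale2_def by (simp add: algebra_simps)
    show "right2 \<alpha> (left2 \<rho> \<alpha> l w) = scale2 l w - right2 \<alpha> (right2 \<alpha> w) - left2 \<rho> \<alpha> l (right2 \<alpha> w)"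
      by (simp add: w scale2_def right2_def left2_def algebra_simps)
  qed (simp_all add: K)
qed

lemma four_dim_eigen_module:
  assumes K: "is_subfield K" and K_in: "\<alpha> \<in> K" "l \<in> K"
  shows "eigen_module K scale4 (grade4 K) (right4 \<alpha> l) (left4 \<alpha> l) l \<alpha>"
proof -
  note [simp] = subfield_closed[OF K] K_in
  show ?thesis
  proof (unfold_locales, unfold carr_grade4[OF K])
    show "is_superspace K \<lparr>scl = scale4, part = grade4 K\<rparr>"
      unfolding is_superspace_def carr_grade4[OF K]
      by (auto simp: vspace_on_def scale4_def grade4_def zero_prod_def algebra_simps)
    show "linear_on K scale4 (K \<times> K \<times> K \<times> K) scale4 (right4 \<alpha> l)"
      "linear_on K scale4 (K \<times> K \<times> K \<times> K) scale4 (left4 \<alpha> l)"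
      by (auto simp: linear_on_def scale4_def right4_def left4_def algebra_simps)
    show "right4 \<alpha> l w \<in> grade4 K (i + 1)" "left4 \<alpha> l w \<in> grade4 K (i + 1)" if "w \<in> grade4 K i" for w i
      using that bit_cases[of i] by (auto simp: grade4_def right4_def left4_def)
    fix w assume "w \<in> K \<times> K \<times> K \<times> K"
    then obtain p q r t where w: "w = (p, q, r, t)" by blast
    show "right4 \<alpha> l (right4 \<alpha> l w) = scale4 \<alpha> w"
      "left4 \<alpha> l (left4 \<alpha> l w) = right4 \<alpha> l (right4 \<alpha> l w) - scale4 (2 * l) w"
      "right4 \<alpha> l (left4 \<alpha> l w) = scale4 l w - right4 \<alpha> l (right4 \<alpha> l w) - left4 \<alpha> l (right4 \<alpha> l w)"
      by (simp_all add: w scale4_def right4_def left4_def algebra_simps)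
  qed (simp_all add: K)
qed

lemma realized_two_dim:
  assumes "eigen_module K scale2 (grade2 K) (right2 \<alpha>) (left2 \<rho> \<alpha> l) l \<alpha>"
    and "field_embedding \<iota>" "range \<iota> \<subseteq> K"
  shows "realized K scale2 (grade2 K) (right2 \<alpha>) (left2 \<rho> \<alpha> l) l \<iota> (two_dim K \<iota> \<rho> \<alpha> l)"
proof -
  interpret eigen_module K scale2 "grade2 K" "right2 \<alpha>" "left2 \<rho> \<alpha> l" l \<alpha> by fact
  show ?thesis
    by unfold_locales (use assms(2,3) in \<open>auto simp: realizes_def two_dim_def bimodule_by_x_def
      grade2_def left2_def scale2_def algebra_simps\<close>)
qed

lemma realized_V22:
  assumes "eigen_module K scale4 (grade4 K) (right4 \<alpha> l) (left4 \<alpha> l) l \<alpha>"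
    and "field_embedding \<iota>" "range \<iota> \<subseteq> K"
  shows "realized K scale4 (grade4 K) (right4 \<alpha> l) (left4 \<alpha> l) l \<iota> (V22 K \<iota> \<alpha> l)"
proof -
  interpret eigen_module K scale4 "grade4 K" "right4 \<alpha> l" "left4 \<alpha> l" l \<alpha> by fact
  show ?thesis
    by unfold_locales (use assms(2,3) in \<open>auto simp: realizes_def V22_by_x bimodule_by_x_def
      grade4_def left4_def scale4_def algebra_simps\<close>)
qed

text \<open>
  A nonzero homogeneous vector is a multiple of \<open>v\<close> or of \<open>vx\<close>, and each of these two generates the
  other because \<open>vx\<cdot>x = \<alpha>v\<close> with \<open>\<alpha> \<noteq> 0\<close>.
\<close>

lemma two_dim_irreducible:
  assumes "eigen_module K scale2 (grade2 K) (right2 \<alpha>) (left2 \<rho> \<alpha> l) l \<alpha>" and \<alpha>: "\<alpha> \<noteq> 0"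
  shows "ab_irreducible K scale2 (grade2 K) (right2 \<alpha>) (left2 \<rho> \<alpha> l)"
proof -
  interpret eigen_module K scale2 "grade2 K" "right2 \<alpha>" "left2 \<rho> \<alpha> l" l \<alpha> by fact
  note M_eq = carr_grade2[OF subfield]
  show ?thesis
    unfolding ab_irreducible_def
  proof (intro conjI allI impI)
    have "(1, 0) \<in> M" unfolding M_eq by simp
    then show "M \<noteq> {0}" by (auto simp: zero_prod_def)
    fix N assume N: "ab_submodule K scale2 (grade2 K) (right2 \<alpha>) (left2 \<rho> \<alpha> l) N"
    note D = ab_submoduleD[OF N]
    show "N = {0} \<or> N = M"
    proof (cases "N = {0}")
      case False
      then obtain w where "w \<in> N" "w \<noteq> 0" using D(2) by blast
      then obtain w i where w: "w \<in> N" "w \<noteq> 0" "w \<in> grade2 K i"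
        using D(5)[of w] by (metis IntD1 IntD2 add.right_neutral)
      have "(1, 0) \<in> N \<and> (0, 1) \<in> N"
      proof (cases "i = 0")
        case True
        then obtain p where p: "w = (p, 0)" "p \<noteq> 0" "p \<in> K"
          using w by (auto simp: grade2_def zero_prod_def)
        then have 1: "(1, 0) \<in> N" using D(4)[of "inverse p" w] w(1) by (simp add: scale2_def)
        then show ?thesis using D(6)[OF 1] by (simp add: right2_def)
      next
        case False
        then obtain q where q: "w = (0, q)" "q \<noteq> 0" "q \<in> K"
          using w by (auto simp: grade2_def zero_prod_def)
        then have 1: "(0, 1) \<in> N" using D(4)[of "inverse q" w] w(1) by (simp add: scale2_def)
        then show ?thesis
          using D(4)[OF _ D(6)[OF 1], of "inverse \<alpha>"] \<alpha> by (simp add: right2_def scale2_def)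
      qed
      then have e: "(1, 0) \<in> N" "(0, 1) \<in> N" by auto
      have "(p, q) \<in> N" if "p \<in> K" "q \<in> K" for p q
        using D(3)[OF D(4)[OF that(1) e(1)] D(4)[OF that(2) e(2)]] by (simp add: scale2_def)
      then have "M \<subseteq> N" unfolding M_eq by auto
      then show ?thesis using D(1) by blast
    qed blast
  qed
qed

text \<open>
  The explicit bimodule is the regular module in the basis \<open>1 = v\<close>, \<open>a = vx\<close>, \<open>b = xv\<close>, \<open>ab = -x(vx)\<close>; the
  last sign is that of the left action on the odd vector \<open>vx\<close>.
\<close>

lemma four_dim_irreducible:
  assumes "eigen_module K scale4 (grade4 K) (right4 \<alpha> l) (left4 \<alpha> l) l \<alpha>" and "no_root K \<alpha> l"
  shows "ab_irreducible K scale4 (grade4 K) (right4 \<alpha> l) (left4 \<alpha> l)"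
proof -
  interpret eigen_module K scale4 "grade4 K" "right4 \<alpha> l" "left4 \<alpha> l" l \<alpha> by fact
  have act: "act (1, 0, 0, 0) (p, r, q, - t) = (p, q, r, t)" for p q r t
    unfolding act_def comb_def by (simp add: scale4_def right4_def left4_def)
  show ?thesis
  proof (rule irreducible_of_cyclic[OF assms(2)])
    show "oneU \<in> grade4 K 0" "oneU \<noteq> 0" by (simp_all add: grade4_def zero_prod_def)
    fix i w assume "w \<in> grade4 K i"
    moreover obtain p q r t where "w = (p, q, r, t)" by (metis surj_pair)
    ultimately show "\<exists>u\<in>part U i. w = act oneU u"
      using act[of p r q t] by (intro bexI[of _ "(p, r, q, - t)"]) (auto simp: grade4_def Ualg_def split: if_splits)
  qed
qed


lemma superspace_iso_trans:
  assumes "superspace_iso K V W \<phi>" "superspace_iso K W Y \<psi>"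
  shows "superspace_iso K V Y (\<psi> \<circ> \<phi>)"
proof -
  have "\<phi> u \<in> carr W" if "u \<in> carr V" for u
    using assms(1) that by (auto simp: superspace_iso_def bij_betw_def)
  moreover have "(\<psi> \<circ> \<phi>) ` part V i = part Y i" for i
    unfolding image_comp[symmetric] using assms by (simp add: superspace_iso_def)
  ultimately show ?thesis
    using assms unfolding superspace_iso_def linear_on_def by (auto intro: bij_betw_trans)
qed

context eigen_module
begin

lemma isomorphic_V22:
  assumes W: "realized K s P a b l \<iota> W" and irr: "ab_irreducible K s P a b"
    and root: "no_root K \<alpha> l" and v: "v \<in> P 0" "v \<noteq> 0"
  shows "isomorphic_bimodules K (algA lam) (V22 K \<iota> \<alpha> l) W"
proof -
  interpret W: realized K s P a b l \<iota> W by fact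
  have [simp]: "v \<in> M" using v by auto
  have em: "eigen_module K scale4 (grade4 K) (right4 \<alpha> l) (left4 \<alpha> l) l \<alpha>"
    by (rule four_dim_eigen_module) (simp_all add: subfield)
  then have R: "realized K scale4 (grade4 K) (right4 \<alpha> l) (left4 \<alpha> l) l \<iota> (V22 K \<iota> \<alpha> l)"
    by (rule realized_V22) (auto simp: W.\<iota>)
  let ?X = "V22 K \<iota> \<alpha> l"
  have X: "scl ?X = scale4" "part ?X = grade4 K" by (simp_all add: V22_by_x bimodule_by_x_def)
  have carr_X: "carr ?X = K \<times> K \<times> K \<times> K"
    using carr_grade4[OF subfield] X by (simp add: carr_def)
  \<comment> \<open>the basis \<open>v, xv, vx, x(vx)\<close> corresponds to \<open>1, b, a, -ab\<close>\<close>
  let ?\<psi> = "\<lambda>(p, q, r, t). (p, r, q, - t)"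
  have "superspace_iso K ?X U ?\<psi>"
    unfolding superspace_iso_def carr_X carr_Ualg[OF subfield] X
  proof (intro conjI allI)
    show "bij_betw ?\<psi> (K \<times> K \<times> K \<times> K) (K \<times> K \<times> K \<times> K)"
      by (rule bij_betwI[where g = ?\<psi>]) auto
    show "?\<psi> ` grade4 K i = part U i" for i
    proof -
      have "?\<psi> ` grade4 K i \<subseteq> part U i" using bit_cases[of i] by (auto simp: grade4_def Ualg_def)
      moreover have "x \<in> ?\<psi> ` grade4 K i" if "x \<in> part U i" for x
        using that bit_cases[of i]
        by (intro image_eqI[of _ _ "?\<psi> x"]) (auto simp: grade4_def Ualg_def)
      ultimately show ?thesis by blast
    qed
    show "linear_on K scale4 (K \<times> K \<times> K \<times> K) (scl U) ?\<psi>"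
      by (auto simp: linear_on_def scale4_def Ualg_def)
  qed
  moreover have "superspace_iso K U W (act v)"
    by (rule regular_iso[OF _ _ irr root v]) simp_all
  ultimately have "superspace_iso K ?X W (act v \<circ> ?\<psi>)"
    by (rule superspace_iso_trans)
  then show ?thesis
  proof (rule realized_isomorphic[OF R W])
    fix w assume "w \<in> carr ?X"
    then obtain p q r t where w: "w = (p, q, r, t)" "p \<in> K" "q \<in> K" "r \<in> K" "t \<in> K"
      unfolding carr_X by auto
    then show "(act v \<circ> ?\<psi>) (right4 \<alpha> l w) = a ((act v \<circ> ?\<psi>) w)"
      "(act v \<circ> ?\<psi>) (left4 \<alpha> l w) = b ((act v \<circ> ?\<psi>) w)"
      by (simp_all add: act_def right4_def left4_def a_comb b_comb algebra_simps)
  qed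
qed

text \<open>
  Once \<open>vb = \<rho>va\<close> is achieved, the action is determined on the basis \<open>v, va\<close>: \<open>va\<^sup>2 = \<alpha>v\<close>, and \<open>vab\<close>
  follows from \<open>ab + ba = \<lambda> - \<alpha>\<close>.
\<close>

lemma isomorphic_two_dim:
  assumes W: "realized K s P a b l \<iota> W" and irr: "ab_irreducible K s P a b"
    and \<rho>: "\<rho> \<in> K" and root: "\<rho>\<^sup>2 * \<alpha> - \<rho> * (l - \<alpha>) + (\<alpha> - 2 * l) = 0" and \<alpha>_l: "\<alpha> \<noteq> l"
    and v: "v \<in> P 0" "v \<noteq> 0" "b v = s \<rho> (a v)"
  shows "isomorphic_bimodules K (algA lam) (two_dim K \<iota> \<rho> \<alpha> l) W"
proof -
  interpret W: realized K s P a b l \<iota> W by fact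
  have [simp]: "v \<in> M" using v by auto
  note [simp] = \<rho>
  have em: "eigen_module K scale2 (grade2 K) (right2 \<alpha>) (left2 \<rho> \<alpha> l) l \<alpha>"
    by (rule two_dim_eigen_module) (simp_all add: subfield root)
  then have R: "realized K scale2 (grade2 K) (right2 \<alpha>) (left2 \<rho> \<alpha> l) l \<iota> (two_dim K \<iota> \<rho> \<alpha> l)"
    by (rule realized_two_dim) (auto simp: W.\<iota>)
  let ?X = "two_dim K \<iota> \<rho> \<alpha> l"
  have X: "scl ?X = scale2" "part ?X = grade2 K" by (simp_all add: two_dim_def bimodule_by_x_def)
  have carr_X: "carr ?X = K \<times> K"
    using carr_grade2[OF subfield] X by (simp add: carr_def)
  note span = two_dim_span[OF irr \<rho> v \<alpha>_l] and indep = two_dim_indep[OF irr \<rho> v \<alpha>_l]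
    and b_a_v = b_a_v[OF irr \<rho> v \<alpha>_l]
  define \<phi> where "\<phi> = (\<lambda>(p, q). s p v + s q (a v))"
  have "superspace_iso K ?X W \<phi>"
    unfolding superspace_iso_def carr_X W.carr_W X W.scl_W W.part_W
  proof (intro conjI allI)
    have "inj_on \<phi> (K \<times> K)"
    proof (rule inj_onI)
      fix x y assume xy: "x \<in> K \<times> K" "y \<in> K \<times> K" "\<phi> x = \<phi> y"
      obtain p q p' q' where pq: "x = (p, q)" "y = (p', q')" by (metis surj_pair)
      have "s (p - p') v + s (q - q') (a v) = \<phi> x - \<phi> y"
        using xy(1,2) by (simp add: pq \<phi>_def s_simps algebra_simps)
      then have "p - p' = 0 \<and> q - q' = 0" using xy pq by (intro indep) auto
      then show "x = y" by (simp add: pq)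
    qed
    moreover have "\<phi> ` (K \<times> K) = M"
    proof
      show "M \<subseteq> \<phi> ` (K \<times> K)"
        using span by (fastforce simp: \<phi>_def)
    qed (auto simp: \<phi>_def)
    ultimately show "bij_betw \<phi> (K \<times> K) M" by (simp add: bij_betw_def)
    show "\<phi> ` grade2 K i = P i" for i
    proof
      show "\<phi> ` grade2 K i \<subseteq> P i"
        using bit_cases[of i] v by (auto simp: \<phi>_def grade2_def)
      show "P i \<subseteq> \<phi> ` grade2 K i"
      proof
        fix w assume w: "w \<in> P i"
        then obtain p q where pq: "p \<in> K" "q \<in> K" "w = s p v + s q (a v)" using span[of w] by auto
        have P: "s p v \<in> P 0" "s q (a v) \<in> P 1" using v pq by simp_all
        show "w \<in> \<phi> ` grade2 K i"
        proof (cases "i = 0")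
          case True
          then have "w = s p v"
            using homogeneous_sum_unique[of w 0 "s p v" "s q (a v)"] w P pq(3) by simp
          then have "w = \<phi> (p, 0)" by (simp add: \<phi>_def)
          then show ?thesis using True pq(1) by (auto simp: grade2_def)
        next
          case False
          then have "i = 1" using bit_cases by blast
          then have "w = s q (a v)"
            using homogeneous_sum_unique[of 0 w "s p v" "s q (a v)"] w P pq(3) by simp
          then have "w = \<phi> (0, q)" by (simp add: \<phi>_def)
          then show ?thesis using \<open>i = 1\<close> pq(2) by (auto simp: grade2_def)
        qed
      qed
    qed
    show "linear_on K scale2 (K \<times> K) s \<phi>"
      by (auto simp: linear_on_def \<phi>_def scale2_def s_simps algebra_simps)
  qed
  then show ?thesis
  proof (rule realized_isomorphic[OF R W])
    fix w assume "w \<in> carr ?X"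
    then obtain p q where w: "w = (p, q)" "p \<in> K" "q \<in> K"
      unfolding carr_X by auto
    then show "\<phi> (right2 \<alpha> w) = a (\<phi> w)"
      by (simp add: \<phi>_def right2_def ab_simps s_simps a_a algebra_simps)
    show "\<phi> (left2 \<rho> \<alpha> l w) = b (\<phi> w)"
      using w by (simp add: \<phi>_def left2_def ab_simps s_s v(3) b_a_v add.commute del: v_M)
  qed
qed

end

section \<open>Change of parity and restriction of scalars\<close>

lemma ab_irreducible_shift:
  assumes "ab_irreducible K s P a b"
  shows "ab_irreducible K s (\<lambda>i. P (i + 1)) a b"
proof -
  have M_eq: "carr \<lparr>scl = s, part = \<lambda>i. P (i + 1)\<rparr> = carr \<lparr>scl = s, part = P\<rparr>"
    by (auto simp: carr_def) (metis add.commute)+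
  have "{u + w | u w. u \<in> N \<inter> P (0 + 1) \<and> w \<in> N \<inter> P (1 + 1)} = {u + w | u w. u \<in> N \<inter> P 0 \<and> w \<in> N \<inter> P 1}" for N
    by auto (metis add.commute)+
  then show ?thesis
    using assms unfolding ab_irreducible_def ab_submodule_def M_eq by simp
qed

text \<open>
  The change of parity makes any given homogeneous vector even, so that isomorphisms to the explicit
  bimodules may be sought under the assumption that the distinguished generator is even.
\<close>

lemma even_representative:
  assumes R: "realized K s P a b l \<iota> W" and E: "eigen_module K s P a b l \<alpha>"
    and irr: "ab_irreducible K s P a b" and v: "v \<in> P i"
  obtains P' W' where "W' = W \<or> W' = parity_change (algA lam) W" "realized K s P' a b l \<iota> W'"
    "eigen_module K s P' a b l \<alpha>" "ab_irreducible K s P' a b" "v \<in> P' 0"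
proof (cases "i = 0")
  case True
  then show ?thesis using that[of W P] assms by blast
next
  case False
  then have i: "i = 1" using bit_cases by blast
  interpret eigen_module K s P a b l \<alpha> by fact
  have R': "realized K s (\<lambda>i. P (i + 1)) a b l \<iota> (parity_change (algA lam) W)"
    by (rule parity_change_realized[OF R])
  interpret R': realized K s "\<lambda>i. P (i + 1)" a b l \<iota> "parity_change (algA lam) W" by (rule R')
  have "carr \<lparr>scl = s, part = \<lambda>i. P (i + 1)\<rparr> = M"
    by (auto simp: carr_def) (metis add.commute)+
  then have "eigen_module K s (\<lambda>i. P (i + 1)) a b l \<alpha>"
    by unfold_locales (simp_all add: a_a)
  then show ?thesis
    using that[of "parity_change (algA lam) W" "\<lambda>i. P (i + 1)"] R' ab_irreducible_shift[OF irr] v i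
    by simp
qed

lemma restrict_realized:
  assumes "realized K s P a b (\<iota> lam) \<iota> W"
  shows "realized_over_ground (\<lambda>c. s (\<iota> c)) P a b lam (restrict_scalars \<iota> W)"
proof -
  interpret realized K s P a b "\<iota> lam" \<iota> W by fact
  note [simp] = field_embedding_hom[OF \<iota>]
  have \<iota>_2: "\<iota> (2 * lam) = 2 * \<iota> lam" by (simp only: mult_2 field_embedding_hom[OF \<iota>])
  have M_eq: "carr \<lparr>scl = (\<lambda>c. s (\<iota> c)), part = P\<rparr> = M" by (simp add: carr_def)
  have vs: "vspace_on UNIV (\<lambda>c. s (\<iota> c)) N" if "vspace_on K s N" for N
    using that by (auto simp: vspace_on_def)
  show ?thesis
  proof (unfold_locales, unfold M_eq)
    show "is_subfield UNIV" by (rule is_subfield_UNIV)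
    show "is_superspace UNIV \<lparr>scl = (\<lambda>c. s (\<iota> c)), part = P\<rparr>"
      using vs[OF vspace_M] vs[OF vspace_P] superspace unfolding is_superspace_def M_eq by simp
    show "linear_on UNIV (\<lambda>c. s (\<iota> c)) M (\<lambda>c. s (\<iota> c)) a" "linear_on UNIV (\<lambda>c. s (\<iota> c)) M (\<lambda>c. s (\<iota> c)) b"
      by (simp_all add: linear_on_def ab_simps)
    show "a w \<in> P (i + 1)" "b w \<in> P (i + 1)" if "w \<in> P i" for w i
      using that by (rule a_odd b_odd)+
    show "b (b w) = a (a w) - s (\<iota> (2 * lam)) w" "a (b w) = s (\<iota> lam) w - a (a w) - b (a w)" if "w \<in> M" for w
      using that unfolding \<iota>_2 by (rule b_b a_b)+
    show "realizes (\<lambda>c. c) (restrict_scalars \<iota> W) (\<lambda>c. s (\<iota> c)) P a b"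
      using realizes by (simp add: realizes_def restrict_scalars_def with_scl_def)
    show "field_embedding (\<lambda>c. c)"
      by (auto simp: field_embedding_def ring_hom_def)
  qed simp_all
qed

text \<open>
  An \<open>F\<close>-submodule is closed under \<open>a\<^sup>2\<close>, which is multiplication by \<open>\<alpha>\<close>, and hence under
  \<open>K = F[\<alpha>]\<close>.
\<close>

lemma restrict_irreducible:
  assumes E: "eigen_module (adjoin \<iota> \<alpha>) s P a b l \<alpha>" and \<iota>: "field_embedding \<iota>"
    and alg: "algebraic_elem \<iota> \<alpha>" and irr: "ab_irreducible (adjoin \<iota> \<alpha>) s P a b"
  shows "ab_irreducible UNIV (\<lambda>c. s (\<iota> c)) P a b"
proof -
  interpret eigen_module "adjoin \<iota> \<alpha>" s P a b l \<alpha> by fact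
  have [simp]: "\<iota> c \<in> adjoin \<iota> \<alpha>" for c by (rule adjoin_incl)
  have M_eq: "carr \<lparr>scl = (\<lambda>c. s (\<iota> c)), part = P\<rparr> = M" by (simp add: carr_def)
  show ?thesis
    unfolding ab_irreducible_def M_eq
  proof (intro conjI allI impI)
    show "M \<noteq> {0}" using irr by (simp add: ab_irreducible_def)
    fix N assume N: "ab_submodule UNIV (\<lambda>c. s (\<iota> c)) P a b N"
    have sub: "N \<subseteq> M" and vs: "vspace_on UNIV (\<lambda>c. s (\<iota> c)) N"
      and dec: "N = {u + w | u w. u \<in> N \<inter> P 0 \<and> w \<in> N \<inter> P 1}"
      and ab: "\<And>w. w \<in> N \<Longrightarrow> a w \<in> N" "\<And>w. w \<in> N \<Longrightarrow> b w \<in> N"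
      using N unfolding ab_submodule_def M_eq by auto
    have N0: "0 \<in> N" and add: "\<And>u w. u \<in> N \<Longrightarrow> w \<in> N \<Longrightarrow> u + w \<in> N"
      and sc: "\<And>c u. u \<in> N \<Longrightarrow> s (\<iota> c) u \<in> N"
      using vs by (auto simp: vspace_on_def)
    have ev_K [simp]: "eval_at \<iota> \<alpha> q \<in> adjoin \<iota> \<alpha>" for q
      by (simp add: adjoin_eq_range_eval_at[OF \<iota> alg])
    have "s (eval_at \<iota> \<alpha> q) u \<in> N" if u: "u \<in> N" for q u
    proof (induction q)
      case 0
      then show ?case using u sub N0 by (auto simp: eval_at_0[OF \<iota>])
    next
      case (pCons c q)
      have uM: "u \<in> M" using u sub by auto
      have "s (eval_at \<iota> \<alpha> (pCons c q)) u = s (\<iota> c) u + a (a (s (eval_at \<iota> \<alpha> q) u))"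
        using uM by (simp add: eval_at_pCons[OF \<iota>] s_add_left s_s a_a)
      then show ?case using pCons.IH u by (simp add: add sc ab)
    qed
    then have sK: "s k u \<in> N" if "u \<in> N" "k \<in> adjoin \<iota> \<alpha>" for k u
      using that by (auto simp: adjoin_eq_range_eval_at[OF \<iota> alg])
    have "ab_submodule (adjoin \<iota> \<alpha>) s P a b N"
    proof (rule ab_submoduleI)
      show "\<exists>u\<in>N \<inter> P 0. \<exists>v\<in>N \<inter> P 1. w = u + v" if "w \<in> N" for w
        using that dec by blast
    qed (use sub N0 add sK ab in auto)
    then show "N = {0} \<or> N = M" using irr by (simp add: ab_irreducible_def)
  qed
qed

section \<open>The classification\<close>

lemma converse_irreducible_alternative:
  assumes \<iota>: "field_embedding \<iota>" "algebraic_elem \<iota> \<alpha>"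
    and E: "eigen_module (adjoin \<iota> \<alpha>) s P a b (\<iota> lam) \<alpha>"
    and R: "realized (adjoin \<iota> \<alpha>) s P a b (\<iota> lam) \<iota> W"
    and irr: "ab_irreducible (adjoin \<iota> \<alpha>) s P a b"
  shows "irreducible_bimodule UNIV (algA lam) (restrict_scalars \<iota> W) \<and>
    alternative_bimodule UNIV (algA lam) (restrict_scalars \<iota> W)"
proof -
  interpret G: realized_over_ground "\<lambda>c. s (\<iota> c)" P a b lam "restrict_scalars \<iota> W"
    by (rule restrict_realized[OF R])
  show ?thesis
    using G.irreducible_iff G.alternative restrict_irreducible[OF E \<iota> irr] by simp
qed

text \<open>
  Multiplied by \<open>\<alpha>\<close>, the square of \<open>b - (\<epsilon>/\<alpha>)a\<close> is \<open>f(\<epsilon>)\<close>.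
\<close>

lemma root_slope:
  assumes "\<epsilon>\<^sup>2 + (\<alpha> - l) * \<epsilon> + \<alpha> * (\<alpha> - 2 * l) = 0" "\<alpha> \<noteq> (0 :: 'e::field)"
  shows "(\<epsilon> / \<alpha>)\<^sup>2 * \<alpha> - \<epsilon> / \<alpha> * (l - \<alpha>) + (\<alpha> - 2 * l) = 0"
proof -
  have "\<alpha> * ((\<epsilon> / \<alpha>)\<^sup>2 * \<alpha> - \<epsilon> / \<alpha> * (l - \<alpha>) + (\<alpha> - 2 * l)) =
      \<epsilon>\<^sup>2 + (\<alpha> - l) * \<epsilon> + \<alpha> * (\<alpha> - 2 * l)"
    using assms(2) by (simp add: power2_eq_square field_simps)
  then show ?thesis using assms by simp
qed

lemma converse_two_dim:
  assumes \<iota>: "field_embedding \<iota>" "algebraic_elem \<iota> \<alpha>" and "\<alpha> \<noteq> 0"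
    and root: "nonzero_root (adjoin \<iota> \<alpha>) (fpoly \<alpha> (\<iota> lam)) \<epsilon>"
  shows "irreducible_bimodule UNIV (algA lam) (restrict_scalars \<iota> (V11 (adjoin \<iota> \<alpha>) \<iota> \<epsilon> \<alpha> (\<iota> lam))) \<and>
    alternative_bimodule UNIV (algA lam) (restrict_scalars \<iota> (V11 (adjoin \<iota> \<alpha>) \<iota> \<epsilon> \<alpha> (\<iota> lam)))"
proof -
  let ?K = "adjoin \<iota> \<alpha>"
  have \<epsilon>: "\<epsilon> \<in> ?K" and f: "\<epsilon>\<^sup>2 + (\<alpha> - \<iota> lam) * \<epsilon> + \<alpha> * (\<alpha> - 2 * \<iota> lam) = 0"
    using root by (auto simp: nonzero_root_def eval_fpoly)
  have E: "eigen_module ?K scale2 (grade2 ?K) (right2 \<alpha>) (left2 (\<epsilon> / \<alpha>) \<alpha> (\<iota> lam)) (\<iota> lam) \<alpha>"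
    by (rule two_dim_eigen_module[OF is_subfield_adjoin _ _ _ root_slope[OF f \<open>\<alpha> \<noteq> 0\<close>]])
      (simp_all add: adjoin_incl \<epsilon> subfield_closed[OF is_subfield_adjoin])
  have range: "range \<iota> \<subseteq> ?K" using adjoin_incl by blast
  show ?thesis
    unfolding V11_two_dim[OF \<open>\<alpha> \<noteq> 0\<close>]
    by (rule converse_irreducible_alternative[OF \<iota> E realized_two_dim[OF E \<iota>(1) range]
          two_dim_irreducible[OF E \<open>\<alpha> \<noteq> 0\<close>]])
qed

lemma converse_four_dim:
  assumes \<iota>: "field_embedding \<iota>" "algebraic_elem \<iota> \<alpha>"
    and irr: "irreducible_over (adjoin \<iota> \<alpha>) (fpoly \<alpha> (\<iota> lam))"
  shows "irreducible_bimodule UNIV (algA lam) (restrict_scalars \<iota> (V22 (adjoin \<iota> \<alpha>) \<iota> \<alpha> (\<iota> lam))) \<and>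
    alternative_bimodule UNIV (algA lam) (restrict_scalars \<iota> (V22 (adjoin \<iota> \<alpha>) \<iota> \<alpha> (\<iota> lam)))"
proof -
  let ?K = "adjoin \<iota> \<alpha>"
  have root: "no_root ?K \<alpha> (\<iota> lam)"
    using irreducible_fpoly_no_root[OF is_subfield_adjoin _ _ _ irr]
    by (auto simp: no_root_def adjoin_incl)
  have E: "eigen_module ?K scale4 (grade4 ?K) (right4 \<alpha> (\<iota> lam)) (left4 \<alpha> (\<iota> lam)) (\<iota> lam) \<alpha>"
    by (rule four_dim_eigen_module[OF is_subfield_adjoin]) (simp_all add: adjoin_incl)
  have range: "range \<iota> \<subseteq> ?K" using adjoin_incl by blast
  show ?thesis
    by (rule converse_irreducible_alternative[OF \<iota> E realized_V22[OF E \<iota>(1) range]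
          four_dim_irreducible[OF E root]])
qed

lemma (in realized) scalar_extension_with_scl:
  assumes V: "\<And>c v. v \<in> M \<Longrightarrow> s (\<iota> c) v = scl V c v" and W: "W = with_scl s V"
  shows "scalar_extension K \<iota> (algA lam) V s"
proof -
  have carr_V: "carr V = M" and act_V: "lact V = lact W" "ract V = ract W"
    using carr_W unfolding W by (simp_all add: carr_def with_scl_def)
  have "is_superspace K W"
    using superspace unfolding is_superspace_def carr_W scl_W part_W by simp
  moreover have "linear_on K s M s (lact W z)" for z
    by (simp add: linear_on_def lact_add lact_s)
  moreover have "linear_on K s M s (\<lambda>v. ract W v z)" for z
    by (cases z) (simp add: linear_on_def ract_W s_simps ab_simps algebra_simps)
  ultimately show ?thesis
    by (simp add: scalar_extension_def carr_V act_V V flip: W)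
qed

lemma (in realized) act_x:
  assumes "w \<in> P i"
  shows "ract W w xA = a w" "psgn i (lact W xA w) = b w"
  using assms bit_cases[of i] lact_W[OF assms, of 0 1] ract_W[of w 0 1] field_embedding_hom[OF \<iota>]
  by auto

text \<open>
  The parity of the vector killed by \<open>b - \<rho>a\<close> cannot be prescribed; a change of parity makes it even.
\<close>

lemma up_to_parity_two_dim:
  assumes R: "realized K s P a b l \<iota> W" and E: "eigen_module K s P a b l \<alpha>"
    and irr: "ab_irreducible K s P a b" and \<alpha>_l: "\<alpha> \<noteq> l"
    and \<rho>: "\<rho> \<in> K" "\<rho>\<^sup>2 * \<alpha> - \<rho> * (l - \<alpha>) + (\<alpha> - 2 * l) = 0"
  shows "\<exists>W'. (W' = W \<or> W' = parity_change (algA lam) W) \<and>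
    isomorphic_bimodules K (algA lam) (two_dim K \<iota> \<rho> \<alpha> l) W'"
proof -
  obtain v i where v: "v \<in> P i" "v \<noteq> 0" "b v = s \<rho> (a v)"
    by (rule eigen_module.odd_root_vector[OF E irr \<rho>])
  obtain P' W' where W': "W' = W \<or> W' = parity_change (algA lam) W" "realized K s P' a b l \<iota> W'"
    "eigen_module K s P' a b l \<alpha>" "ab_irreducible K s P' a b" "v \<in> P' 0"
    by (rule even_representative[OF R E irr v(1)])
  then show ?thesis
    using eigen_module.isomorphic_two_dim[OF W'(3,2,4) \<rho> \<alpha>_l W'(5) v(2,3)] by blast
qed

lemma up_to_parity_four_dim:
  assumes R: "realized K s P a b l \<iota> W" and E: "eigen_module K s P a b l \<alpha>"
    and irr: "ab_irreducible K s P a b" and root: "no_root K \<alpha> l"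
  shows "\<exists>W'. (W' = W \<or> W' = parity_change (algA lam) W) \<and>
    (\<exists>act. right_supermodule K (Ualg K \<alpha> l) oneU W' act \<and>
      (\<forall>i. \<forall>w\<in>part W' i. act w aU = ract W' w xA \<and> act w bU = psgn i (lact W' xA w)) \<and>
      isomorphic_to_regular K (Ualg K \<alpha> l) W' act) \<and>
    isomorphic_bimodules K (algA lam) (V22 K \<iota> \<alpha> l) W'"
proof -
  interpret E0: eigen_module K s P a b l \<alpha> by fact
  obtain v i where v: "v \<in> P i" "v \<noteq> 0"
    by (rule E0.nonzero_homogeneous) (use irr in \<open>simp_all add: ab_irreducible_def\<close>)
  obtain P' W' where W': "W' = W \<or> W' = parity_change (algA lam) W" "realized K s P' a b l \<iota> W'"
    "eigen_module K s P' a b l \<alpha>" "ab_irreducible K s P' a b" "v \<in> P' 0"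
    by (rule even_representative[OF R E irr v(1)])
  interpret E: eigen_module K s P' a b l \<alpha> by (rule W'(3))
  interpret R: realized K s P' a b l \<iota> W' by (rule W'(2))
  have "E.act w aU = ract W' w xA \<and> E.act w bU = psgn i (lact W' xA w)" if "w \<in> part W' i" for i w
    using that R.act_x[of w i] by (auto simp: E.act_def E.comb_def)
  moreover have "isomorphic_to_regular K E.U W' E.act"
    unfolding isomorphic_to_regular_def carr_Ualg[OF E.subfield]
  proof (intro exI conjI ballI)
    show "superspace_iso K E.U W' (E.act v)"
      by (rule E.regular_iso[OF R.scl_W R.part_W W'(4) root W'(5) v(2)])
    show "E.act v (mul E.U u u') = E.act (E.act v u) u'"
      if "u \<in> K \<times> K \<times> K \<times> K" "u' \<in> K \<times> K \<times> K \<times> K" for u u'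
      using E.act_mult[OF E.P_M[OF W'(5)] that] .
  qed
  ultimately show ?thesis
    using W'(1) E.right_supermodule[OF R.scl_W R.part_W]
      E.isomorphic_V22[OF W'(2,4) root W'(5) v(2)]
    by (intro exI[of _ W'] conjI exI[of _ E.act] allI ballI) simp_all
qed

text \<open>
  The case \<open>\<alpha> = \<lambda>\<close> is excluded since then \<open>(vx)x = \<lambda>v\<close> for all \<open>v\<close>, and the bimodule is associative.
\<close>

lemma classification:
  fixes lam :: "'f::field" and V :: "('f, 'f \<times> 'f, 'v::ab_group_add) superbimodule"
  assumes alt: "alternative_bimodule UNIV (algA lam) V" and unital: "unital_bimodule oneA V"
    and irr: "irreducible_bimodule UNIV (algA lam) V"
    and nonassoc: "\<not> associative_bimodule (algA lam) V"
  obtains \<alpha> :: "'f alg_closure" and sc P a b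
  where "algebraic_elem to_ac \<alpha>" "\<alpha> \<noteq> to_ac lam"
    "scalar_extension (adjoin to_ac \<alpha>) to_ac (algA lam) V sc"
    "realized (adjoin to_ac \<alpha>) sc P a b (to_ac lam) to_ac (with_scl sc V)"
    "eigen_module (adjoin to_ac \<alpha>) sc P a b (to_ac lam) \<alpha>"
    "ab_irreducible (adjoin to_ac \<alpha>) sc P a b"
proof -
  let ?R = "\<lambda>w. ract V w xA"
  obtain b where R: "realized_over_ground (scl V) (part V) ?R b lam V"
    by (rule alternative_bimodule_realized[OF alt unital])
  interpret R: realized_over_ground "scl V" "part V" ?R b lam V by (rule R)
  interpret I: irreducible_x_module "scl V" "part V" ?R b lam
    by unfold_locales (rule R.irreducible_iff[THEN iffD1, OF irr])
  note [simp del] = R.scl_W R.part_W R.carr_W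
  obtain \<alpha> sc where \<alpha>: "algebraic_elem to_ac \<alpha>"
    and X: "x_module (adjoin to_ac \<alpha>) sc (part V) ?R b (to_ac lam)"
    and irr': "ab_irreducible (adjoin to_ac \<alpha>) sc (part V) ?R b"
    and a_a: "\<And>w. w \<in> R.M \<Longrightarrow> ?R (?R w) = sc \<alpha> w"
    and sc: "\<And>c w. w \<in> R.M \<Longrightarrow> sc (to_ac c) w = scl V c w"
    by (rule I.extended_scalars) blast
  interpret X: x_module "adjoin to_ac \<alpha>" sc "part V" ?R b "to_ac lam" by (rule X)
  have M_eq: "X.M = R.M" by (simp add: carr_def)
  have carr_V: "carr V = R.M" by (simp add: carr_def)
  have E: "eigen_module (adjoin to_ac \<alpha>) sc (part V) ?R b (to_ac lam) \<alpha>"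
    by unfold_locales (simp_all add: adjoin_incl a_a M_eq)
  have R': "realized (adjoin to_ac \<alpha>) sc (part V) ?R b (to_ac lam) to_ac (with_scl sc V)"
  proof unfold_locales
    show "realizes to_ac (with_scl sc V) sc (part V) ?R b"
      unfolding realizes_def
    proof (intro conjI ballI allI)
      fix u w c d assume uw: "u \<in> part V 0" "w \<in> part V 1"
      then have "u \<in> R.M" "w \<in> R.M" by auto
      then show "lact (with_scl sc V) (c, d) (u + w) = sc (to_ac c) (u + w) + sc (to_ac d) (b u - b w)"
        "ract (with_scl sc V) (u + w) (c, d) = sc (to_ac c) (u + w) + sc (to_ac d) (?R (u + w))"
        using R.lact_W_sum[OF uw, of c d] R.ract_W[of "u + w" c d] R.a_M[of "u + w"]
        by (simp_all add: with_scl_def sc)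
    qed (simp_all add: with_scl_def)
  qed (simp_all add: field_embedding_to_ac adjoin_incl)
  have "\<alpha> \<noteq> to_ac lam"
  proof
    assume "\<alpha> = to_ac lam"
    then have sq: "?R (?R w) = scl V lam w" if "w \<in> R.M" for w using a_a sc that by simp
    have "ract V (ract V w z) z' - ract V w (mul (algA lam) z z') = 0" if w: "w \<in> R.M" for w z z'
    proof -
      obtain c d c' d' where z: "z = (c, d)" "z' = (c', d')" by (metis surj_pair)
      have "ract V w z = scl V c w + scl V d (?R w)"
        unfolding z using w by (rule R.ract_W)
      moreover have "ract V (scl V c w + scl V d (?R w)) z' =
          scl V c' (scl V c w + scl V d (?R w)) + scl V d' (?R (scl V c w + scl V d (?R w)))"
        unfolding z using w by (intro R.ract_W) simp
      moreover have "ract V w (mul (algA lam) z z') =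
          scl V (c * c' + lam * (d * d')) w + scl V (c * d' + d * c') (?R w)"
        unfolding z algA_simps using w by (rule R.ract_W)
      ultimately show ?thesis
        using w by (simp add: R.s_simps R.a_add R.a_s sq algebra_simps)
    qed
    then have "associative_bimodule (algA lam) V"
      by (simp add: associative_bimodule_def carr_V)
    then show False using nonassoc by simp
  qed
  moreover have "scalar_extension (adjoin to_ac \<alpha>) to_ac (algA lam) V sc"
    by (rule realized.scalar_extension_with_scl[OF R']) (simp_all add: sc M_eq)
  ultimately show ?thesis using that \<alpha> R' E irr' by blast
qed

theorem theorem5p1:
  fixes lam :: "'f::field"
    and V :: "('f, 'f \<times> 'f, 'v::ab_group_add) superbimodule"
  shows
  "(alternative_bimodule UNIV (algA lam) V \<and> unital_bimodule oneA V \<and>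
    irreducible_bimodule UNIV (algA lam) V \<and> faithful_bimodule (algA lam) V \<and>
    \<not> associative_bimodule (algA lam) V
    \<longrightarrow>
    (\<exists>(\<alpha>::'f alg_closure) sc.
       let K = adjoin to_ac \<alpha>; l = to_ac lam; VK = with_scl sc V;
           up_to_parity = (\<lambda>P. P VK \<or> P (parity_change (algA lam) VK))
       in
       algebraic_elem to_ac \<alpha> \<and> \<alpha> \<noteq> l \<and>
       scalar_extension K to_ac (algA lam) V sc \<and>
       (\<exists>n\<le>4. has_dim K sc (carr V) n) \<and>
       (\<forall>\<epsilon>. nonzero_root K (fpoly \<alpha> l) \<epsilon> \<longrightarrow>
          up_to_parity (\<lambda>W.
            (\<alpha> \<noteq> 0 \<longrightarrow> isomorphic_bimodules K (algA lam) (V11 K to_ac \<epsilon> \<alpha> l) W) \<and>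
            (\<alpha> = 0 \<longrightarrow> isomorphic_bimodules K (algA lam) (V11_zero K to_ac l) W))) \<and>
       (irreducible_over K (fpoly \<alpha> l) \<longrightarrow>
          graded_division_algebra K (Ualg K \<alpha> l) oneU \<and>
          has_dim K sc (carr V) 4 \<and>
          up_to_parity (\<lambda>W.
            (\<exists>act. right_supermodule K (Ualg K \<alpha> l) oneU W act \<and>
               (\<forall>i. \<forall>w\<in>part W i. act w aU = ract W w xA \<and> act w bU = psgn i (lact W xA w)) \<and>
               isomorphic_to_regular K (Ualg K \<alpha> l) W act) \<and>
            isomorphic_bimodules K (algA lam) (V22 K to_ac \<alpha> l) W))))
   \<and>
   (\<forall>(\<iota>::'f \<Rightarrow> 'e::field) \<alpha>.
      let K = adjoin \<iota> \<alpha>; l = \<iota> lam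
      in
      field_embedding \<iota> \<and> algebraic_elem \<iota> \<alpha> \<and> \<alpha> \<noteq> l \<longrightarrow>
      (\<forall>\<epsilon>. \<alpha> \<noteq> 0 \<and> nonzero_root K (fpoly \<alpha> l) \<epsilon> \<longrightarrow>
         irreducible_bimodule UNIV (algA lam) (restrict_scalars \<iota> (V11 K \<iota> \<epsilon> \<alpha> l)) \<and>
         alternative_bimodule UNIV (algA lam) (restrict_scalars \<iota> (V11 K \<iota> \<epsilon> \<alpha> l))) \<and>
      (irreducible_over K (fpoly \<alpha> l) \<longrightarrow>
         irreducible_bimodule UNIV (algA lam) (restrict_scalars \<iota> (V22 K \<iota> \<alpha> l)) \<and>
         alternative_bimodule UNIV (algA lam) (restrict_scalars \<iota> (V22 K \<iota> \<alpha> l))))"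
  (is "(?hyps \<longrightarrow> ?classified) \<and> ?converse")
proof (intro conjI impI)
  assume "alternative_bimodule UNIV (algA lam) V \<and> unital_bimodule oneA V \<and>
    irreducible_bimodule UNIV (algA lam) V \<and> faithful_bimodule (algA lam) V \<and>
    \<not> associative_bimodule (algA lam) V"
  then obtain \<alpha> :: "'f alg_closure" and sc P a b
    where \<alpha>: "algebraic_elem to_ac \<alpha>" "\<alpha> \<noteq> to_ac lam"
      and ext: "scalar_extension (adjoin to_ac \<alpha>) to_ac (algA lam) V sc"
      and R: "realized (adjoin to_ac \<alpha>) sc P a b (to_ac lam) to_ac (with_scl sc V)"
      and E: "eigen_module (adjoin to_ac \<alpha>) sc P a b (to_ac lam) \<alpha>"
      and irr: "ab_irreducible (adjoin to_ac \<alpha>) sc P a b"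
    using classification[of lam V] by blast
  let ?K = "adjoin to_ac \<alpha>" and ?l = "to_ac lam"
  interpret E: eigen_module ?K sc P a b ?l \<alpha> by (rule E)
  interpret R: realized ?K sc P a b ?l to_ac "with_scl sc V" by (rule R)
  have carr_V: "carr V = E.M"
    using R.carr_W by (simp add: carr_def with_scl_def)
  note cl = subfield_closed[OF is_subfield_adjoin]
  have two: "isomorphic_bimodules ?K (algA lam) (two_dim ?K to_ac \<rho> \<alpha> ?l) (with_scl sc V) \<or>
      isomorphic_bimodules ?K (algA lam) (two_dim ?K to_ac \<rho> \<alpha> ?l) (parity_change (algA lam) (with_scl sc V))"
    and dim2: "has_dim ?K sc (carr V) 2"
    if \<rho>: "\<rho> \<in> ?K" "\<rho>\<^sup>2 * \<alpha> - \<rho> * (?l - \<alpha>) + (\<alpha> - 2 * ?l) = 0" for \<rho>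
  proof -
    show "isomorphic_bimodules ?K (algA lam) (two_dim ?K to_ac \<rho> \<alpha> ?l) (with_scl sc V) \<or>
      isomorphic_bimodules ?K (algA lam) (two_dim ?K to_ac \<rho> \<alpha> ?l) (parity_change (algA lam) (with_scl sc V))"
      using up_to_parity_two_dim[OF R E irr \<alpha>(2) \<rho>] by blast
    obtain v i where v: "v \<in> P i" "v \<noteq> 0" "b v = sc \<rho> (a v)"
      by (rule E.odd_root_vector[OF irr \<rho>])
    show "has_dim ?K sc (carr V) 2"
      unfolding carr_V by (rule E.dim_2[OF irr \<rho>(1) v \<alpha>(2)])
  qed
  have slope: "\<epsilon> / \<alpha> \<in> ?K" "(\<epsilon> / \<alpha>)\<^sup>2 * \<alpha> - \<epsilon> / \<alpha> * (?l - \<alpha>) + (\<alpha> - 2 * ?l) = 0"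
    if "nonzero_root ?K (fpoly \<alpha> ?l) \<epsilon>" "\<alpha> \<noteq> 0" for \<epsilon>
    using that root_slope[of \<epsilon> \<alpha> ?l] cl(8)[of \<epsilon> to_ac \<alpha> \<alpha>] E.\<alpha>_K
    by (auto simp: nonzero_root_def eval_fpoly)
  have slope_0: "- 2 \<in> ?K" "(- 2)\<^sup>2 * \<alpha> - (- 2) * (?l - \<alpha>) + (\<alpha> - 2 * ?l) = 0" if "\<alpha> = 0"
    using that cl(5)[OF cl(9)] by auto
  have dim4: "has_dim ?K sc (carr V) 4" if root: "no_root ?K \<alpha> ?l"
  proof -
    obtain v i where "v \<in> P i" "v \<noteq> 0"
      by (rule E.nonzero_homogeneous) (use irr in \<open>simp_all add: ab_irreducible_def\<close>)
    then show ?thesis unfolding carr_V by (rule E.dim_4[OF irr root])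
  qed
  have dim: "\<exists>n\<le>4. has_dim ?K sc (carr V) n"
  proof (cases "\<exists>\<epsilon>. nonzero_root ?K (fpoly \<alpha> ?l) \<epsilon>")
    case True
    then have "has_dim ?K sc (carr V) 2"
      using dim2[OF slope] dim2[OF slope_0] by (cases "\<alpha> = 0") auto
    then show ?thesis by (intro exI[of _ 2]) simp
  next
    case False
    then show ?thesis using dim4 no_root_iff[OF E.subfield E.\<alpha>_K E.l_K \<alpha>(2)] by blast
  qed
  have no_root: "no_root ?K \<alpha> ?l" if "irreducible_over ?K (fpoly \<alpha> ?l)"
    using irreducible_fpoly_no_root[OF E.subfield E.\<alpha>_K E.l_K _ that] by (simp add: no_root_def)
  show "?classified"
    unfolding Let_def
  proof (intro exI[of _ \<alpha>] exI[of _ sc] conjI allI impI)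
    fix \<epsilon> assume \<epsilon>: "nonzero_root ?K (fpoly \<alpha> ?l) \<epsilon>"
    show "((\<alpha> \<noteq> 0 \<longrightarrow> isomorphic_bimodules ?K (algA lam) (V11 ?K to_ac \<epsilon> \<alpha> ?l) (with_scl sc V)) \<and>
        (\<alpha> = 0 \<longrightarrow> isomorphic_bimodules ?K (algA lam) (V11_zero ?K to_ac ?l) (with_scl sc V))) \<or>
      ((\<alpha> \<noteq> 0 \<longrightarrow> isomorphic_bimodules ?K (algA lam) (V11 ?K to_ac \<epsilon> \<alpha> ?l)
          (parity_change (algA lam) (with_scl sc V))) \<and>
        (\<alpha> = 0 \<longrightarrow> isomorphic_bimodules ?K (algA lam) (V11_zero ?K to_ac ?l)
          (parity_change (algA lam) (with_scl sc V))))"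
      using two[OF slope[OF \<epsilon>]] two[OF slope_0] by (cases "\<alpha> = 0") (simp_all add: V11_two_dim V11_zero_two_dim)
  next
    assume irr_f: "irreducible_over ?K (fpoly \<alpha> ?l)"
    note root = no_root[OF irr_f]
    show "graded_division_algebra ?K (Ualg ?K \<alpha> ?l) oneU"
      by (rule Ualg_graded_division[OF E.subfield E.\<alpha>_K E.l_K root])
    show "has_dim ?K sc (carr V) 4" by (rule dim4[OF root])
    show "(\<exists>act. right_supermodule ?K (Ualg ?K \<alpha> ?l) oneU (with_scl sc V) act \<and>
           (\<forall>i. \<forall>w\<in>part (with_scl sc V) i. act w aU = ract (with_scl sc V) w xA \<and>
             act w bU = psgn i (lact (with_scl sc V) xA w)) \<and>
           isomorphic_to_regular ?K (Ualg ?K \<alpha> ?l) (with_scl sc V) act) \<and>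
         isomorphic_bimodules ?K (algA lam) (V22 ?K to_ac \<alpha> ?l) (with_scl sc V) \<or>
       (\<exists>act. right_supermodule ?K (Ualg ?K \<alpha> ?l) oneU (parity_change (algA lam) (with_scl sc V)) act \<and>
           (\<forall>i. \<forall>w\<in>part (parity_change (algA lam) (with_scl sc V)) i.
             act w aU = ract (parity_change (algA lam) (with_scl sc V)) w xA \<and>
             act w bU = psgn i (lact (parity_change (algA lam) (with_scl sc V)) xA w)) \<and>
           isomorphic_to_regular ?K (Ualg ?K \<alpha> ?l) (parity_change (algA lam) (with_scl sc V)) act) \<and>
         isomorphic_bimodules ?K (algA lam) (V22 ?K to_ac \<alpha> ?l) (parity_change (algA lam) (with_scl sc V))"
      using up_to_parity_four_dim[OF R E irr root] by blast
  qed (fact \<alpha> ext dim)+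
next
  show ?converse
    unfolding Let_def using converse_two_dim converse_four_dim by blast
qed

end
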